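(* Let $k\geq1$ and $\lambda,\mu\in\mathbb{C}$. (i) If $(\lambda,\mu)\neq(0,1)$, then the algebra $\mathcal{I}^k_{\lambda,\mu}(\mathbb{R})$ is isomorphic to $\mathcal{I}^k_{\lambda,\mu}(S^1)$. (ii) If $(\lambda,\mu)=(0,1)$, then $\mathcal{I}^k_{0,1}(\mathbb{R})\cong\mathfrak{t}_2\oplus\mathbb{R}^2$ for $k\geq3$, $\mathcal{I}^2_{0,1}(\mathbb{R})\cong\mathfrak{t}_2\oplus\mathbb{R}$, and $\mathcal{I}^1_{0,1}(\mathbb{R})\cong\mathfrak{t}_2$.
   Context: For a one-dimensional manifold $M\in\{S^1,\mathbb{R}\}$ and $\lambda\in\mathbb{C}$, $\mathcal{F}_\lambda(M)$ denotes the space of smooth $\lambda$-densities $\phi(x)(dx)^\lambda$ on $M$, with $\mathrm{Diff}(M)$-action $\rho^\lambda_{f^{-1}}:\phi(x)(dx)^\lambda\mapsto (f'(x))^\lambda\phi(f(x))(dx)^\lambda$. $\mathcal{D}^k_{\lambda,\mu}(M)$ is the space of linear differential operators $A=\sum_{i=0}^k a_i(x)\frac{d^i}{dx^i}:\mathcal{F}_\lambda(M)\to\mathcal{F}_\mu(M)$ of order $\le k$, with $\mathrm{Diff}(M)$-action $A\mapsto\rho^\mu_f\circ A\circ\rho^\lambda_{f^{-1}}$. $\mathcal{I}^k_{\lambda,\mu}(M)$ is the associative algebra of all linear maps $\mathcal{D}^k_{\lambda,\mu}(M)\to\mathcal{D}^k_{\lambda,\mu}(M)$ commuting with the $\mathrm{Diff}(M)$-action.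 $\mathbb{R}^n$ is the commutative algebra $\mathbb{R}\oplus\cdots\oplus\mathbb{R}$ ($n$ copies); $\mathfrak{t}_2$ is the algebra of lower triangular real $2\times2$ matrices.
   Formalization: Part (i) is proved for complex-valued densities and complex-linear maps, part (ii) for real-valued densities and real-linear maps, since a complex algebra cannot be isomorphic to t_2⊕R^n; Diff(M) is the orientation-preserving group, so that (f')^λ is defined. *)

theory Defs
  imports "HOL-Analysis.Analysis"
begin

fun nderiv :: "nat \<Rightarrow> (real \<Rightarrow> 'a::real_normed_vector) \<Rightarrow> real \<Rightarrow> 'a" where
  "nderiv 0 f = f"
| "nderiv (Suc n) f = (\<lambda>x. vector_derivative (nderiv n f) (at x))"

definition smooth :: "(real \<Rightarrow> 'a::real_normed_vector) \<Rightarrow> bool" where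
  "smooth f \<longleftrightarrow> (\<forall>n x. nderiv n f differentiable (at x))"

text \<open>S^1 = R/Z: functions on S^1 are 1-periodic functions on R; orientation preserving
  diffeomorphisms of S^1 are represented by their lifts f with f(x+1) = f(x)+1.\<close>
datatype mfd = Circle | Line

definition fn_space :: "mfd \<Rightarrow> (real \<Rightarrow> 'k::real_normed_field) set" where
  "fn_space M = {\<phi>. smooth \<phi> \<and> (M = Circle \<longrightarrow> (\<forall>x. \<phi> (x + 1) = \<phi> x))}"

definition Diffeo :: "mfd \<Rightarrow> (real \<Rightarrow> real) set" where
  "Diffeo M = {f. smooth f \<and> bij f \<and> smooth (inv f) \<and> (\<forall>x. deriv f x > 0)
                  \<and> (M = Circle \<longrightarrow> (\<forall>x. f (x + 1) = f x + 1))}"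

text \<open>rho lam g phi = (g')^lam * (phi o g); thus rho^lam_{f^-1} = rho lam f and
  rho^lam_f = rho lam (inv f).\<close>
definition rho :: "'k::{real_normed_field,ln} \<Rightarrow> (real \<Rightarrow> real) \<Rightarrow> (real \<Rightarrow> 'k) \<Rightarrow> real \<Rightarrow> 'k" where
  "rho lam g \<phi> = (\<lambda>x. (of_real (deriv g x)) powr lam * \<phi> (g x))"

type_synonym 'k dop = "(real \<Rightarrow> 'k) \<Rightarrow> (real \<Rightarrow> 'k)"

text \<open>D^k(M): operators sum_{i<=k} a_i d^i/dx^i with smooth coefficients (periodic on S^1),
  represented as maps on functions, normalised to 0 outside the space of densities.\<close>
definition Dops :: "nat \<Rightarrow> mfd \<Rightarrow> ('k::{real_normed_field}) dop set" where
  "Dops k M = {A. \<exists>a. (\<forall>i\<le>k. a i \<in> fn_space M) \<and>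
      A = (\<lambda>\<phi>. if \<phi> \<in> fn_space M then (\<lambda>x. \<Sum>i\<le>k. a i x * nderiv i \<phi> x) else (\<lambda>x. 0))}"

definition act :: "'k::{real_normed_field,ln} \<Rightarrow> 'k \<Rightarrow> mfd \<Rightarrow> (real \<Rightarrow> real) \<Rightarrow> 'k dop \<Rightarrow> 'k dop" where
  "act lam mu M f A = (\<lambda>\<phi>. if \<phi> \<in> fn_space M then rho mu (inv f) (A (rho lam f \<phi>)) else (\<lambda>x. 0))"

definition op_add :: "'k::real_normed_field dop \<Rightarrow> 'k dop \<Rightarrow> 'k dop" where
  "op_add A B = (\<lambda>\<phi> x. A \<phi> x + B \<phi> x)"

definition op_smult :: "'k::real_normed_field \<Rightarrow> 'k dop \<Rightarrow> 'k dop" where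
  "op_smult c A = (\<lambda>\<phi> x. c * A \<phi> x)"

record ('s, 'a) kalg =
  acar :: "'a set"
  aadd :: "'a \<Rightarrow> 'a \<Rightarrow> 'a"
  amul :: "'a \<Rightarrow> 'a \<Rightarrow> 'a"
  asmul :: "'s \<Rightarrow> 'a \<Rightarrow> 'a"

definition alg_isomorphic :: "('s, 'a) kalg \<Rightarrow> ('s, 'b) kalg \<Rightarrow> bool" where
  "alg_isomorphic A B \<longleftrightarrow> (\<exists>h. bij_betw h (acar A) (acar B) \<and>
     (\<forall>x\<in>acar A. \<forall>y\<in>acar A. h (aadd A x y) = aadd B (h x) (h y) \<and>
                              h (amul A x y) = amul B (h x) (h y)) \<and>
     (\<forall>c. \<forall>x\<in>acar A. h (asmul A c x) = asmul B c (h x)))"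

definition Iset :: "nat \<Rightarrow> 'k::{real_normed_field,ln} \<Rightarrow> 'k \<Rightarrow> mfd \<Rightarrow> ('k dop \<Rightarrow> 'k dop) set" where
  "Iset k lam mu M = {T. T \<in> extensional (Dops k M) \<and> (\<forall>A\<in>Dops k M. T A \<in> Dops k M) \<and>
      (\<forall>A\<in>Dops k M. \<forall>B\<in>Dops k M. T (op_add A B) = op_add (T A) (T B)) \<and>
      (\<forall>c. \<forall>A\<in>Dops k M. T (op_smult c A) = op_smult c (T A)) \<and>
      (\<forall>f\<in>Diffeo M. \<forall>A\<in>Dops k M. T (act lam mu M f A) = act lam mu M f (T A))}"

definition Ialg :: "nat \<Rightarrow> 'k::{real_normed_field,ln} \<Rightarrow> 'k \<Rightarrow> mfd \<Rightarrow> ('k, 'k dop \<Rightarrow> 'k dop) kalg" where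
  "Ialg k lam mu M = \<lparr> acar = Iset k lam mu M,
     aadd = (\<lambda>S T. restrict (\<lambda>A. op_add (S A) (T A)) (Dops k M)),
     amul = (\<lambda>S T. compose (Dops k M) S T),
     asmul = (\<lambda>c T. restrict (\<lambda>A. op_smult c (T A)) (Dops k M)) \<rparr>"

text \<open>t_2 = real lower triangular 2x2 matrices (M $ i $ j is row i, column j; indices 0,1),
  R^n = functions nat => real supported in {..<n} with componentwise operations.\<close>
definition t2_plus_Rn :: "nat \<Rightarrow> (real, (real^2^2) \<times> (nat \<Rightarrow> real)) kalg" where
  "t2_plus_Rn n = \<lparr> acar = {(M, v). M $ 0 $ 1 = 0 \<and> (\<forall>i\<ge>n. v i = 0)},
     aadd = (\<lambda>(M, v) (N, w). (M + N, \<lambda>i. v i + w i)),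
     amul = (\<lambda>(M, v) (N, w). (M ** N, \<lambda>i. v i * w i)),
     asmul = (\<lambda>c (M, v). (c *\<^sub>R M, \<lambda>i. c * v i)) \<rparr>"

end

theory Submission
  imports Defs
begin

text \<open>
  Replace operators by their coefficient families and let T be an equivariant endomorphism. The first
  point is that T is local. On the line, an operator A supported on one side of x0 equals B - fB for a
  diffeomorphism f that is the identity near x0 and pushes the rest to infinity (sum the translates of
  A), and T(B - fB) vanishes at x0. On the circle, if \<lambda> \<noteq> \<mu>, then T A, where A vanishes, is an
  operator invariant under all local diffeomorphisms, and only multiples of d/dx for (0, 1) are left.
  If \<lambda> = \<mu>, operators vanishing near x0 are, by induction on the order, combinations of differences
  B - fB with f the identity near x0 and of differences f d^n - g d^n with f and g of the same germ at
  x0; the symbols of the latter are controlled by the total mass of the densities (f^-1)' and (g^-1)'.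
  For local T, restriction to periodic coefficients is an isomorphism in case (i), because germs of
  functions and of diffeomorphisms extend from the line to the circle.

  For (0, 1), every positive symbol of order n other than 1 is the symbol of some f d^n, and every
  increasing function times d is some f (x d). So T is determined by T(d^n) = c_n d^n and
  T(x d) = c_1 x d + e, and c_n vanishes for n at least 4 when T kills lower orders. The remaining
  scalars c_0, c_1, e, c_2, c_3 are realised by the identity, the formal adjoint A*, the zeroth
  coefficient, A(1) - A*(1), and b d where b' = A(1) - A*(1).
\<close>

text \<open>The pair (0, 1) is excluded from the first claim because the circle really differs
  there: A(1) is a 1-density, so A can be sent to its integral times the invariant operator d, and
  this map is not local. For equal weights on the circle nothing can be pushed to infinity. What
  helps is that the only global datum of a positive density on the circle is its total mass:
  densities with the same mass and the same germ at x0 give diffeomorphisms with the same germ, so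
  their symbols cannot be told apart at x0. The bound 4 on the order comes from comparing (2m choose
  m) with (m+1)! for m = n - 1. The two numbers agree for n = 2 and n = 3, which leaves room for c_2
  and c_3, and they differ from n = 4 on. Weights are complex in the first claim and scalars are
  real in the second, so most of the development is generic in the field.\<close>

section \<open>Calculus of smooth functions of a real variable\<close>

abbreviation vd :: "(real \<Rightarrow> 'a::real_normed_vector) \<Rightarrow> real \<Rightarrow> 'a"
  where "vd f \<equiv> (\<lambda>x. vector_derivative f (at x))"

lemma nderiv_vd: "nderiv n (vd f) = nderiv (Suc n) f"
  by (induction n) simp_all

text \<open>Peels off the first derivative, whereas \<open>nderiv\<close> adds a last one. Closure
  under products and composition then follows by induction on n with the functions
  generalised.\<close>

fun smooth_upto :: "nat \<Rightarrow> (real \<Rightarrow> 'a::real_normed_vector) \<Rightarrow> bool" where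
  "smooth_upto 0 f = True"
| "smooth_upto (Suc n) f = ((\<forall>x. f differentiable at x) \<and> smooth_upto n (vd f))"

lemma smooth_upto_iff: "smooth_upto n f \<longleftrightarrow> (\<forall>m<n. \<forall>x. nderiv m f differentiable at x)"
proof (induction n arbitrary: f)
  case (Suc n)
  show ?case
    unfolding smooth_upto.simps(2) Suc nderiv_vd by (auto simp: less_Suc_eq_0_disj)
qed simp

lemma smooth_iff_upto: "smooth f \<longleftrightarrow> (\<forall>n. smooth_upto n f)"
  unfolding smooth_def smooth_upto_iff by blast

lemma smooth_iff_vd: "smooth f \<longleftrightarrow> (\<forall>x. f differentiable at x) \<and> smooth (vd f)"
  unfolding smooth_iff_upto by (metis smooth_upto.simps not0_implies_Suc)

lemma smooth_differentiable: "smooth f \<Longrightarrow> f differentiable at x"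
  using smooth_iff_vd by blast

lemma smooth_has_vector_derivative: "smooth f \<Longrightarrow> (f has_vector_derivative vd f x) (at x)"
  using smooth_differentiable vector_derivative_works by blast

lemma smooth_nderiv: "smooth f \<Longrightarrow> smooth (nderiv n f)"
  using smooth_iff_vd by (induction n) auto

lemma smooth_vd: "smooth f \<Longrightarrow> smooth (vd f)"
  using smooth_iff_vd by blast

lemma smooth_isCont: "smooth f \<Longrightarrow> isCont f x"
  by (simp add: smooth_differentiable differentiable_imp_continuous_within)

lemma smooth_continuous_on: "smooth f \<Longrightarrow> continuous_on S f"
  by (simp add: smooth_isCont continuous_at_imp_continuous_on)

lemma smooth_upto_SucD: "smooth_upto (Suc n) f \<Longrightarrow> smooth_upto n f"
  by (auto simp: smooth_upto_iff)

lemma smooth_upto_SucI: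
  assumes "\<And>x. (f has_vector_derivative g x) (at x)" "smooth_upto n g"
  shows "smooth_upto (Suc n) f"
proof -
  have "vd f = g" using assms(1) vector_derivative_at by blast
  then show ?thesis using assms by (auto intro: differentiableI_vector simp: smooth_upto.simps(2))
qed

lemma smooth_upto_SucE:
  assumes "smooth_upto (Suc n) f"
  shows "(f has_vector_derivative vd f x) (at x)" "smooth_upto n (vd f)"
  using assms by (auto simp: vector_derivative_works[symmetric] smooth_upto.simps(2))

declare smooth_upto.simps(2) [simp del]

lemma smooth_upto_const: "smooth_upto n (\<lambda>x. c)"
  by (induction n arbitrary: c) (auto simp: smooth_upto.simps(2))

lemma smooth_upto_add: "smooth_upto n f \<Longrightarrow> smooth_upto n g \<Longrightarrow> smooth_upto n (\<lambda>x. f x + g x)"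
proof (induction n arbitrary: f g)
  case (Suc n)
  show ?case
    by (rule smooth_upto_SucI[where g="\<lambda>x. vd f x + vd g x"])
       (intro has_vector_derivative_add smooth_upto_SucE(1)[OF Suc.prems(1)] smooth_upto_SucE(1)[OF Suc.prems(2)]
         smooth_upto_SucE(2)[OF Suc.prems(1)] smooth_upto_SucE(2)[OF Suc.prems(2)] Suc.IH)+
qed simp

lemma smooth_upto_mult:
  fixes f g :: "real \<Rightarrow> 'a::real_normed_algebra"
  shows "smooth_upto n f \<Longrightarrow> smooth_upto n g \<Longrightarrow> smooth_upto n (\<lambda>x. f x * g x)"
proof (induction n arbitrary: f g)
  case (Suc n)
  show ?case
  proof (rule smooth_upto_SucI[where g="\<lambda>x. f x * vd g x + vd f x * g x"])
    show "((\<lambda>x. f x * g x) has_vector_derivative f x * vd g x + vd f x * g x) (at x)" for x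
      using Suc.prems smooth_upto_SucE by (auto intro!: has_vector_derivative_mult)
    show "smooth_upto n (\<lambda>x. f x * vd g x + vd f x * g x)"
      by (intro smooth_upto_add Suc.IH smooth_upto_SucE(2) Suc.prems smooth_upto_SucD)
  qed
qed simp

lemma smooth_upto_of_real:
  "smooth_upto n f \<Longrightarrow> smooth_upto n (\<lambda>x. of_real (f x) :: 'a::real_normed_algebra_1)"
proof (induction n arbitrary: f)
  case (Suc n)
  show ?case
    by (rule smooth_upto_SucI[where g="\<lambda>x. of_real (vd f x)"])
       (simp_all add: has_vector_derivative_of_real has_real_derivative_iff_has_vector_derivative
          Suc.IH smooth_upto_SucE[OF Suc.prems])
qed simp

lemma smooth_upto_compose:
  fixes f :: "real \<Rightarrow> real" and g :: "real \<Rightarrow> 'a::real_normed_algebra_1"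
  shows "smooth_upto n f \<Longrightarrow> smooth_upto n g \<Longrightarrow> smooth_upto n (\<lambda>x. g (f x))"
proof (induction n arbitrary: f g)
  case (Suc n)
  show ?case
  proof (rule smooth_upto_SucI[where g="\<lambda>x. of_real (vd f x) * vd g (f x)"])
    show "((\<lambda>x. g (f x)) has_vector_derivative of_real (vd f x) * vd g (f x)) (at x)" for x
      using vector_diff_chain_at[OF smooth_upto_SucE(1)[OF Suc.prems(1)] smooth_upto_SucE(1)[OF Suc.prems(2)]]
      by (simp add: o_def scaleR_conv_of_real)
    have "smooth_upto n (\<lambda>x. vd g (f x))"
      by (rule Suc.IH) (use Suc.prems smooth_upto_SucD smooth_upto_SucE in blast)+
    then show "smooth_upto n (\<lambda>x. of_real (vd f x) * vd g (f x))"
      using Suc.prems smooth_upto_SucE(2) by (intro smooth_upto_mult smooth_upto_of_real) blast+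
  qed
qed simp

named_theorems smooth_intros

lemma smooth_const [smooth_intros]: "smooth (\<lambda>x. c)"
  by (simp add: smooth_iff_upto smooth_upto_const)

lemma smooth_ident [smooth_intros]: "smooth (\<lambda>x::real. x)"
  by (subst smooth_iff_vd) (simp add: smooth_const)

lemma smooth_add [smooth_intros]: "smooth f \<Longrightarrow> smooth g \<Longrightarrow> smooth (\<lambda>x. f x + g x)"
  by (simp add: smooth_iff_upto smooth_upto_add)

lemma smooth_mult [smooth_intros]:
  fixes f g :: "real \<Rightarrow> 'a::real_normed_algebra"
  shows "smooth f \<Longrightarrow> smooth g \<Longrightarrow> smooth (\<lambda>x. f x * g x)"
  by (simp add: smooth_iff_upto smooth_upto_mult)

lemma smooth_of_real [smooth_intros]:
  "smooth f \<Longrightarrow> smooth (\<lambda>x. of_real (f x) :: 'a::real_normed_algebra_1)"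
  by (simp add: smooth_iff_upto smooth_upto_of_real)

lemma smooth_compose:
  fixes f :: "real \<Rightarrow> real" and g :: "real \<Rightarrow> 'a::real_normed_algebra_1"
  shows "smooth g \<Longrightarrow> smooth f \<Longrightarrow> smooth (\<lambda>x. g (f x))"
  by (simp add: smooth_iff_upto smooth_upto_compose)

lemma smooth_minus [smooth_intros]:
  fixes f :: "real \<Rightarrow> 'a::real_normed_algebra_1"
  shows "smooth f \<Longrightarrow> smooth (\<lambda>x. - f x)"
  using smooth_mult[OF smooth_const[of "-1"], of f] by simp

lemma smooth_diff [smooth_intros]:
  fixes f :: "real \<Rightarrow> 'a::real_normed_algebra_1"
  shows "smooth f \<Longrightarrow> smooth g \<Longrightarrow> smooth (\<lambda>x. f x - g x)"
  using smooth_add[of f "\<lambda>x. - g x"] smooth_minus by fastforce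

lemma smooth_sum [smooth_intros]:
  "(\<And>i. i \<in> I \<Longrightarrow> smooth (f i)) \<Longrightarrow> smooth (\<lambda>x. \<Sum>i\<in>I. f i x)"
  by (induction I rule: infinite_finite_induct) (auto intro: smooth_intros)

lemma smooth_power [smooth_intros]:
  fixes f :: "real \<Rightarrow> 'a::real_normed_algebra_1"
  shows "smooth f \<Longrightarrow> smooth (\<lambda>x. f x ^ n)"
  by (induction n) (auto intro: smooth_intros)

text \<open>Bootstrapping: when the derivative g is expressed through f itself, n derivatives of f
  give n derivatives of g and so n + 1 of f. This serves \<open>exp\<close>, reciprocals and inverse
  functions.\<close>

lemma smoothI_upto:
  assumes "\<And>x. (f has_vector_derivative g x) (at x)" "\<And>n. smooth_upto n f \<Longrightarrow> smooth_upto n g"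
  shows "smooth f"
  unfolding smooth_iff_upto
proof
  show "smooth_upto n f" for n
    by (induction n) (simp, metis assms smooth_upto_SucI)
qed

lemma smoothI_derivative:
  assumes "\<And>x. (f has_vector_derivative g x) (at x)" "smooth g"
  shows "smooth f"
  using assms smoothI_upto smooth_iff_upto by blast

lemma smooth_exp [smooth_intros]:
  fixes f :: "real \<Rightarrow> 'a::{real_normed_field,banach}"
  assumes "smooth f"
  shows "smooth (\<lambda>x. exp (f x))"
proof (rule smoothI_upto)
  show "((\<lambda>x. exp (f x)) has_vector_derivative vd f x * exp (f x)) (at x)" for x
    using field_vector_diff_chain_at[OF smooth_has_vector_derivative[OF assms, of x] DERIV_exp]
    by (simp add: o_def)
  show "smooth_upto n (\<lambda>x. vd f x * exp (f x))" if "smooth_upto n (\<lambda>x. exp (f x))" for n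
    using smooth_vd[OF assms] that smooth_upto_mult unfolding smooth_iff_upto by blast
qed

lemma smooth_inverse [smooth_intros]:
  fixes f :: "real \<Rightarrow> real"
  assumes "smooth f" "\<And>x. f x \<noteq> 0"
  shows "smooth (\<lambda>x. inverse (f x))"
proof (rule smoothI_upto)
  show "((\<lambda>x. inverse (f x)) has_vector_derivative - (inverse (f x) * inverse (f x) * vd f x)) (at x)" for x
    using smooth_has_vector_derivative[OF assms(1), of x] assms(2)[of x]
    unfolding has_real_derivative_iff_has_vector_derivative[symmetric]
    by (auto intro!: derivative_eq_intros)
  show "smooth_upto n (\<lambda>x. - (inverse (f x) * inverse (f x) * vd f x))"
    if "smooth_upto n (\<lambda>x. inverse (f x))" for n
  proof -
    have "smooth_upto n (\<lambda>x. (-1) * (inverse (f x) * inverse (f x) * vd f x))"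
      using smooth_vd[OF assms(1)] that
      by (intro smooth_upto_mult smooth_upto_const) (simp_all add: smooth_iff_upto)
    then show ?thesis by simp
  qed
qed

lemma smooth_divide [smooth_intros]:
  fixes f g :: "real \<Rightarrow> real"
  assumes "smooth f" "smooth g" "\<And>x. g x \<noteq> 0"
  shows "smooth (\<lambda>x. f x / g x)"
  unfolding divide_inverse by (intro smooth_intros assms)

lemma smooth_ln [smooth_intros]:
  fixes f :: "real \<Rightarrow> real"
  assumes "smooth f" "\<And>x. f x > 0"
  shows "smooth (\<lambda>x. ln (f x))"
proof (rule smoothI_derivative)
  show "((\<lambda>x. ln (f x)) has_vector_derivative vd f x / f x) (at x)" for x
    using smooth_has_vector_derivative[OF assms(1), of x] assms(2)[of x]
    unfolding has_real_derivative_iff_has_vector_derivative[symmetric]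
    by (auto intro!: derivative_eq_intros)
  show "smooth (\<lambda>x. vd f x / f x)"
    by (intro smooth_intros smooth_vd assms) (metis assms(2) less_irrefl)
qed

lemma smooth_bounded_linear:
  assumes "bounded_linear h" "smooth f"
  shows "smooth (\<lambda>x. h (f x))"
proof -
  have *: "smooth_upto n (\<lambda>x. h (f x))" if "smooth_upto n f" for n f
    using that
  proof (induction n arbitrary: f)
    case (Suc n)
    show ?case
      by (rule smooth_upto_SucI[where g="\<lambda>x. h (vd f x)",
            OF bounded_linear.has_vector_derivative[OF assms(1) smooth_upto_SucE(1)[OF Suc.prems]]
              Suc.IH[OF smooth_upto_SucE(2)[OF Suc.prems]]])
  qed simp
  show ?thesis using * assms(2) by (simp add: smooth_iff_upto)
qed

lemma vd_local_cong:
  assumes "open S" "x \<in> S" "\<And>y. y \<in> S \<Longrightarrow> f y = g y"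
  shows "vd f x = vd g x"
  by (rule vector_derivative_cong_eq) (use assms in \<open>auto simp: eventually_nhds\<close>)

lemma nderiv_local_cong:
  assumes "open S" "x \<in> S" "\<And>y. y \<in> S \<Longrightarrow> f y = g y"
  shows "nderiv n f x = nderiv n g x"
proof -
  have "\<forall>y\<in>S. nderiv n f y = nderiv n g y"
  proof (induction n)
    case (Suc n)
    then show ?case using vd_local_cong[OF assms(1), of _ "nderiv n f" "nderiv n g"] by auto
  qed (use assms in auto)
  then show ?thesis using assms by blast
qed

text \<open>The criterion for functions glued from pieces, such as periodizations and one-sided
  truncations.\<close>

lemma smooth_local:
  assumes "\<And>x. \<exists>g S. open S \<and> x \<in> S \<and> smooth g \<and> (\<forall>y\<in>S. f y = g y)"
  shows "smooth f"
  unfolding smooth_def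
proof (intro allI)
  fix n x
  obtain g S where gS: "open S" "x \<in> S" "smooth g" "\<And>y. y \<in> S \<Longrightarrow> f y = g y"
    using assms by metis
  have "(nderiv n g has_vector_derivative vd (nderiv n g) x) (at x)"
    using smooth_has_vector_derivative smooth_nderiv gS(3) by blast
  then have "(nderiv n f has_vector_derivative vd (nderiv n g) x) (at x)"
    by (rule has_vector_derivative_transform_within_open[OF _ gS(1,2)])
       (use nderiv_local_cong gS in metis)
  then show "nderiv n f differentiable at x" by (rule differentiableI_vector)
qed

lemma nderiv_add:
  assumes "smooth f" "smooth g"
  shows "nderiv n (\<lambda>x. f x + g x) x = nderiv n f x + nderiv n g x"
proof -
  have "nderiv n (\<lambda>x. f x + g x) = (\<lambda>x. nderiv n f x + nderiv n g x)"
    by (induction n) (use assms in \<open>simp_all add: smooth_nderiv smooth_differentiable\<close>)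
  then show ?thesis by simp
qed

lemma nderiv_bounded_linear:
  assumes "bounded_linear h" "smooth f"
  shows "nderiv n (\<lambda>x. h (f x)) x = h (nderiv n f x)"
proof -
  have "nderiv n (\<lambda>x. h (f x)) = (\<lambda>x. h (nderiv n f x))"
  proof (induction n)
    case (Suc n)
    then show ?case
      using bounded_linear.has_vector_derivative[OF assms(1) smooth_has_vector_derivative[OF smooth_nderiv[OF assms(2)]]]
      by (auto intro: vector_derivative_at)
  qed simp
  then show ?thesis by simp
qed

lemma nderiv_cmult:
  fixes f :: "real \<Rightarrow> 'a::real_normed_field"
  assumes "smooth f"
  shows "nderiv n (\<lambda>x. c * f x) x = c * nderiv n f x"
  by (rule nderiv_bounded_linear[OF bounded_linear_mult_right assms])

lemma nderiv_of_real:
  assumes "smooth f"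
  shows "nderiv n (\<lambda>x. of_real (f x) :: 'a::real_normed_algebra_1) x = of_real (nderiv n f x)"
  by (rule nderiv_bounded_linear[OF bounded_linear_of_real assms])

lemma nderiv_const: "nderiv n (\<lambda>x. c) x = (if n = 0 then c else 0)"
proof -
  have "nderiv (Suc m) (\<lambda>x. c) = (\<lambda>x. 0)" for m
    by (induction m) auto
  then show ?thesis by (cases n) auto
qed

lemma nderiv_shift:
  fixes f :: "real \<Rightarrow> 'a::real_normed_algebra_1"
  assumes "smooth f"
  shows "nderiv n (\<lambda>x. f (x + c)) x = nderiv n f (x + c)"
proof -
  have "nderiv n (\<lambda>x. f (x + c)) = (\<lambda>x. nderiv n f (x + c))"
  proof (induction n)
    case (Suc n)
    have "((\<lambda>x. nderiv n f (x + c)) has_vector_derivative vd (nderiv n f) (x + c)) (at x)" for x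
    proof -
      have "((\<lambda>x. x + c) has_vector_derivative 1) (at x)"
        by (auto intro!: derivative_eq_intros)
      then show ?thesis
        using vector_diff_chain_at[of "\<lambda>x. x + c" 1 x "nderiv n f" "vd (nderiv n f) (x+c)"]
          smooth_has_vector_derivative[OF smooth_nderiv[OF assms]]
        by (simp add: o_def)
    qed
    then have "vd (\<lambda>x. nderiv n f (x + c)) = (\<lambda>x. vd (nderiv n f) (x + c))"
      by (intro ext vector_derivative_at)
    then show ?case using Suc by simp
  qed simp
  then show ?thesis by simp
qed

lemma deriv_eq_vd: "smooth f \<Longrightarrow> deriv f x = vd f x" for f :: "real \<Rightarrow> real"
  by (intro DERIV_imp_deriv)
     (simp add: smooth_has_vector_derivative has_real_derivative_iff_has_vector_derivative)

lemma smooth_DERIV: "smooth f \<Longrightarrow> (f has_real_derivative deriv f x) (at x)"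
  by (simp add: deriv_eq_vd smooth_has_vector_derivative has_real_derivative_iff_has_vector_derivative)

lemma smooth_deriv: "smooth f \<Longrightarrow> smooth (deriv f)" for f :: "real \<Rightarrow> real"
  using smooth_vd[of f] deriv_eq_vd[of f] by presburger

lemma vd_mult:
  fixes f g :: "real \<Rightarrow> 'a::real_normed_field"
  assumes "smooth f" "smooth g"
  shows "vd (\<lambda>x. f x * g x) x = f x * vd g x + vd f x * g x"
  using assms by (simp add: smooth_differentiable)

lemma vd_compose:
  fixes f :: "real \<Rightarrow> real" and g :: "real \<Rightarrow> 'a::real_normed_field"
  assumes "smooth f" "smooth g"
  shows "vd (\<lambda>x. g (f x)) x = of_real (deriv f x) * vd g (f x)"
  using vector_derivative_chain_at[of f x g] assms
  by (simp add: smooth_differentiable o_def deriv_eq_vd scaleR_conv_of_real)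

section \<open>Cutoff functions\<close>

text \<open>The factors \<open>inverse x ^ n\<close> make the family closed under differentiation up
  to linear combinations, so that one induction proves all its members smooth.\<close>

definition flat_fn :: "nat \<Rightarrow> real \<Rightarrow> real" where
  "flat_fn n x = (if x > 0 then inverse x ^ n * exp (- inverse x) else 0)"

text \<open>With t = 1/x, the single term t^(n+2)/(n+2)! of the exponential series bounds exp t from
  below. The quadratic bound makes the difference quotient at 0 tend to 0.\<close>

lemma flat_fn_bound: "\<bar>flat_fn n x\<bar> \<le> fact (n + 2) * x\<^sup>2"
proof (cases "x > 0")
  case True
  define t where "t = inverse x"
  have t: "t > 0" "x = inverse t" using True by (auto simp: t_def)
  have "t ^ (n + 2) /\<^sub>R fact (n + 2) \<le> exp t"
    using sum_le_suminf[OF summable_exp_generic[of t], of "{n+2}"] t(1)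
    unfolding exp_def by simp
  then have "t ^ (n + 2) / fact (n + 2) \<le> exp t"
    by (simp add: divide_inverse mult.commute)
  then have "t ^ n * exp (- t) \<le> fact (n + 2) * (inverse t)\<^sup>2"
  proof -
    assume "t ^ (n + 2) / fact (n + 2) \<le> exp t"
    then have "t ^ (n + 2) \<le> fact (n + 2) * exp t"
      by (subst (asm) pos_divide_le_eq) (simp_all add: mult.commute del: fact_Suc)
    then have "(t ^ n * t\<^sup>2) * (exp (- t) * (inverse t)\<^sup>2) \<le> (fact (n + 2) * exp t) * (exp (- t) * (inverse t)\<^sup>2)"
      using t(1) by (intro mult_right_mono) (simp_all add: power_add power2_eq_square mult_ac del: fact_Suc)
    moreover have "t\<^sup>2 * (inverse t)\<^sup>2 = 1" using t(1) by (simp add: power_inverse)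
    moreover have "exp t * exp (- t) = 1" by (simp add: exp_minus)
    moreover have "(t ^ n * t\<^sup>2) * (exp (- t) * (inverse t)\<^sup>2) = (t ^ n * exp (- t)) * (t\<^sup>2 * (inverse t)\<^sup>2)"
      by (simp only: mult_ac)
    moreover have "(fact (n + 2) * exp t) * (exp (- t) * (inverse t)\<^sup>2) = fact (n + 2) * (inverse t)\<^sup>2 * (exp t * exp (- t))"
      by (simp only: mult_ac)
    ultimately show ?thesis by (simp only: mult_1_right)
  qed
  moreover have "flat_fn n x = t ^ n * exp (- t)" using True by (simp add: flat_fn_def t_def)
  ultimately show ?thesis using t by (simp add: abs_mult)
qed (simp add: flat_fn_def)

lemma flat_fn_derivative:
  "(flat_fn n has_vector_derivative flat_fn (n + 2) x - of_nat n * flat_fn (n + 1) x) (at x)"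
proof -
  consider "x > 0" | "x < 0" | "x = 0" by linarith
  then show ?thesis
  proof cases
    case 1
    have "((\<lambda>x. inverse x ^ n * exp (- inverse x)) has_real_derivative
        (flat_fn (n + 2) x - of_nat n * flat_fn (n + 1) x)) (at x)"
    proof -
      have i: "(inverse has_real_derivative - (inverse x * inverse x)) (at x)"
        using DERIV_inverse[of x] 1 by (simp add: power2_eq_square)
      have "((\<lambda>x. inverse x ^ n * exp (- inverse x)) has_real_derivative
          of_nat n * (- (inverse x * inverse x) * inverse x ^ (n - Suc 0)) * exp (- inverse x)
          + exp (- inverse x) * (- (- (inverse x * inverse x))) * inverse x ^ n) (at x)"
        by (intro DERIV_mult DERIV_power DERIV_fun_exp DERIV_minus i)
      moreover have "of_nat n * (- (inverse x * inverse x) * inverse x ^ (n - Suc 0)) * exp (- inverse x)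
          + exp (- inverse x) * (- (- (inverse x * inverse x))) * inverse x ^ n
        = flat_fn (n + 2) x - of_nat n * flat_fn (n + 1) x"
        using 1 by (cases n) (simp_all add: flat_fn_def algebra_simps)
      ultimately show ?thesis by simp
    qed
    then show ?thesis
      unfolding has_real_derivative_iff_has_vector_derivative
      by (rule has_vector_derivative_transform_within_open[where S="{0<..}"]) (use 1 in \<open>auto simp: flat_fn_def\<close>)
  next
    case 2
    have "((\<lambda>x. 0) has_vector_derivative 0) (at x)" by simp
    then have "(flat_fn n has_vector_derivative 0) (at x)"
      by (rule has_vector_derivative_transform_within_open[where S="{..<0}"]) (use 2 in \<open>auto simp: flat_fn_def\<close>)
    then show ?thesis using 2 by (simp add: flat_fn_def)
  next
    case 3
    have "((\<lambda>h. flat_fn n h / h) \<longlongrightarrow> 0) (at 0)"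
    proof (rule Lim_null_comparison)
      show "\<forall>\<^sub>F h in at 0. norm (flat_fn n h / h) \<le> fact (n + 2) * \<bar>h\<bar>"
      proof (rule always_eventually, rule allI)
        fix h :: real
        have "\<bar>flat_fn n h\<bar> / \<bar>h\<bar> \<le> fact (n + 2) * h\<^sup>2 / \<bar>h\<bar>"
          by (rule divide_right_mono[OF flat_fn_bound]) simp
        also have "\<dots> = fact (n + 2) * \<bar>h\<bar>" by (cases "h = 0") (auto simp: power2_eq_square abs_if)
        finally show "norm (flat_fn n h / h) \<le> fact (n + 2) * \<bar>h\<bar>" by simp
      qed
      show "((\<lambda>h::real. fact (n + 2) * \<bar>h\<bar>) \<longlongrightarrow> 0) (at 0)"
        by (auto intro!: tendsto_eq_intros)
    qed
    then have "(flat_fn n has_real_derivative 0) (at 0)"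
      unfolding DERIV_def by (simp add: flat_fn_def[of n 0])
    then show ?thesis using 3 by (simp add: flat_fn_def has_real_derivative_iff_has_vector_derivative)
  qed
qed

lemma smooth_flat_fn: "smooth (flat_fn n)"
  unfolding smooth_iff_upto
proof
  show "smooth_upto m (flat_fn n)" for m
  proof (induction m arbitrary: n)
    case (Suc m)
    have "smooth_upto m (\<lambda>x. flat_fn (n + 2) x + (- of_nat n) * flat_fn (n + 1) x)"
      by (intro smooth_upto_add smooth_upto_mult smooth_upto_const Suc)
    then show ?case
      by (intro smooth_upto_SucI[OF flat_fn_derivative]) simp
  qed simp
qed

definition step_fn :: "real \<Rightarrow> real" where
  "step_fn x = flat_fn 0 x / (flat_fn 0 x + flat_fn 0 (1 - x))"

lemma step_denominator_pos: "flat_fn 0 x + flat_fn 0 (1 - x) > 0"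
  by (auto simp: flat_fn_def add_pos_pos)

lemma smooth_step_fn: "smooth step_fn"
proof -
  have "smooth (\<lambda>x. flat_fn 0 x / (flat_fn 0 x + flat_fn 0 (1 - x)))"
    by (intro smooth_intros smooth_flat_fn smooth_compose[of "flat_fn 0"])
       (use step_denominator_pos in \<open>simp add: less_imp_neq[symmetric]\<close>)
  then show ?thesis unfolding step_fn_def[abs_def] .
qed

lemma step_fn_eq_0: "x \<le> 0 \<Longrightarrow> step_fn x = 0"
  by (simp add: step_fn_def flat_fn_def)

lemma step_fn_eq_1: "x \<ge> 1 \<Longrightarrow> step_fn x = 1"
  by (simp add: step_fn_def flat_fn_def)

lemma step_fn_range: "0 \<le> step_fn x" "step_fn x \<le> 1"
  using step_denominator_pos[of x] by (auto simp: step_fn_def flat_fn_def divide_le_eq)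

text \<open>Monotonicity keeps the derivative of the pushing map in
  \<open>Line_one_sided_local\<close> at least 1.\<close>

lemma step_fn_deriv_nonneg: "deriv step_fn x \<ge> 0"
proof -
  have d: "(flat_fn 0 has_real_derivative flat_fn 2 x) (at x)" for x
    using flat_fn_derivative[of 0 x]
    by (simp add: has_real_derivative_iff_has_vector_derivative numeral_2_eq_2)
  have nn: "flat_fn n x \<ge> 0" for n x by (simp add: flat_fn_def)
  define N where "N = flat_fn 0 x + flat_fn 0 (1 - x)"
  have d': "((\<lambda>x. flat_fn 0 (1 - x)) has_real_derivative - flat_fn 2 (1 - x)) (at x)"
  proof -
    have "((\<lambda>x. 1 - x) has_real_derivative -1) (at x)" by (auto intro!: derivative_eq_intros)
    with DERIV_chain2[of "flat_fn 0" "flat_fn 2 (1 - x)" "\<lambda>x. 1 - x" x "-1" UNIV] d[of "1 - x"]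
    show ?thesis by simp
  qed
  have "((\<lambda>x. flat_fn 0 x / (flat_fn 0 x + flat_fn 0 (1 - x))) has_real_derivative
     (flat_fn 2 x * N - flat_fn 0 x * (flat_fn 2 x + - flat_fn 2 (1 - x))) / (N * N)) (at x)"
    unfolding N_def using step_denominator_pos[of x] by (intro DERIV_divide DERIV_add d d') auto
  then have "deriv step_fn x = (flat_fn 2 x * N - flat_fn 0 x * (flat_fn 2 x + - flat_fn 2 (1 - x))) / (N * N)"
    unfolding step_fn_def[abs_def] by (rule DERIV_imp_deriv)
  also have "\<dots> = (flat_fn 2 x * flat_fn 0 (1 - x) + flat_fn 0 x * flat_fn 2 (1 - x)) / (N * N)"
    by (simp add: N_def algebra_simps)
  also have "\<dots> \<ge> 0"
    by (intro divide_nonneg_nonneg add_nonneg_nonneg mult_nonneg_nonneg nn) (simp_all add: N_def nn)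
  finally show ?thesis .
qed

definition bump :: "real \<Rightarrow> real" where
  "bump x = step_fn (x + 2) * step_fn (2 - x)"

lemma smooth_bump: "smooth bump"
  unfolding bump_def[abs_def] by (intro smooth_intros smooth_compose[OF smooth_step_fn])

lemma bump_eq_1: "\<bar>x\<bar> \<le> 1 \<Longrightarrow> bump x = 1"
  by (simp add: bump_def step_fn_eq_1 abs_le_iff)

lemma bump_eq_0: "\<bar>x\<bar> \<ge> 2 \<Longrightarrow> bump x = 0"
  by (auto simp: bump_def step_fn_eq_0 abs_if split: if_splits)

lemma bump_range: "0 \<le> bump x" "bump x \<le> 1"
  using step_fn_range[of "x+2"] step_fn_range[of "2-x"] by (auto simp: bump_def intro: mult_le_one)

section \<open>Powers of positive reals with real or complex exponents\<close>

text \<open>A common setting for real and complex scalars. All powers taken have a positive real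
  base, so agreement of \<open>ln\<close> with the real logarithm on such numbers is the property
  that matters.\<close>

class powr_field = real_normed_field + ln +
  assumes ln_scaleR_one: "0 < (r::real) \<Longrightarrow> ln (r *\<^sub>R 1) = ln r *\<^sub>R 1"

instance real :: powr_field
  by standard simp

instance complex :: powr_field
  by standard (simp add: Ln_of_real flip: of_real_def)

lemma ln_of_real_pos: "0 < r \<Longrightarrow> ln (of_real r :: 'k::powr_field) = of_real (ln r)"
  unfolding of_real_def by (rule ln_scaleR_one)

lemma powr_of_real_eq: "0 < r \<Longrightarrow> (of_real r :: 'k::powr_field) powr a = exp (a * of_real (ln r))"
  by (simp add: powr_def ln_of_real_pos)

lemma powr_of_real_add:
  "0 < r \<Longrightarrow> (of_real r :: 'k::powr_field) powr (a + b) = of_real r powr a * of_real r powr b"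
  by (simp add: powr_of_real_eq exp_add[symmetric] distrib_right)

lemma powr_of_real_inverse:
  "0 < r \<Longrightarrow> (of_real (inverse r) :: 'k::powr_field) powr a = of_real r powr (- a)"
  by (subst (1 2) powr_of_real_eq) (simp_all add: ln_inverse del: of_real_inverse)

lemma powr_of_real_of_nat:
  "0 < r \<Longrightarrow> (of_real r :: 'k::powr_field) powr (of_nat n) = of_real r ^ n"
proof (induction n)
  case (Suc n)
  have "(of_real r :: 'k) powr 1 = of_real r"
    using Suc.prems by (simp add: powr_of_real_eq exp_of_real)
  then show ?case using Suc by (simp add: powr_of_real_add)
qed (simp add: powr_of_real_eq)

lemma smooth_powr [smooth_intros]:
  fixes f :: "real \<Rightarrow> real"
  assumes "smooth f" "\<And>x. f x > 0"
  shows "smooth (\<lambda>x. (of_real (f x) :: 'k::powr_field) powr a)"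
proof -
  have "smooth (\<lambda>x. exp (a * of_real (ln (f x))))"
    using assms by (intro smooth_intros) auto
  then show ?thesis using assms(2) by (simp add: powr_of_real_eq)
qed

section \<open>Diffeomorphisms and densities\<close>

lemma DiffeoD:
  assumes "f \<in> Diffeo M"
  shows "smooth f" "bij f" "smooth (inv f)" "deriv f x > 0"
    "inv f (f x) = x" "f (inv f x) = x" "M = Circle \<Longrightarrow> f (x + 1) = f x + 1"
  using assms by (auto simp: Diffeo_def bij_is_inj bij_is_surj surj_f_inv_f)

lemma Diffeo_Line: "f \<in> Diffeo M \<Longrightarrow> f \<in> Diffeo Line"
  by (auto simp: Diffeo_def)

lemma deriv_inv_Diffeo:
  assumes "f \<in> Diffeo M"
  shows "deriv (inv f) y = inverse (deriv f (inv f y))"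
proof -
  note f = DiffeoD[OF assms]
  have "((\<lambda>x. f (inv f x)) has_real_derivative deriv f (inv f y) * deriv (inv f) y) (at y)"
    by (rule DERIV_chain2[OF smooth_DERIV[OF f(1)] smooth_DERIV[OF f(3)]])
  then have "((\<lambda>x. x) has_real_derivative deriv f (inv f y) * deriv (inv f) y) (at y)"
    using f(6) by simp
  then have "deriv f (inv f y) * deriv (inv f) y = 1"
    by (rule DERIV_unique) (rule DERIV_ident)
  then show ?thesis using f(4)[of "inv f y"] by (simp add: field_simps)
qed

lemma deriv_compose_smooth:
  fixes f g :: "real \<Rightarrow> real"
  assumes "smooth f" "smooth g"
  shows "deriv (\<lambda>x. f (g x)) x = deriv f (g x) * deriv g x"
  by (rule DERIV_imp_deriv, rule DERIV_chain2[OF smooth_DERIV[OF assms(1)] smooth_DERIV[OF assms(2)]])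

lemma Diffeo_inv: assumes "f \<in> Diffeo M" shows "inv f \<in> Diffeo M"
proof -
  note f = DiffeoD[OF assms]
  have "inv f (x + 1) = inv f x + 1" if "M = Circle" for x
    using f(7)[OF that, of "inv f x"] f(5,6) by metis
  then show ?thesis using f unfolding Diffeo_def
    by (auto simp: bij_imp_bij_inv inv_inv_eq deriv_inv_Diffeo[OF assms])
qed

lemma Diffeo_compose:
  assumes "f \<in> Diffeo M" "g \<in> Diffeo M"
  shows "(\<lambda>x. f (g x)) \<in> Diffeo M"
proof -
  note f = DiffeoD[OF assms(1)] and g = DiffeoD[OF assms(2)]
  have b: "bij (f \<circ> g)" using f(2) g(2) by (rule bij_comp[rotated])
  have i: "inv (f \<circ> g) = (\<lambda>x. inv g (inv f x))"
    by (subst o_inv_distrib) (use f g in auto)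
  show ?thesis unfolding Diffeo_def
    using f g b i by (auto simp: o_def deriv_compose_smooth intro!: smooth_compose[where g=f] smooth_compose[where g="inv g"])
qed

lemma Diffeo_shift: "(\<lambda>x. x + c) \<in> Diffeo M"
proof -
  have i: "inv (\<lambda>x. x + c) = (\<lambda>x. x - c)" by (rule inv_equality) auto
  have "deriv (\<lambda>x. x + c) x = 1" for x :: real
    by (rule DERIV_imp_deriv) (auto intro!: derivative_eq_intros)
  moreover have "bij (\<lambda>x. x + c)" by (rule bijI') (auto intro: exI[of _ "_ - c"])
  moreover have "smooth (\<lambda>x. x - c)" "smooth (\<lambda>x. x + c)" by (intro smooth_intros)+
  ultimately show ?thesis unfolding Diffeo_def i[symmetric] by (auto simp: i)
qed

text \<open>A uniform lower bound c on the derivative, not just positivity, gives linear growth and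
  hence surjectivity; it also makes the inverse Lipschitz with constant 1/c.\<close>

lemma DiffeoI:
  assumes "smooth g" "\<And>x. deriv g x \<ge> c" "c > 0" "M = Circle \<Longrightarrow> (\<And>x. g (x + 1) = g x + 1)"
  shows "g \<in> Diffeo M"
proof -
  have g': "(g has_real_derivative deriv g x) (at x)" for x by (rule smooth_DERIV[OF assms(1)])
  have pos: "deriv g x > 0" for x using assms(2)[of x] assms(3) by linarith
  have mono: "g x + c * (y - x) \<le> g y" if "x \<le> y" for x y
  proof (cases "x = y")
    case False
    then have "x < y" using that by simp
    then obtain z where "z > x" "z < y" "g y - g x = (y - x) * deriv g z"
      using MVT2[of x y g "deriv g"] g' by metis
    moreover have "(y - x) * c \<le> (y - x) * deriv g z"
      using assms(2)[of z] that by (intro mult_left_mono) auto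
    ultimately show ?thesis unfolding mult.commute[of c] by linarith
  qed simp
  have "inj g"
  proof (rule injI)
    fix x y assume e: "g x = g y"
    have "c * (y - x) \<le> 0" if "x \<le> y" using mono[OF that] e by simp
    moreover have "c * (x - y) \<le> 0" if "y \<le> x" using mono[OF that] e by simp
    ultimately show "x = y" using assms(3) linear[of x y] by (auto simp: mult_le_0_iff)
  qed
  moreover have "surj g"
  unfolding surj_def
  proof
    fix y
    \<comment> \<open>By linear growth g passes the value y within this distance of 0; the summand 1
      keeps d positive.\<close>
    define d where "d = \<bar>y - g 0\<bar> / c + 1"
    have d: "d > 0" "c * d \<ge> \<bar>y - g 0\<bar>" using assms(3) by (auto simp: d_def field_simps add_nonneg_pos)
    have "g (-d) \<le> y" "y \<le> g d" using mono[of "-d" 0] mono[of 0 d] d by auto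
    then show "\<exists>x. y = g x"
      using IVT'[of g "-d" y d] d(1) smooth_continuous_on[OF assms(1)] by auto
  qed
  ultimately have bij: "bij g" by (rule bijI)
  have gi: "g (inv g y) = y" for y using bij by (simp add: bij_is_surj surj_f_inv_f)
  have "(inv g has_real_derivative inverse (deriv g (inv g y))) (at y)" for y
  proof (rule DERIV_inverse_function[where a="y-1" and b="y+1"])
    show "(g has_real_derivative deriv g (inv g y)) (at (inv g y))" by (rule g')
    show "isCont (inv g) y"
      unfolding isCont_def LIM_def
    proof safe
      fix r :: real assume "r > 0"
      have "\<bar>inv g x - inv g y\<bar> < r" if "\<bar>x - y\<bar> < c * r" for x
      proof -
        have "c * \<bar>inv g x - inv g y\<bar> \<le> \<bar>x - y\<bar>"
          using mono[of "inv g x" "inv g y"] mono[of "inv g y" "inv g x"] gi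
          by (cases "inv g x \<le> inv g y") (auto simp: abs_if algebra_simps)
        then have "c * \<bar>inv g x - inv g y\<bar> < c * r" using that by linarith
        then show ?thesis using assms(3) by simp
      qed
      then show "\<exists>s>0. \<forall>x. x \<noteq> y \<and> dist x y < s \<longrightarrow> dist (inv g x) (inv g y) < r"
        using \<open>r > 0\<close> assms(3) by (intro exI[of _ "c * r"]) (auto simp: dist_real_def)
    qed
  qed (use pos[of "inv g y"] gi in auto)
  then have "(inv g has_vector_derivative inverse (deriv g (inv g y))) (at y)" for y
    by (simp add: has_real_derivative_iff_has_vector_derivative)
  \<comment> \<open>The derivative of \<open>inv g\<close> is a smooth function of
    \<open>inv g\<close>, so its regularity bootstraps.\<close>
  then have "smooth (inv g)"
  proof (rule smoothI_upto)
    fix n assume "smooth_upto n (inv g)"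
    moreover have "smooth (\<lambda>x. inverse (deriv g x))"
      by (intro smooth_intros smooth_deriv assms(1)) (metis pos less_irrefl)
    ultimately show "smooth_upto n (\<lambda>y. inverse (deriv g (inv g y)))"
      using smooth_upto_compose unfolding smooth_iff_upto by fast
  qed
  then show ?thesis using bij pos assms(1,4) by (simp add: Diffeo_def)
qed

lemma fn_space_smooth: "\<phi> \<in> fn_space M \<Longrightarrow> smooth \<phi>"
  by (simp add: fn_space_def)

lemma fn_space_mono: "\<phi> \<in> fn_space M \<Longrightarrow> \<phi> \<in> fn_space Line"
  by (simp add: fn_space_def)

named_theorems fn_space_intros

lemma fn_space_const [fn_space_intros]: "(\<lambda>x. c) \<in> fn_space M"
  by (simp add: fn_space_def smooth_intros)

lemma fn_space_add [fn_space_intros]: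
  "\<phi> \<in> fn_space M \<Longrightarrow> \<psi> \<in> fn_space M \<Longrightarrow> (\<lambda>x. \<phi> x + \<psi> x) \<in> fn_space M"
  by (simp add: fn_space_def smooth_intros)

lemma fn_space_mult [fn_space_intros]:
  "\<phi> \<in> fn_space M \<Longrightarrow> \<psi> \<in> fn_space M \<Longrightarrow> (\<lambda>x. \<phi> x * \<psi> x) \<in> fn_space M"
  by (simp add: fn_space_def smooth_intros)

lemma fn_space_diff [fn_space_intros]:
  "\<phi> \<in> fn_space M \<Longrightarrow> \<psi> \<in> fn_space M \<Longrightarrow> (\<lambda>x. \<phi> x - \<psi> x) \<in> fn_space M"
  by (simp add: fn_space_def smooth_intros)

lemma fn_space_sum [fn_space_intros]:
  "(\<And>i. i \<in> I \<Longrightarrow> \<phi> i \<in> fn_space M) \<Longrightarrow> (\<lambda>x. \<Sum>i\<in>I. \<phi> i x) \<in> fn_space M"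
  by (simp add: fn_space_def smooth_intros)

lemma fn_space_of_real [fn_space_intros]:
  "\<phi> \<in> fn_space M \<Longrightarrow> (\<lambda>x. of_real (\<phi> x)) \<in> fn_space M"
  by (simp add: fn_space_def smooth_intros)

lemma fn_space_vd [fn_space_intros]:
  fixes \<phi> :: "real \<Rightarrow> 'k::real_normed_field"
  assumes "\<phi> \<in> fn_space M" shows "vd \<phi> \<in> fn_space M"
proof -
  have s: "smooth \<phi>" using assms by (rule fn_space_smooth)
  have "vd \<phi> (x + 1) = vd \<phi> x" if "M = Circle" for x
  proof -
    have "vd \<phi> (x + 1) = vd (\<lambda>x. \<phi> (x + 1)) x" using nderiv_shift[OF s, of 1 1 x] by simp
    also have "(\<lambda>x. \<phi> (x + 1)) = \<phi>" using assms that by (auto simp: fn_space_def)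
    finally show ?thesis .
  qed
  then show ?thesis using s smooth_vd by (auto simp: fn_space_def)
qed

lemma fn_space_compose:
  fixes \<phi> :: "real \<Rightarrow> 'k::real_normed_field"
  assumes "\<phi> \<in> fn_space M" "f \<in> Diffeo M"
  shows "(\<lambda>x. \<phi> (f x)) \<in> fn_space M"
  using assms DiffeoD[OF assms(2)] by (auto simp: fn_space_def intro: smooth_compose)

lemma fn_space_deriv_Diffeo:
  assumes "f \<in> Diffeo M"
  shows "deriv f \<in> fn_space M"
proof -
  note f = DiffeoD[OF assms]
  have "deriv f (x + 1) = deriv f x" if "M = Circle" for x
  proof -
    have "deriv f (x + 1) = deriv (\<lambda>x. f (x + 1)) x"
      using deriv_compose_smooth[OF f(1), of "\<lambda>x. x + 1" x]
      by (simp add: smooth_intros)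
    also have "(\<lambda>x. f (x + 1)) = (\<lambda>x. f x + 1)" using f(7)[OF that] by auto
    also have "deriv (\<lambda>x. f x + 1) x = deriv f x"
      by (rule DERIV_imp_deriv) (auto intro!: derivative_eq_intros smooth_DERIV f)
    finally show ?thesis .
  qed
  then show ?thesis using f smooth_deriv by (auto simp: fn_space_def)
qed

lemma fn_space_powr [fn_space_intros]:
  fixes a :: "'k::powr_field"
  assumes "\<phi> \<in> fn_space M" "\<And>x. \<phi> x > 0"
  shows "(\<lambda>x. of_real (\<phi> x) powr a) \<in> fn_space M"
  using assms by (auto simp: fn_space_def intro: smooth_intros)

lemma fn_space_rho:
  fixes \<phi> :: "real \<Rightarrow> 'k::powr_field"
  assumes "\<phi> \<in> fn_space M" "f \<in> Diffeo M"
  shows "rho lam f \<phi> \<in> fn_space M"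
  unfolding rho_def
  by (rule fn_space_mult[OF fn_space_powr[OF fn_space_deriv_Diffeo[OF assms(2)] DiffeoD(4)[OF assms(2)]]
        fn_space_compose[OF assms]])

section \<open>Operators and their coefficients\<close>

definition op_at :: "nat \<Rightarrow> (nat \<Rightarrow> real \<Rightarrow> 'k::real_normed_field) \<Rightarrow> (real \<Rightarrow> 'k) \<Rightarrow> real \<Rightarrow> 'k" where
  "op_at k a \<phi> x = (\<Sum>i\<le>k. a i x * nderiv i \<phi> x)"

text \<open>Coefficients beyond k are set to zero so that an operator determines its family, see
  \<open>dop_of_inj\<close>.\<close>

definition op_coeffs :: "nat \<Rightarrow> mfd \<Rightarrow> (nat \<Rightarrow> real \<Rightarrow> 'k::real_normed_field) set" where
  "op_coeffs k M = {a. (\<forall>i. a i \<in> fn_space M) \<and> (\<forall>i>k. a i = (\<lambda>x. 0))}"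

definition dop_of :: "nat \<Rightarrow> mfd \<Rightarrow> (nat \<Rightarrow> real \<Rightarrow> 'k::real_normed_field) \<Rightarrow> 'k dop" where
  "dop_of k M a = (\<lambda>\<phi>. if \<phi> \<in> fn_space M then op_at k a \<phi> else (\<lambda>x. 0))"

lemma op_at_local_cong:
  assumes "open S" "x \<in> S" "\<And>y. y \<in> S \<Longrightarrow> \<phi> y = \<psi> y"
  shows "op_at k a \<phi> x = op_at k a \<psi> x"
  unfolding op_at_def using nderiv_local_cong[OF assms] by simp

text \<open>A multiple of s^j vanishes to order j at a zero of s. The factor h is carried along
  because differentiating \<open>h * s ^ Suc j\<close> gives \<open>h' * s ^ j\<close> with a new
  smooth factor.\<close>

lemma nderiv_mult_power:
  fixes s h :: "real \<Rightarrow> 'k::real_normed_field"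
  assumes s: "smooth s" "s x = 0" and "smooth h"
  shows "(\<forall>i<j. nderiv i (\<lambda>x. h x * s x ^ j) x = 0) \<and>
         nderiv j (\<lambda>x. h x * s x ^ j) x = h x * fact j * vd s x ^ j"
  using assms(3)
proof (induction j arbitrary: h)
  case (Suc j)
  define h' where "h' = (\<lambda>x. vd h x * s x + of_nat (Suc j) * (h x * vd s x))"
  have h': "smooth h'" unfolding h'_def by (intro smooth_intros smooth_vd s Suc.prems)
  have vp: "vd (\<lambda>x. s x ^ m) y = of_nat m * (s y ^ (m - 1) * vd s y)" for m y
  proof (induction m)
    case (Suc m)
    then show ?case
      using vd_mult[OF s(1) smooth_power[OF s(1), of m], of y]
      by (cases m) (auto simp: algebra_simps)
  qed simp
  have "vd (\<lambda>x. h x * s x ^ Suc j) y = h' y * s y ^ j" for y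
    by (subst vd_mult) (simp_all add: vp Suc.prems smooth_intros s h'_def algebra_simps del: power_Suc, simp add: algebra_simps)
  then have *: "vd (\<lambda>x. h x * s x ^ Suc j) = (\<lambda>y. h' y * s y ^ j)" by blast
  have "nderiv (Suc i) (\<lambda>x. h x * s x ^ Suc j) x = nderiv i (\<lambda>y. h' y * s y ^ j) x" for i
    unfolding nderiv_vd[symmetric] * ..
  moreover have "h' x = of_nat (Suc j) * (h x * vd s x)" using s by (simp add: h'_def)
  ultimately show ?case
    using Suc.IH[OF h'] s(2) by (auto simp: less_Suc_eq_0_disj algebra_simps)
qed simp

text \<open>Tests on powers of a sine with a simple zero at x; they are periodic and so serve both
  manifolds. If j is the largest index with a nonzero coefficient, the j-th power isolates it: its
  lower derivatives vanish at x, and the higher coefficients are zero.\<close>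

lemma coeff_zeroI:
  fixes a :: "nat \<Rightarrow> real \<Rightarrow> 'k::real_normed_field"
  assumes "\<And>\<phi>. \<phi> \<in> fn_space M \<Longrightarrow> op_at k a \<phi> x = 0" "i \<le> k"
  shows "a i x = 0"
proof (rule ccontr)
  assume "a i x \<noteq> 0"
  define J where "J = {j. j \<le> k \<and> a j x \<noteq> 0}"
  have J: "finite J" "J \<noteq> {}" using \<open>a i x \<noteq> 0\<close> assms(2) by (auto simp: J_def)
  define j where "j = Max J"
  have j: "j \<le> k" "a j x \<noteq> 0" using Max_in[OF J] by (auto simp: J_def j_def)
  have gt: "a m x = 0" if "m > j" "m \<le> k" for m
    using Max_ge[OF J(1), of m] that unfolding j_def[symmetric] by (auto simp: J_def)
  define s :: "real \<Rightarrow> real" where "s = (\<lambda>y. sin (2 * pi * (y - x)))"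
  have ds: "(s has_vector_derivative 2 * pi * cos (2 * pi * (y - x))) (at y)" for y
    unfolding s_def has_real_derivative_iff_has_vector_derivative[symmetric]
    by (auto intro!: derivative_eq_intros)
  have smooth_trig: "smooth_upto n (\<lambda>y. c * sin (2 * pi * (y - x)))" "smooth_upto n (\<lambda>y. c * cos (2 * pi * (y - x)))" for n c
  proof (induction n arbitrary: c)
    case (Suc n)
    { case 1 show ?case
        by (rule smooth_upto_SucI[OF _ Suc(2)[of "c * (2 * pi)"]])
           (auto intro!: derivative_eq_intros simp: has_real_derivative_iff_has_vector_derivative[symmetric]) }
    { case 2 show ?case
        by (rule smooth_upto_SucI[OF _ Suc(1)[of "- c * (2 * pi)"]])
           (auto intro!: derivative_eq_intros simp: has_real_derivative_iff_has_vector_derivative[symmetric]) }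
  qed simp_all
  have s: "smooth s" unfolding smooth_iff_upto s_def using smooth_trig(1)[of _ 1] by simp
  have per: "s (y + 1) = s y" for y
    unfolding s_def using sin_periodic[of "2 * pi * (y - x)"] by (simp add: algebra_simps)
  define \<phi> :: "real \<Rightarrow> 'k" where "\<phi> = (\<lambda>y. of_real (s y ^ j))"
  have "\<phi> \<in> fn_space M"
    unfolding \<phi>_def fn_space_def using per by (auto intro!: smooth_intros s)
  then have 0: "op_at k a \<phi> x = 0" by (rule assms)
  have nd: "nderiv m \<phi> x = of_real (nderiv m (\<lambda>y. 1 * s y ^ j) x)" for m
    unfolding \<phi>_def by (subst nderiv_of_real) (auto intro!: smooth_intros s)
  have sx: "s x = 0" by (simp add: s_def)
  have vs: "vd s x = 2 * pi" using vector_derivative_at[OF ds[of x]] by simp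
  have "nderiv m \<phi> x = 0" if "m < j" for m
    using nderiv_mult_power[OF s sx smooth_const, of j 1] that nd[of m] by simp
  moreover have "nderiv j \<phi> x \<noteq> 0"
    using nderiv_mult_power[OF s sx smooth_const, of j 1] nd[of j] vs by simp
  moreover have "op_at k a \<phi> x = a j x * nderiv j \<phi> x"
    unfolding op_at_def using calculation(1) gt j(1)
    by (subst sum.remove[of _ j]) (auto intro!: sum.neutral, metis linorder_neqE_nat)
  ultimately show False using 0 j(2) by simp
qed

lemma coeff_eqI:
  fixes a b :: "nat \<Rightarrow> real \<Rightarrow> 'k::real_normed_field"
  assumes "\<And>\<phi>. \<phi> \<in> fn_space M \<Longrightarrow> op_at k a \<phi> x = op_at k b \<phi> x" "i \<le> k"
  shows "a i x = b i x"
  using coeff_zeroI[of M k "\<lambda>i x. a i x - b i x" x i] assms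
  by (auto simp: op_at_def left_diff_distrib sum_subtractf)

lemma coeffsD: "a \<in> op_coeffs k M \<Longrightarrow> a i \<in> fn_space M" "a \<in> op_coeffs k M \<Longrightarrow> i > k \<Longrightarrow> a i x = 0"
  by (auto simp: op_coeffs_def)

lemma coeffs_smooth: "a \<in> op_coeffs k M \<Longrightarrow> smooth (a i)"
  using coeffsD fn_space_smooth by blast

lemma coeffs_mono: "a \<in> op_coeffs k M \<Longrightarrow> a \<in> op_coeffs k Line"
  by (auto simp: op_coeffs_def intro: fn_space_mono)

section \<open>Linear structure and group action on coefficient families\<close>

definition cadd :: "(nat \<Rightarrow> real \<Rightarrow> 'k::real_normed_field) \<Rightarrow> (nat \<Rightarrow> real \<Rightarrow> 'k) \<Rightarrow> nat \<Rightarrow> real \<Rightarrow> 'k" where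
  "cadd a b = (\<lambda>i x. a i x + b i x)"

definition csmul :: "'k::real_normed_field \<Rightarrow> (nat \<Rightarrow> real \<Rightarrow> 'k) \<Rightarrow> nat \<Rightarrow> real \<Rightarrow> 'k" where
  "csmul c a = (\<lambda>i x. c * a i x)"

lemma cadd_coeffs: "a \<in> op_coeffs k M \<Longrightarrow> b \<in> op_coeffs k M \<Longrightarrow> cadd a b \<in> op_coeffs k M"
  by (auto simp: op_coeffs_def cadd_def intro!: fn_space_intros)

lemma csmul_coeffs: "a \<in> op_coeffs k M \<Longrightarrow> csmul c a \<in> op_coeffs k M"
  by (auto simp: op_coeffs_def csmul_def intro!: fn_space_intros)

text \<open>The universal coefficients in \<open>nderiv_rho\<close>, produced by the product and
  chain rules; for lam = 0 they are the partial Bell polynomials in the derivatives of f.\<close>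

fun jet_coeff :: "'k::powr_field \<Rightarrow> (real \<Rightarrow> real) \<Rightarrow> nat \<Rightarrow> nat \<Rightarrow> real \<Rightarrow> 'k" where
  "jet_coeff lam f 0 j = (\<lambda>x. if j = 0 then of_real (deriv f x) powr lam else 0)"
| "jet_coeff lam f (Suc i) j = (\<lambda>x. vd (jet_coeff lam f i j) x +
     (if j = 0 then 0 else of_real (deriv f x) * jet_coeff lam f i (j - 1) x))"

lemma jet_coeff_fn_space:
  assumes "f \<in> Diffeo M" shows "jet_coeff lam f i j \<in> fn_space M"
proof (induction i arbitrary: j)
  case 0
  show ?case using DiffeoD(4)[OF assms]
    by (cases "j = 0") (auto intro!: fn_space_intros fn_space_deriv_Diffeo assms)
next
  case (Suc i)
  then show ?case
    by (cases "j = 0") (auto intro!: fn_space_intros fn_space_deriv_Diffeo assms)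
qed

lemma jet_coeff_above: "j > i \<Longrightarrow> jet_coeff lam f i j = (\<lambda>x. 0)"
  by (induction i arbitrary: j) auto

lemma jet_coeff_diag:
  fixes lam :: "'k::powr_field"
  assumes "deriv f x > 0"
  shows "jet_coeff lam f i i x = of_real (deriv f x) powr (lam + of_nat i)"
proof (induction i)
  case (Suc i)
  have "jet_coeff lam f (Suc i) (Suc i) x = of_real (deriv f x) * of_real (deriv f x) powr (lam + of_nat i)"
    using Suc by (simp add: jet_coeff_above)
  also have "\<dots> = of_real (deriv f x) powr of_nat 1 * of_real (deriv f x) powr (lam + of_nat i)"
    using powr_of_real_of_nat[OF assms, of 1, where 'k='k] unfolding power_one_right by simp
  also have "\<dots> = of_real (deriv f x) powr (lam + of_nat (Suc i))"
    by (subst powr_of_real_add[OF assms, symmetric]) (simp add: algebra_simps)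
  finally show ?case .
qed simp

text \<open>The summation bound n is kept free because the rows for all i are later summed up to the
  common order k.\<close>

lemma nderiv_rho:
  fixes \<phi> :: "real \<Rightarrow> 'k::powr_field"
  assumes "f \<in> Diffeo M" "smooth \<phi>" "i \<le> n"
  shows "nderiv i (rho lam f \<phi>) x = (\<Sum>j\<le>n. jet_coeff lam f i j x * nderiv j \<phi> (f x))"
  using assms(3)
proof (induction i arbitrary: x n)
  case 0
  then show ?case by (simp add: rho_def sum.remove[of _ 0] if_distrib cong: if_cong)
next
  case (Suc i)
  note f = DiffeoD[OF assms(1)]
  obtain m where n: "n = Suc m" "i \<le> m" using Suc.prems by (cases n) auto
  have sj: "smooth (jet_coeff lam f i j)" for j
    using jet_coeff_fn_space[OF assms(1)] fn_space_smooth by blast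
  have sn: "smooth (\<lambda>x. nderiv j \<phi> (f x))" for j
    by (rule smooth_compose[OF smooth_nderiv[OF assms(2)] f(1)])
  have "nderiv i (rho lam f \<phi>) = (\<lambda>x. \<Sum>j\<le>n. jet_coeff lam f i j x * nderiv j \<phi> (f x))"
    using Suc.IH[of n] Suc.prems by auto
  then have "nderiv (Suc i) (rho lam f \<phi>) x = vd (\<lambda>x. \<Sum>j\<le>n. jet_coeff lam f i j x * nderiv j \<phi> (f x)) x"
    by simp
  also have "\<dots> = (\<Sum>j\<le>n. jet_coeff lam f i j x * (of_real (deriv f x) * nderiv (Suc j) \<phi> (f x))
      + vd (jet_coeff lam f i j) x * nderiv j \<phi> (f x))"
  proof (rule vector_derivative_at, rule has_vector_derivative_sum)
    fix j
    have "((\<lambda>x. nderiv j \<phi> (f x)) has_vector_derivative of_real (deriv f x) * nderiv (Suc j) \<phi> (f x)) (at x)"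
      using smooth_has_vector_derivative[OF sn, of j x] vd_compose[OF f(1) smooth_nderiv[OF assms(2)], of j x] by simp
    then show "((\<lambda>x. jet_coeff lam f i j x * nderiv j \<phi> (f x)) has_vector_derivative
        jet_coeff lam f i j x * (of_real (deriv f x) * nderiv (Suc j) \<phi> (f x)) + vd (jet_coeff lam f i j) x * nderiv j \<phi> (f x)) (at x)"
      using has_vector_derivative_mult[OF smooth_has_vector_derivative[OF sj]] by blast
  qed
  also have "\<dots> = (\<Sum>j\<le>n. of_real (deriv f x) * jet_coeff lam f i j x * nderiv (Suc j) \<phi> (f x))
      + (\<Sum>j\<le>n. vd (jet_coeff lam f i j) x * nderiv j \<phi> (f x))"
    by (simp add: sum.distrib mult_ac)
  also have "(\<Sum>j\<le>n. of_real (deriv f x) * jet_coeff lam f i j x * nderiv (Suc j) \<phi> (f x))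
      = (\<Sum>j\<le>m. of_real (deriv f x) * jet_coeff lam f i j x * nderiv (Suc j) \<phi> (f x))"
    using n jet_coeff_above[of i "Suc m" lam f] by simp
  also have "\<dots> = (\<Sum>j\<le>n. (if j = 0 then 0 else of_real (deriv f x) * jet_coeff lam f i (j - 1) x) * nderiv j \<phi> (f x))"
    unfolding n(1) by (subst sum.atMost_Suc_shift) simp
  finally show ?case by (simp add: sum.distrib[symmetric] distrib_right algebra_simps cong: sum.cong)
qed

definition cact :: "nat \<Rightarrow> 'k::powr_field \<Rightarrow> 'k \<Rightarrow> (real \<Rightarrow> real) \<Rightarrow> (nat \<Rightarrow> real \<Rightarrow> 'k) \<Rightarrow> nat \<Rightarrow> real \<Rightarrow> 'k" where
  "cact k lam mu f a = (\<lambda>j y. if j \<le> k then of_real (deriv (inv f) y) powr mu *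
      (\<Sum>i\<le>k. a i (inv f y) * jet_coeff lam f i j (inv f y)) else 0)"

lemma cact_coeffs:
  assumes "a \<in> op_coeffs k M" "f \<in> Diffeo M"
  shows "cact k lam mu f a \<in> op_coeffs k M"
proof -
  have g: "inv f \<in> Diffeo M" by (rule Diffeo_inv[OF assms(2)])
  have "cact k lam mu f a j \<in> fn_space M" for j
  proof (cases "j \<le> k")
    case True
    have "(\<lambda>y. of_real (deriv (inv f) y) powr mu * (\<lambda>x. \<Sum>i\<le>k. a i x * jet_coeff lam f i j x) (inv f y)) \<in> fn_space M"
      by (rule fn_space_mult[OF fn_space_powr[OF fn_space_deriv_Diffeo[OF g] DiffeoD(4)[OF g]]
            fn_space_compose[OF fn_space_sum g]])
         (intro fn_space_mult coeffsD(1)[OF assms(1)] jet_coeff_fn_space[OF assms(2)])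
    then show ?thesis using True by (simp add: cact_def)
  qed (simp add: cact_def fn_space_const)
  then show ?thesis by (auto simp: op_coeffs_def cact_def)
qed

lemma op_at_cact:
  assumes "f \<in> Diffeo M" "smooth \<phi>"
  shows "op_at k (cact k lam mu f a) \<phi> y = rho mu (inv f) (op_at k a (rho lam f \<phi>)) y"
proof -
  define x where "x = inv f y"
  have fx: "f x = y" using DiffeoD(6)[OF assms(1)] by (simp add: x_def)
  have "op_at k a (rho lam f \<phi>) x = (\<Sum>i\<le>k. a i x * (\<Sum>j\<le>k. jet_coeff lam f i j x * nderiv j \<phi> y))"
    unfolding op_at_def using nderiv_rho[OF assms, of _ k lam x] fx by (intro sum.cong) auto
  also have "\<dots> = (\<Sum>j\<le>k. (\<Sum>i\<le>k. a i x * jet_coeff lam f i j x) * nderiv j \<phi> y)"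
    by (simp add: sum_distrib_left sum_distrib_right mult.assoc) (rule sum.swap)
  finally have e: "op_at k a (rho lam f \<phi>) x = (\<Sum>j\<le>k. (\<Sum>i\<le>k. a i x * jet_coeff lam f i j x) * nderiv j \<phi> y)" .
  have "rho mu (inv f) (op_at k a (rho lam f \<phi>)) y
      = of_real (deriv (inv f) y) powr mu * op_at k a (rho lam f \<phi>) x"
    by (simp add: rho_def x_def)
  moreover define S where "S = (\<lambda>j. \<Sum>i\<le>k. a i x * jet_coeff lam f i j x)"
  have "op_at k (cact k lam mu f a) \<phi> y = (\<Sum>j\<le>k. of_real (deriv (inv f) y) powr mu * S j * nderiv j \<phi> y)"
    unfolding op_at_def cact_def x_def[symmetric] S_def by simp
  ultimately show ?thesis
    unfolding e by (simp add: sum_distrib_left mult.assoc) (simp add: S_def)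
qed

lemma Dops_eq: "Dops k M = dop_of k M ` (op_coeffs k M :: (nat \<Rightarrow> real \<Rightarrow> 'k::real_normed_field) set)"
proof -
  have "dop_of k M a \<in> Dops k M" if "a \<in> op_coeffs k M" for a :: "nat \<Rightarrow> real \<Rightarrow> 'k"
    using that unfolding Dops_def op_coeffs_def dop_of_def op_at_def[abs_def] by auto
  moreover have "A \<in> dop_of k M ` op_coeffs k M" if A: "A \<in> Dops k M" for A :: "'k dop"
  proof -
    obtain a where a: "\<forall>i\<le>k. a i \<in> fn_space M"
      "A = (\<lambda>\<phi>. if \<phi> \<in> fn_space M then (\<lambda>x. \<Sum>i\<le>k. a i x * nderiv i \<phi> x) else (\<lambda>x. 0))"
      using A unfolding Dops_def by blast
    define b where "b = (\<lambda>i. if i \<le> k then a i else (\<lambda>x. 0))"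
    have "b \<in> op_coeffs k M" using a by (auto simp: b_def op_coeffs_def intro: fn_space_intros)
    moreover have "A = dop_of k M b" unfolding a(2) dop_of_def op_at_def[abs_def] b_def by auto
    ultimately show ?thesis by blast
  qed
  ultimately show ?thesis by blast
qed

lemma dop_of_inj: "inj_on (dop_of k M) (op_coeffs k M :: (nat \<Rightarrow> real \<Rightarrow> 'k::real_normed_field) set)"
proof (rule inj_onI)
  fix a b :: "nat \<Rightarrow> real \<Rightarrow> 'k" assume ab: "a \<in> op_coeffs k M" "b \<in> op_coeffs k M" "dop_of k M a = dop_of k M b"
  have "op_at k a \<phi> x = op_at k b \<phi> x" if "\<phi> \<in> fn_space M" for \<phi> x
    using fun_cong[OF fun_cong[OF ab(3), of \<phi>], of x] that by (simp add: dop_of_def)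
  then have "a i x = b i x" for i x
    using coeff_eqI[of M k a x b i] coeffsD(2)[OF ab(1)] coeffsD(2)[OF ab(2)] by (cases "i \<le> k") auto
  then show "a = b" by blast
qed

lemma dop_of_cadd: "dop_of k M (cadd a b) = op_add (dop_of k M a) (dop_of k M b)"
  by (auto simp: dop_of_def cadd_def op_add_def op_at_def distrib_right sum.distrib fun_eq_iff)

lemma dop_of_csmul: "dop_of k M (csmul c a) = op_smult c (dop_of k M a)"
  by (auto simp: dop_of_def csmul_def op_smult_def op_at_def sum_distrib_left mult.assoc fun_eq_iff)

lemma dop_of_cact:
  assumes "f \<in> Diffeo M"
  shows "dop_of k M (cact k lam mu f a) = act lam mu M f (dop_of k M a)"
proof (rule ext)
  fix \<phi>
  show "dop_of k M (cact k lam mu f a) \<phi> = act lam mu M f (dop_of k M a) \<phi>"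
  proof (cases "\<phi> \<in> fn_space M")
    case True
    then show ?thesis
      using op_at_cact[OF assms fn_space_smooth[OF True]] fn_space_rho[OF True assms]
      by (simp add: dop_of_def act_def fun_eq_iff)
  qed (simp add: dop_of_def act_def)
qed

section \<open>Algebras of equivariant endomorphisms\<close>

definition equiv_end :: "'x set \<Rightarrow> ('x \<Rightarrow> 'x \<Rightarrow> 'x) \<Rightarrow> ('s \<Rightarrow> 'x \<Rightarrow> 'x) \<Rightarrow> ('f \<Rightarrow> 'x \<Rightarrow> 'x) \<Rightarrow> 'f set \<Rightarrow> ('x \<Rightarrow> 'x) set" where
  "equiv_end X add sm mv F = {T. T \<in> extensional X \<and> (\<forall>A\<in>X. T A \<in> X) \<and>
      (\<forall>A\<in>X. \<forall>B\<in>X. T (add A B) = add (T A) (T B)) \<and>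
      (\<forall>c. \<forall>A\<in>X. T (sm c A) = sm c (T A)) \<and>
      (\<forall>f\<in>F. \<forall>A\<in>X. T (mv f A) = mv f (T A))}"

definition equiv_end_alg :: "'x set \<Rightarrow> ('x \<Rightarrow> 'x \<Rightarrow> 'x) \<Rightarrow> ('s \<Rightarrow> 'x \<Rightarrow> 'x) \<Rightarrow> ('f \<Rightarrow> 'x \<Rightarrow> 'x) \<Rightarrow> 'f set \<Rightarrow> ('s, 'x \<Rightarrow> 'x) kalg" where
  "equiv_end_alg X add sm mv F = \<lparr> acar = equiv_end X add sm mv F,
     aadd = (\<lambda>S T. restrict (\<lambda>A. add (S A) (T A)) X),
     amul = (\<lambda>S T. compose X S T),
     asmul = (\<lambda>c T. restrict (\<lambda>A. sm c (T A)) X) \<rparr>"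

text \<open>Transport of structure: conjugation with an equivariant linear bijection identifies the
  endomorphism algebras. Working with bare operations lets operators and coefficient families fit
  alike; closure of Y follows from that of X through the bijection.\<close>

locale equiv_iso =
  fixes X :: "'x set" and add sm mv and F :: "'f set"
    and Y :: "'y set" and add' and sm' :: "'s \<Rightarrow> 'y \<Rightarrow> 'y" and mv' and h :: "'x \<Rightarrow> 'y"
  assumes bij: "bij_betw h X Y"
    and closed: "A \<in> X \<Longrightarrow> B \<in> X \<Longrightarrow> add A B \<in> X" "A \<in> X \<Longrightarrow> sm c A \<in> X" "f \<in> F \<Longrightarrow> A \<in> X \<Longrightarrow> mv f A \<in> X"
    and hom: "A \<in> X \<Longrightarrow> B \<in> X \<Longrightarrow> h (add A B) = add' (h A) (h B)"
      "A \<in> X \<Longrightarrow> h (sm c A) = sm' c (h A)" "f \<in> F \<Longrightarrow> A \<in> X \<Longrightarrow> h (mv f A) = mv' f (h A)"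
begin

abbreviation "g \<equiv> inv_into X h"

lemma hg: "B \<in> Y \<Longrightarrow> h (g B) = B" "A \<in> X \<Longrightarrow> g (h A) = A" "B \<in> Y \<Longrightarrow> g B \<in> X" "A \<in> X \<Longrightarrow> h A \<in> Y"
  using bij by (auto simp: bij_betw_def f_inv_into_f inv_into_into)

lemma inverse_iso: "equiv_iso Y add' sm' mv' F X add sm mv g"
proof
  show "bij_betw g Y X" by (rule bij_betw_inv_into[OF bij])
  fix A B assume A: "A \<in> Y"
  { assume B: "B \<in> Y"
    have e: "h (add (g A) (g B)) = add' A B" using hom(1)[of "g A" "g B"] hg A B by simp
    then show "add' A B \<in> Y" "g (add' A B) = add (g A) (g B)"
      using hg(2,4)[of "add (g A) (g B)"] closed(1) hg(3) A B by metis+ }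
  { fix c have e: "h (sm c (g A)) = sm' c A" using hom(2)[of "g A"] hg A by simp
    then show "sm' c A \<in> Y" "g (sm' c A) = sm c (g A)"
      using hg(2,4)[of "sm c (g A)"] closed(2) hg(3) A by metis+ }
  { fix f assume f: "f \<in> F"
    have e: "h (mv f (g A)) = mv' f A" using hom(3)[OF f, of "g A"] hg A by simp
    then show "mv' f A \<in> Y" "g (mv' f A) = mv f (g A)"
      using hg(2,4)[of "mv f (g A)"] closed(3)[OF f] hg(3) A by metis+ }
qed

lemma conj_equiv_end:
  assumes "T \<in> equiv_end X add sm mv F"
  shows "restrict (\<lambda>B. h (T (g B))) Y \<in> equiv_end Y add' sm' mv' F"
proof -
  interpret inv: equiv_iso Y add' sm' mv' F X add sm mv g by (rule inverse_iso)
  show ?thesis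
    using assms hg inv.closed inv.hom hom unfolding equiv_end_def by auto
qed

lemma alg_isomorphic:
  "alg_isomorphic (equiv_end_alg X add sm mv F) (equiv_end_alg Y add' sm' mv' F)"
proof -
  interpret inv: equiv_iso Y add' sm' mv' F X add sm mv g by (rule inverse_iso)
  define \<Phi> where "\<Phi> = (\<lambda>T. restrict (\<lambda>B. h (T (g B))) Y)"
  define \<Psi> where "\<Psi> = (\<lambda>T. restrict (\<lambda>A. g (T (h A))) X)"
  have "inv_into Y g A = h A" if "A \<in> X" for A
    using that bij inv_into_inv_into_eq by metis
  then have \<Psi>: "\<Psi> T \<in> equiv_end X add sm mv F" if "T \<in> equiv_end Y add' sm' mv' F" for T
    using inv.conj_equiv_end[OF that] unfolding \<Psi>_def by (auto cong: restrict_cong)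
  have "bij_betw \<Phi> (equiv_end X add sm mv F) (equiv_end Y add' sm' mv' F)"
  proof (rule bij_betw_byWitness[where f'=\<Psi>])
    show "\<forall>T\<in>equiv_end X add sm mv F. \<Psi> (\<Phi> T) = T"
      using hg unfolding \<Psi>_def \<Phi>_def equiv_end_def by (auto simp: extensional_def fun_eq_iff)
    show "\<forall>T\<in>equiv_end Y add' sm' mv' F. \<Phi> (\<Psi> T) = T"
      using hg unfolding \<Psi>_def \<Phi>_def equiv_end_def by (auto simp: extensional_def fun_eq_iff)
  qed (use \<Psi> conj_equiv_end in \<open>auto simp: \<Phi>_def\<close>)
  moreover have "\<Phi> (restrict (\<lambda>A. add (S A) (T A)) X) = restrict (\<lambda>B. add' (\<Phi> S B) (\<Phi> T B)) Y"
      "\<Phi> (compose X S T) = compose Y (\<Phi> S) (\<Phi> T)"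
    if "S \<in> equiv_end X add sm mv F" "T \<in> equiv_end X add sm mv F" for S T
    using that hg hom unfolding \<Phi>_def equiv_end_def by (auto simp: fun_eq_iff compose_def)
  moreover have "\<Phi> (restrict (\<lambda>A. sm c (T A)) X) = restrict (\<lambda>B. sm' c (\<Phi> T B)) Y"
    if "T \<in> equiv_end X add sm mv F" for T c
    using that hg hom unfolding \<Phi>_def equiv_end_def by (auto simp: fun_eq_iff)
  ultimately show ?thesis
    unfolding alg_isomorphic_def equiv_end_alg_def by (intro exI[of _ \<Phi>]) auto
qed

end

lemma alg_isomorphic_trans:
  assumes "alg_isomorphic A B" "alg_isomorphic B C"
  shows "alg_isomorphic A C"
proof -
  obtain h where h: "bij_betw h (acar A) (acar B)"
    "\<And>x y. x \<in> acar A \<Longrightarrow> y \<in> acar A \<Longrightarrow> h (aadd A x y) = aadd B (h x) (h y) \<and> h (amul A x y) = amul B (h x) (h y)"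
    "\<And>c x. x \<in> acar A \<Longrightarrow> h (asmul A c x) = asmul B c (h x)"
    using assms(1) unfolding alg_isomorphic_def by blast
  obtain g where g: "bij_betw g (acar B) (acar C)"
    "\<And>x y. x \<in> acar B \<Longrightarrow> y \<in> acar B \<Longrightarrow> g (aadd B x y) = aadd C (g x) (g y) \<and> g (amul B x y) = amul C (g x) (g y)"
    "\<And>c x. x \<in> acar B \<Longrightarrow> g (asmul B c x) = asmul C c (g x)"
    using assms(2) unfolding alg_isomorphic_def by blast
  have "h x \<in> acar B" if "x \<in> acar A" for x using h(1) that by (auto simp: bij_betw_def)
  then show ?thesis unfolding alg_isomorphic_def
    by (intro exI[of _ "g \<circ> h"] conjI bij_betw_trans[OF h(1) g(1)]) (auto simp: h g)
qed

definition Cend :: "nat \<Rightarrow> 'k::powr_field \<Rightarrow> 'k \<Rightarrow> mfd \<Rightarrow> _" where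
  "Cend k lam mu M = equiv_end (op_coeffs k M) cadd csmul (cact k lam mu) (Diffeo M)"

definition Cend_alg :: "nat \<Rightarrow> 'k::powr_field \<Rightarrow> 'k \<Rightarrow> mfd \<Rightarrow> _" where
  "Cend_alg k lam mu M = equiv_end_alg (op_coeffs k M) cadd csmul (cact k lam mu) (Diffeo M)"

lemma Ialg_eq: "Ialg k lam mu M = equiv_end_alg (Dops k M) op_add op_smult (act lam mu M) (Diffeo M)"
  unfolding Ialg_def Iset_def equiv_end_alg_def equiv_end_def ..

lemma dop_of_iso:
  "equiv_iso (op_coeffs k M) cadd csmul (cact k lam mu) (Diffeo M)
     (Dops k M) op_add op_smult (act lam mu M) (dop_of k M)"
  by standard
     (auto simp: bij_betw_def dop_of_inj Dops_eq dop_of_cadd dop_of_csmul dop_of_cact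
        intro: cadd_coeffs csmul_coeffs cact_coeffs)

lemma Cend_iso_Ialg: "alg_isomorphic (Cend_alg k lam mu M) (Ialg k lam mu M)"
  unfolding Cend_alg_def Ialg_eq by (rule equiv_iso.alg_isomorphic[OF dop_of_iso])

lemma Ialg_iso_Cend: "alg_isomorphic (Ialg k lam mu M) (Cend_alg k lam mu M)"
  unfolding Cend_alg_def Ialg_eq
  by (rule equiv_iso.alg_isomorphic[OF equiv_iso.inverse_iso[OF dop_of_iso]])

section \<open>Symbols, and dependence of the action on germs\<close>

definition csub :: "(nat \<Rightarrow> real \<Rightarrow> 'k::real_normed_field) \<Rightarrow> (nat \<Rightarrow> real \<Rightarrow> 'k) \<Rightarrow> nat \<Rightarrow> real \<Rightarrow> 'k" where
  "csub a b = (\<lambda>i x. a i x - b i x)"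

lemma csub_eq: "csub a b = cadd a (csmul (-1) b)"
  by (simp add: csub_def cadd_def csmul_def)

lemma csub_coeffs: "a \<in> op_coeffs k M \<Longrightarrow> b \<in> op_coeffs k M \<Longrightarrow> csub a b \<in> op_coeffs k M"
  unfolding csub_eq by (intro cadd_coeffs csmul_coeffs)

lemma zero_coeffs: "(\<lambda>i x. 0) \<in> op_coeffs k M"
  by (auto simp: op_coeffs_def intro: fn_space_const)

definition monomial :: "nat \<Rightarrow> (real \<Rightarrow> 'k::real_normed_field) \<Rightarrow> nat \<Rightarrow> real \<Rightarrow> 'k" where
  "monomial n q = (\<lambda>i x. if i = n then q x else 0)"

lemma monomial_coeffs: "n \<le> k \<Longrightarrow> q \<in> fn_space M \<Longrightarrow> monomial n q \<in> op_coeffs k M"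
  unfolding op_coeffs_def mem_Collect_eq
proof (intro conjI allI impI)
  fix i assume "n \<le> k" "q \<in> fn_space M"
  then show "monomial n q i \<in> fn_space M"
    by (cases "i = n") (simp_all add: monomial_def fn_space_const)
qed (simp add: monomial_def)

lemma CendD:
  assumes "T \<in> Cend k lam mu M"
  shows "a \<in> op_coeffs k M \<Longrightarrow> T a \<in> op_coeffs k M"
    "a \<in> op_coeffs k M \<Longrightarrow> b \<in> op_coeffs k M \<Longrightarrow> T (cadd a b) = cadd (T a) (T b)"
    "a \<in> op_coeffs k M \<Longrightarrow> T (csmul c a) = csmul c (T a)"
    "f \<in> Diffeo M \<Longrightarrow> a \<in> op_coeffs k M \<Longrightarrow> T (cact k lam mu f a) = cact k lam mu f (T a)"
  using assms unfolding Cend_def equiv_end_def by blast+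

lemma Cend_csub:
  assumes "T \<in> Cend k lam mu M" "a \<in> op_coeffs k M" "b \<in> op_coeffs k M"
  shows "T (csub a b) = csub (T a) (T b)"
  unfolding csub_eq using CendD(2,3)[OF assms(1)] assms csmul_coeffs by metis

lemma Cend_zero:
  assumes "T \<in> Cend k lam mu M"
  shows "T (\<lambda>i x. 0) = (\<lambda>i x. 0)"
  using CendD(3)[OF assms zero_coeffs, of 0] by (simp add: csmul_def)

lemma Cend_add_at:
  assumes "T \<in> Cend k lam mu M" "a \<in> op_coeffs k M" "b \<in> op_coeffs k M"
  shows "T (\<lambda>i x. a i x + b i x) j y = T a j y + T b j y"
  using CendD(2)[OF assms] by (simp add: cadd_def)

lemma Cend_diff_at:
  assumes "T \<in> Cend k lam mu M" "a \<in> op_coeffs k M" "b \<in> op_coeffs k M"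
  shows "T (\<lambda>i x. a i x - b i x) j y = T a j y - T b j y"
  using Cend_csub[OF assms] by (simp add: csub_def)

lemma Cend_smul_at:
  assumes "T \<in> Cend k lam mu M" "a \<in> op_coeffs k M"
  shows "T (\<lambda>i x. c * a i x) j y = c * T a j y"
  using CendD(3)[OF assms] by (simp add: csmul_def)

lemma deriv_local_cong:
  assumes "open S" "x \<in> S" "\<And>y. y \<in> S \<Longrightarrow> f y = g y" "smooth f" "smooth g"
  shows "deriv f x = deriv (g :: real \<Rightarrow> real) x"
  using vd_local_cong[OF assms(1-3)] assms(4,5) by (simp add: deriv_eq_vd)

lemma jet_coeff_germ:
  assumes "f \<in> Diffeo M" "g \<in> Diffeo N" "open S" "x \<in> S" "\<And>y. y \<in> S \<Longrightarrow> f y = g y"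
  shows "jet_coeff lam f i j x = jet_coeff lam g i j x"
proof -
  have d: "deriv f y = deriv g y" if "y \<in> S" for y
    by (rule deriv_local_cong[OF assms(3) that assms(5) DiffeoD(1)[OF assms(1)] DiffeoD(1)[OF assms(2)]])
  have "\<forall>j. \<forall>y\<in>S. jet_coeff lam f i j y = jet_coeff lam g i j y"
  proof (induction i)
    case (Suc i)
    have "vd (jet_coeff lam f i j) y = vd (jet_coeff lam g i j) y" if "y \<in> S" for y j
      using Suc vd_local_cong[OF assms(3) that] by blast
    then show ?case using Suc d by simp
  qed (simp add: d)
  then show ?thesis using assms(4) by blast
qed

lemma cact_at:
  assumes "f \<in> Diffeo M"
  shows "cact k lam mu f a j (f x) = (if j \<le> k then of_real (deriv f x) powr (- mu) *
      (\<Sum>i\<le>k. a i x * jet_coeff lam f i j x) else 0)"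
  using powr_of_real_inverse[OF DiffeoD(4)[OF assms, of x], of mu]
  by (simp add: cact_def DiffeoD(5)[OF assms] deriv_inv_Diffeo[OF assms])

text \<open>M and N may differ: a circle diffeomorphism can be compared with an affine map, or with
  any diffeomorphism of the line having the same germ.\<close>

lemma cact_germ:
  assumes "f \<in> Diffeo M" "g \<in> Diffeo N" "open S" "x \<in> S" "\<And>y. y \<in> S \<Longrightarrow> f y = g y"
    "\<And>i. a i x = b i x"
  shows "cact k lam mu f a j (f x) = cact k lam mu g b j (f x)"
proof -
  have "deriv f x = deriv g x"
    by (rule deriv_local_cong[OF assms(3,4,5) DiffeoD(1)[OF assms(1)] DiffeoD(1)[OF assms(2)]])
  moreover have "f x = g x" using assms(4,5) by blast
  ultimately show ?thesis
    using cact_at[OF assms(1), of k lam mu a j x] cact_at[OF assms(2), of k lam mu b j x]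
      jet_coeff_germ[OF assms(1-5), of lam] assms(6) by (simp del: mult_cancel_left)
qed

lemma deriv_shift: "deriv (\<lambda>x. x + c) x = (1::real)"
  by (rule DERIV_imp_deriv) (auto intro!: derivative_eq_intros)

lemma jet_coeff_shift: "jet_coeff lam (\<lambda>x. x + c) i j = (\<lambda>x. if i = j then 1 else 0)"
proof (induction i arbitrary: j)
  case (Suc i)
  have "vd (jet_coeff lam (\<lambda>x. x + c) i j) x = 0" for x j
    unfolding Suc by simp
  then show ?case using Suc by (cases j) (auto simp: deriv_shift)
qed (auto simp: deriv_shift)

lemma cact_shift:
  assumes "f \<in> Diffeo M" "open S" "x \<in> S" "\<And>y. y \<in> S \<Longrightarrow> f y = y + c" "a \<in> op_coeffs k N"
  shows "cact k lam mu f a j (x + c) = a j x"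
proof -
  have "cact k lam mu f a j (f x) = cact k lam mu (\<lambda>x. x + c) a j (f x)"
    using cact_germ[OF assms(1) Diffeo_shift[of c M] assms(2,3)] assms(4) by blast
  then show ?thesis
    using cact_at[OF Diffeo_shift[of c M], of k lam mu a j x] assms(3,4) coeffsD(2)[OF assms(5), of j x]
    by (cases "j \<le> k") (auto simp: jet_coeff_shift deriv_shift if_distrib cong: if_cong)
qed

lemma cact_ident:
  assumes "f \<in> Diffeo M" "open S" "x \<in> S" "\<And>y. y \<in> S \<Longrightarrow> f y = y" "a \<in> op_coeffs k N"
  shows "cact k lam mu f a j x = a j x"
  using cact_shift[of f M S x 0 a k N lam mu j] assms by simp

lemma cact_zero_at:
  assumes "f \<in> Diffeo M" "\<And>i. a i x = 0"
  shows "cact k lam mu f a j (f x) = 0"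
  by (simp add: cact_at[OF assms(1)] assms(2))

text \<open>Only the diagonal jet coefficient reaches the leading order, so a symbol of order n
  behaves as a density of weight mu - lam - n.\<close>

lemma cact_leading:
  assumes "f \<in> Diffeo M" "\<And>i. i > n \<Longrightarrow> a i x = 0" "n \<le> k"
  shows "j > n \<Longrightarrow> cact k lam mu f a j (f x) = 0"
    "cact k lam mu f a n (f x) = of_real (deriv f x) powr (lam + of_nat n - mu) * a n x"
proof -
  note d = DiffeoD(4)[OF assms(1), of x]
  show "cact k lam mu f a j (f x) = 0" if "j > n"
  proof -
    have "a i x * jet_coeff lam f i j x = 0" for i
      using assms(2)[of i] jet_coeff_above[of i j lam f] that by (cases "i > n") auto
    then have "(\<Sum>i\<le>k. a i x * jet_coeff lam f i j x) = 0" by (intro sum.neutral) blast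
    then show ?thesis by (simp add: cact_at[OF assms(1)])
  qed
  have "a i x * jet_coeff lam f i n x = 0" if "i \<noteq> n" for i
    using assms(2)[of i] jet_coeff_above[of i n lam f] that by (cases "i > n") auto
  then have "(\<Sum>i\<le>k. a i x * jet_coeff lam f i n x) = (\<Sum>i\<le>k. if i = n then a n x * jet_coeff lam f n n x else 0)"
    by (intro sum.cong) auto
  also have "\<dots> = a n x * jet_coeff lam f n n x" using assms(3) by simp
  finally have "(\<Sum>i\<le>k. a i x * jet_coeff lam f i n x) = a n x * jet_coeff lam f n n x" .
  moreover have "(of_real (deriv f x) :: 'a) powr (lam + of_nat n - mu)
      = of_real (deriv f x) powr (- mu) * of_real (deriv f x) powr (lam + of_nat n)"
    using powr_of_real_add[OF d, of "- mu" "lam + of_nat n"] by (simp add: algebra_simps)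
  ultimately show "cact k lam mu f a n (f x) = of_real (deriv f x) powr (lam + of_nat n - mu) * a n x"
    using cact_at[OF assms(1), of k lam mu a n x] assms(3) jet_coeff_diag[OF d, of lam n] by (simp add: mult_ac)
qed

section \<open>Locality on the line\<close>

text \<open>An operator supported on one side of x0 is a coboundary b - f b of a translation-like
  diffeomorphism f that is the identity near x0: sum up its translates moving away from x0.\<close>
lemma Line_one_sided_local:
  assumes T: "T \<in> Cend k lam mu Line" and a: "a \<in> op_coeffs k Line" and s: "s = 1 \<or> s = -1"
    and eta: "\<eta> > 0" and a0: "\<And>i y. s * (y - x0) < \<eta> \<Longrightarrow> a i y = 0"
  shows "T a j x0 = 0"
proof -
  have ss [simp]: "s * s = 1" "s * (s * x) = x" for x using s by auto
  \<comment> \<open>Translates of a by at least \<open>N y\<close> steps vanish at y, so the formal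
    sum of all translates is finite there; \<open>b_eq\<close> allows any larger bound, in
    particular one uniform near a point.\<close>
  define N where "N = (\<lambda>y. nat \<lceil>s * (y - x0)\<rceil>)"
  define b where "b = (\<lambda>i y. \<Sum>n<N y. a i (y - s * real n))"
  have b_eq: "b i y = (\<Sum>n<m. a i (y - s * real n))" if "s * (y - x0) \<le> real m" for i y m
  proof -
    have "N y \<le> m" using that by (simp add: N_def ceiling_le)
    then show ?thesis unfolding b_def
    proof (intro sum.mono_neutral_left ballI)
      fix n assume n: "n \<in> {..<m} - {..<N y}"
      then have "s * (y - x0) \<le> real n" by (simp add: N_def)
      then have "s * (y - s * real n - x0) < \<eta>" using eta by (simp add: algebra_simps)
      then show "a i (y - s * real n) = 0" by (rule a0)
    qed auto
  qed
  have "smooth (b i)" for i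
  proof (rule smooth_local)
    fix x
    define m where "m = nat \<lceil>s * (x - x0)\<rceil> + 1"
    have "\<forall>y\<in>ball x 1. b i y = (\<Sum>n<m. a i (y + (- s * real n)))"
    proof
      fix y assume "y \<in> ball x 1"
      then have "s * (y - x) \<le> 1" using s by (auto simp: dist_real_def)
      then have "s * (y - x0) \<le> s * (x - x0) + 1" by (simp add: algebra_simps)
      then have "s * (y - x0) \<le> real m" unfolding m_def by linarith
      then show "b i y = (\<Sum>n<m. a i (y + (- s * real n)))" using b_eq by simp
    qed
    moreover have "smooth (\<lambda>y. \<Sum>n<m. a i (y + (- s * real n)))"
      by (rule smooth_sum, rule smooth_compose[OF coeffs_smooth[OF a]])
         (intro smooth_add smooth_ident smooth_const)
    ultimately show "\<exists>g S. open S \<and> x \<in> S \<and> smooth g \<and> (\<forall>y\<in>S. b i y = g y)"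
      by (intro exI[of _ "\<lambda>y. \<Sum>n<m. a i (y + (- s * real n))"] exI[of _ "ball x 1"]) auto
  qed
  moreover have "b i = (\<lambda>x. 0)" if "i > k" for i using coeffsD(2)[OF a that] by (simp add: b_def)
  ultimately have b: "b \<in> op_coeffs k Line" by (simp add: op_coeffs_def fn_space_def)
  have b_rec: "b i y = a i y + b i (y - s)" for i y
  proof -
    define m where "m = nat \<lceil>s * (y - x0)\<rceil>"
    have m: "s * (y - x0) \<le> real m" unfolding m_def by linarith
    have "b i y = (\<Sum>n<Suc m. a i (y - s * real n))" by (rule b_eq) (use m in simp)
    also have "\<dots> = a i y + (\<Sum>n<m. a i (y - s - s * real n))"
      by (subst sum.lessThan_Suc_shift) (simp add: algebra_simps)
    also have "(\<Sum>n<m. a i (y - s - s * real n)) = b i (y - s)"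
      by (rule b_eq[symmetric]) (use m in \<open>simp add: algebra_simps\<close>)
    finally show ?thesis .
  qed
  have b0: "b i y = 0" if "s * (y - x0) < \<eta>" for i y
  proof -
    have "s * (y - s * real n - x0) < \<eta>" for n using that by (simp add: algebra_simps)
    then have "a i (y - s * real n) = 0" for n by (rule a0)
    then show ?thesis by (simp add: b_def)
  qed
  \<comment> \<open>Maps the zone where s * (y - x0) runs from \<eta> / 3 to 2 * \<eta> / 3 onto the
    unit interval, so that f is the identity before it and the translation by s after it.\<close>
  define u where "u = (\<lambda>y. 3 * s * (y - x0) / \<eta> - 1)"
  define f where "f = (\<lambda>y. y + s * step_fn (u y))"
  have "smooth u" unfolding u_def using eta by (intro smooth_intros) auto
  then have f_smooth: "smooth f" unfolding f_def by (intro smooth_intros smooth_compose[OF smooth_step_fn])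
  have f': "deriv f y \<ge> 1" for y
  proof -
    have "(u has_real_derivative 3 * s / \<eta>) (at y)" unfolding u_def
      using eta by (auto intro!: derivative_eq_intros)
    then have "(f has_real_derivative 1 + s * (deriv step_fn (u y) * (3 * s / \<eta>))) (at y)"
      unfolding f_def by (intro DERIV_add DERIV_ident DERIV_cmult DERIV_chain2[OF smooth_DERIV[OF smooth_step_fn]])
    then have "deriv f y = 1 + s * (deriv step_fn (u y) * (3 * s / \<eta>))" by (rule DERIV_imp_deriv)
    also have "s * (deriv step_fn (u y) * (3 * s / \<eta>)) = deriv step_fn (u y) * 3 / \<eta> * (s * s)" by simp
    finally show ?thesis using step_fn_deriv_nonneg[of "u y"] eta by simp
  qed
  have f: "f \<in> Diffeo Line" by (rule DiffeoI[OF f_smooth f']) auto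
  have f_id: "f y = y" if "s * (y - x0) < \<eta> / 3" for y
    using that eta by (simp add: f_def u_def step_fn_eq_0 field_simps)
  have f_sh: "f y = y + s" if "s * (y - x0) > 2 * \<eta> / 3" for y
    using that eta by (simp add: f_def u_def step_fn_eq_1 field_simps)
  \<comment> \<open>The shape of f in the transition zone is harmless: b still vanishes there, and
    where b can be nonzero f is a translation.\<close>
  have cb: "cact k lam mu f b i z = b i (z - s)" for i z
  proof -
    define y where "y = inv f z"
    have z: "z = f y" using DiffeoD(6)[OF f] by (simp add: y_def)
    show ?thesis
    proof (cases "s * (y - x0) < \<eta>")
      case True
      then have "b i y = 0" for i by (rule b0)
      then have "cact k lam mu f b i z = 0" unfolding z by (rule cact_zero_at[OF f])
      moreover have "s * (z - s - x0) < \<eta>"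
      proof -
        have "s * (z - s - x0) = s * (y - x0) + step_fn (u y) - 1" unfolding z f_def by (simp add: algebra_simps)
        then show ?thesis using step_fn_range(2)[of "u y"] True by linarith
      qed
      ultimately show ?thesis using b0 by simp
    next
      case False
      have o: "open {y. s * (y - x0) > 2 * \<eta> / 3}" by (intro open_Collect_less continuous_intros)
      have y: "y \<in> {y. s * (y - x0) > 2 * \<eta> / 3}" using False eta by auto
      have "cact k lam mu f b i (y + s) = b i y"
        by (rule cact_shift[OF f o y _ b]) (use f_sh in auto)
      then show ?thesis using z f_sh y by simp
    qed
  qed
  have "a i x = b i x - cact k lam mu f b i x" for i x using b_rec[of i x] by (simp add: cb)
  then have "a = (\<lambda>i x. b i x - cact k lam mu f b i x)" by blast
  then have "T a j x0 = T b j x0 - T (cact k lam mu f b) j x0"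
    using Cend_diff_at[OF T b cact_coeffs[OF b f]] by simp
  also have "T (cact k lam mu f b) j x0 = cact k lam mu f (T b) j x0" by (simp add: CendD(4)[OF T f b])
  also have "\<dots> = T b j x0"
  proof (rule cact_ident[OF f, where S="{y. s * (y - x0) < \<eta> / 3}"])
    show "open {y. s * (y - x0) < \<eta> / 3}" by (intro open_Collect_less continuous_intros)
  qed (use eta f_id CendD(1)[OF T b] in auto)
  finally show ?thesis by simp
qed

text \<open>Since a vanishes near x0, its restrictions to the two sides of x0 extend smoothly by
  zero, and the one-sided case covers each of them.\<close>

lemma Line_local:
  assumes T: "T \<in> Cend k lam mu Line" and a: "a \<in> op_coeffs k Line"
    and S: "open S" "x0 \<in> S" "\<And>i y. y \<in> S \<Longrightarrow> a i y = 0"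
  shows "T a j x0 = 0"
proof -
  obtain \<eta> where eta: "\<eta> > 0" "\<And>y. \<bar>y - x0\<bar> < \<eta> \<Longrightarrow> y \<in> S"
    using S(1,2) unfolding open_dist by (auto simp: dist_real_def)
  define c where "c = (\<lambda>s i y. if s * (y - x0) > 0 then a i y else 0)"
  have c0: "c s i y = 0" if "s = 1 \<or> s = -1" "s * (y - x0) < \<eta>" for s i y
    using that eta(2)[of y] S(3)[of y] by (auto simp: c_def abs_if)
  have c: "c s \<in> op_coeffs k Line" if s: "s = 1 \<or> s = -1" for s
  proof -
    have "smooth (c s i)" for i
    proof (rule smooth_local)
      fix x
      show "\<exists>g S. open S \<and> x \<in> S \<and> smooth g \<and> (\<forall>y\<in>S. c s i y = g y)"
      proof (cases "s * (x - x0) < \<eta>")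
        case True
        have "open {y. s * (y - x0) < \<eta>}" by (intro open_Collect_less continuous_intros)
        then show ?thesis using c0[OF s] True
          by (intro exI[of _ "\<lambda>y. 0"] exI[of _ "{y. s * (y - x0) < \<eta>}"]) (auto intro: smooth_const)
      next
        case False
        have "open {y. 0 < s * (y - x0)}" by (intro open_Collect_less continuous_intros)
        then show ?thesis using False eta(1) coeffs_smooth[OF a]
          by (intro exI[of _ "a i"] exI[of _ "{y. 0 < s * (y - x0)}"]) (auto simp: c_def)
      qed
    qed
    then show ?thesis using coeffsD(2)[OF a] by (auto simp: op_coeffs_def fn_space_def c_def)
  qed
  have "a i y = c 1 i y + c (-1) i y" for i y
    using S(3)[OF S(2)] by (cases "y = x0") (auto simp: c_def)
  then have ac: "a = (\<lambda>i y. c 1 i y + c (-1) i y)" by blast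
  have "c 1 \<in> op_coeffs k Line" "c (-1) \<in> op_coeffs k Line" by (rule c, simp)+
  from Cend_add_at[OF T this, of j x0, folded ac]
  have "T a j x0 = T (c 1) j x0 + T (c (-1)) j x0" .
  also have "T (c 1) j x0 = 0"
    by (rule Line_one_sided_local[OF T c[of 1] _ eta(1), of 1]) (use c0[of 1] in simp_all)
  also have "T (c (-1)) j x0 = 0"
    by (rule Line_one_sided_local[OF T c[of "-1"] _ eta(1), of "-1"]) (use c0[of "-1"] in simp_all)
  finally show ?thesis by simp
qed

definition Cend_local :: "mfd \<Rightarrow> nat \<Rightarrow> ((nat \<Rightarrow> real \<Rightarrow> 'k::real_normed_field) \<Rightarrow> nat \<Rightarrow> real \<Rightarrow> 'k) \<Rightarrow> bool" where
  "Cend_local M k T \<longleftrightarrow> (\<forall>a\<in>op_coeffs k M. \<forall>S x j. open S \<longrightarrow> x \<in> S \<longrightarrow> (\<forall>i. \<forall>y\<in>S. a i y = 0) \<longrightarrow> T a j x = 0)"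

lemma Cend_local_Line: "T \<in> Cend k lam mu Line \<Longrightarrow> Cend_local Line k T"
  unfolding Cend_local_def using Line_local by blast

lemma Cend_local_cong:
  assumes "T \<in> Cend k lam mu M" "Cend_local M k T" "a \<in> op_coeffs k M" "b \<in> op_coeffs k M"
    "open S" "x \<in> S" "\<And>i y. y \<in> S \<Longrightarrow> a i y = b i y"
  shows "T a j x = T b j x"
proof -
  have "T (\<lambda>i x. a i x - b i x) j x = 0"
    using assms(2)[unfolded Cend_local_def, rule_format, OF csub_coeffs[OF assms(3,4)] assms(5,6)] assms(7)
    by (simp add: csub_def)
  then show ?thesis using Cend_diff_at[OF assms(1,3,4)] by simp
qed

section \<open>Periodization and germs of circle diffeomorphisms\<close>

text \<open>Evaluates h at the translate of y lying in [x0 - 1/2, x0 + 1/2); smoothness survives at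
  the seam if h vanishes near both ends.\<close>

definition periodize :: "real \<Rightarrow> (real \<Rightarrow> 'k) \<Rightarrow> real \<Rightarrow> 'k" where
  "periodize x0 h = (\<lambda>y. h (y - of_int \<lfloor>y - x0 + 1/2\<rfloor>))"

lemma periodize_periodic: "periodize x0 h (y + 1) = periodize x0 h y"
proof -
  have "\<lfloor>y + 1 - x0 + 1/2\<rfloor> = \<lfloor>y - x0 + 1/2\<rfloor> + 1" by linarith
  then show ?thesis unfolding periodize_def by (simp add: algebra_simps)
qed

lemma periodize_eq:
  assumes "\<And>y. \<bar>y - x0\<bar> \<ge> r \<Longrightarrow> h y = 0" "r < 1/2" "\<bar>y - x0\<bar> \<le> 1/2"
  shows "periodize x0 h y = h y"
proof (cases "y - x0 = 1/2")
  case True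
  then have "y - x0 + 1/2 = 1" by linarith
  then have "\<lfloor>y - x0 + 1/2\<rfloor> = 1" by (metis floor_one)
  moreover have "h y = 0" "h (y - 1) = 0" using True assms(2) by (auto intro!: assms(1))
  ultimately show ?thesis unfolding periodize_def by simp
next
  case False
  moreover have "y - x0 \<le> 1/2" "- (1/2) \<le> y - x0" using assms(3) by linarith+
  ultimately have "0 \<le> y - x0 + 1/2" "y - x0 + 1/2 < 1" by auto
  then have "\<lfloor>y - x0 + 1/2\<rfloor> = 0" by (simp add: floor_eq_iff)
  then show ?thesis unfolding periodize_def by simp
qed

lemma periodize_zero:
  assumes "\<And>y. \<bar>y - x0\<bar> \<ge> r \<Longrightarrow> h y = 0" "\<And>n::int. \<bar>y - of_int n - x0\<bar> \<ge> r"
  shows "periodize x0 h y = 0"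
  unfolding periodize_def by (rule assms(1)) (rule assms(2))

text \<open>Off the seam the floor is locally constant; near the seam h vanishes on both sides.
  Smoothness and derivative bounds are read off from this alternative.\<close>

lemma periodize_local:
  assumes h: "\<And>y. \<bar>y - x0\<bar> \<ge> r \<Longrightarrow> h y = 0" and r: "0 < r" "r < 1/2"
  shows "\<exists>S c. open S \<and> y \<in> S \<and> ((\<forall>z\<in>S. periodize x0 h z = h (z + c)) \<or> (\<forall>z\<in>S. periodize x0 h z = 0))"
proof -
  define n where "n = \<lfloor>y - x0 + 1/2\<rfloor>"
  have n: "of_int n \<le> y - x0 + 1/2" "y - x0 + 1/2 < of_int n + 1" unfolding n_def by linarith+
  show ?thesis
  proof (cases "of_int n < y - x0 + 1/2")
    case True
    define S where "S = {of_int n + x0 - 1/2 <..< of_int n + x0 + 1/2}"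
    have "periodize x0 h z = h (z + (- of_int n))" if "z \<in> S" for z
    proof -
      have "\<lfloor>z - x0 + 1/2\<rfloor> = n" using that by (auto simp: S_def floor_eq_iff)
      then show ?thesis by (simp add: periodize_def)
    qed
    then show ?thesis using True n by (intro exI[of _ S] exI[of _ "- of_int n"]) (auto simp: S_def)
  next
    case False
    then have y: "y = of_int n + x0 - 1/2" using n by linarith
    define S where "S = ball y (1/2 - r)"
    have "periodize x0 h z = 0" if "z \<in> S" for z
    proof -
      have z: "\<bar>z - y\<bar> < 1/2 - r" using that by (simp add: S_def dist_real_def abs_minus_commute)
      show ?thesis
      proof (cases "z \<ge> y")
        case True
        then have "\<lfloor>z - x0 + 1/2\<rfloor> = n" using z r y by (auto simp: floor_eq_iff)
        then show ?thesis unfolding periodize_def by (intro h) (use z y True in auto)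
      next
        case False
        then have "\<lfloor>z - x0 + 1/2\<rfloor> = n - 1" using z r y by (auto simp: floor_eq_iff)
        then show ?thesis unfolding periodize_def by (intro h) (use z y False in auto)
      qed
    qed
    then show ?thesis using r by (intro exI[of _ S]) (auto simp: S_def)
  qed
qed

lemma periodize_fn_space:
  fixes h :: "real \<Rightarrow> 'k::real_normed_field"
  assumes h: "\<And>y. \<bar>y - x0\<bar> \<ge> r \<Longrightarrow> h y = 0" "0 < r" "r < 1/2" and s: "smooth h"
  shows "periodize x0 h \<in> fn_space M"
proof -
  have "smooth (periodize x0 h)"
  proof (rule smooth_local)
    fix y
    have "\<exists>S c. open S \<and> y \<in> S \<and> ((\<forall>z\<in>S. periodize x0 h z = h (z + c)) \<or> (\<forall>z\<in>S. periodize x0 h z = 0))"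
      by (rule periodize_local[OF h])
    then obtain S c where S: "open S" "y \<in> S" "(\<forall>z\<in>S. periodize x0 h z = h (z + c)) \<or> (\<forall>z\<in>S. periodize x0 h z = 0)"
      by blast
    have "smooth (\<lambda>z. h (z + c))" by (rule smooth_compose[OF s]) (intro smooth_add smooth_ident smooth_const)
    then have "\<exists>g. smooth g \<and> (\<forall>z\<in>S. periodize x0 h z = g z)"
      using S(3) smooth_const[of "0::'k"] by (elim disjE) (rule exI, erule conjI, assumption)+
    then show "\<exists>g S. open S \<and> y \<in> S \<and> smooth g \<and> (\<forall>z\<in>S. periodize x0 h z = g z)"
      using S(1,2) by blast
  qed
  then show ?thesis using periodize_periodic[of x0 h] by (simp add: fn_space_def)
qed

lemma periodize_deriv_bound:
  fixes h :: "real \<Rightarrow> real"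
  assumes h: "\<And>y. \<bar>y - x0\<bar> \<ge> r \<Longrightarrow> h y = 0" "0 < r" "r < 1/2" and s: "smooth h"
    and B: "\<And>y. \<bar>deriv h y\<bar> \<le> B"
  shows "\<bar>deriv (periodize x0 h) y\<bar> \<le> B"
proof -
  have sp: "smooth (periodize x0 h)" using periodize_fn_space[OF assms(1-4)] fn_space_smooth by blast
  have "\<exists>S c. open S \<and> y \<in> S \<and> ((\<forall>z\<in>S. periodize x0 h z = h (z + c)) \<or> (\<forall>z\<in>S. periodize x0 h z = 0))"
    by (rule periodize_local[OF h])
  then obtain S c where S: "open S" "y \<in> S" "(\<forall>z\<in>S. periodize x0 h z = h (z + c)) \<or> (\<forall>z\<in>S. periodize x0 h z = 0)"
    by blast
  from S(3) show ?thesis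
  proof
    assume *: "\<forall>z\<in>S. periodize x0 h z = h (z + c)"
    have sc: "smooth (\<lambda>z. z + c)" by (intro smooth_add smooth_ident smooth_const)
    have "deriv (periodize x0 h) y = deriv (\<lambda>z. h (z + c)) y"
      by (rule deriv_local_cong[OF S(1,2) _ sp smooth_compose[OF s sc]]) (use * in blast)
    then show ?thesis using B[of "y + c"] deriv_compose_smooth[OF s sc] deriv_shift by simp
  next
    assume *: "\<forall>z\<in>S. periodize x0 h z = 0"
    have "deriv (periodize x0 h) y = deriv (\<lambda>z. 0) y"
      by (rule deriv_local_cong[OF S(1,2) _ sp smooth_const]) (use * in blast)
    then show ?thesis using B[of 0] by simp
  qed
qed

lemma deriv_bump_bounded: "\<exists>B. \<forall>y. \<bar>deriv bump y\<bar> \<le> B"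
proof -
  have "continuous_on {-3..3} (deriv bump)"
    by (rule smooth_continuous_on[OF smooth_deriv[OF smooth_bump]])
  then have "compact (deriv bump ` {-3..3})" by (rule compact_continuous_image) simp
  then obtain B where B: "\<And>y. y \<in> {-3..3} \<Longrightarrow> \<bar>deriv bump y\<bar> \<le> B"
    using compact_imp_bounded bounded_iff by (metis imageI real_norm_def)
  have "\<bar>deriv bump y\<bar> \<le> B" for y
  proof (cases "y \<in> {-3..3}")
    case False
    then have y: "y \<in> {y. \<bar>y\<bar> > 2}" by auto
    have "open {y::real. \<bar>y\<bar> > 2}" by (intro open_Collect_less continuous_intros)
    then have "deriv bump y = deriv (\<lambda>z. 0) y"
      by (rule deriv_local_cong[OF _ y _ smooth_bump smooth_const]) (auto simp: bump_eq_0)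
    then show ?thesis using B[of 0] by simp
  qed (rule B)
  then show ?thesis by blast
qed

text \<open>Cutting off \<eta> at radius r costs a derivative of size 2 * B / r, but \<eta> itself
  is at most d * r there. The bound on the derivative of the product is therefore independent of r,
  and one d serves all \<eta>, x0 and R.\<close>

lemma small_germ_extension:
  "\<exists>d>0. \<forall>\<eta> x0 R. smooth \<eta> \<longrightarrow> \<eta> x0 = 0 \<longrightarrow> \<bar>deriv \<eta> x0\<bar> < d \<longrightarrow> R > 0 \<longrightarrow>
    (\<exists>f\<in>Diffeo Circle. \<exists>\<epsilon>>0. (\<forall>y. \<bar>y - x0\<bar> < \<epsilon> \<longrightarrow> f y = y + \<eta> y) \<and>
       (\<forall>y. (\<forall>n::int. \<bar>y - of_int n - x0\<bar> \<ge> R) \<longrightarrow> f y = y) \<and> (\<forall>y. \<bar>f y - y\<bar> < R))"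
proof -
  obtain B where B: "\<And>y. \<bar>deriv bump y\<bar> \<le> B" using deriv_bump_bounded by blast
  have B0: "B \<ge> 0" using B[of 0] by linarith
  \<comment> \<open>Makes the product rule bound d * (2 * B + 1) equal to 1/2, so that f has
    derivative at least 1/2.\<close>
  define d where "d = 1 / (2 * (2 * B + 1))"
  have d: "d > 0" "d * (2 * B + 1) = 1/2" "d \<le> 1/2" using B0 by (auto simp: d_def field_simps)
  show ?thesis
  proof (intro exI[of _ d] conjI allI impI d(1))
    fix \<eta> :: "real \<Rightarrow> real" and x0 R :: real
    assume s: "smooth \<eta>" and e0: "\<eta> x0 = 0" and de: "\<bar>deriv \<eta> x0\<bar> < d" and R: "R > 0"
    have "isCont (\<lambda>y. \<bar>deriv \<eta> y\<bar>) x0"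
      using smooth_isCont[OF smooth_deriv[OF s]] by (intro continuous_intros)
    then have "\<forall>\<^sub>F y in at x0. \<bar>deriv \<eta> y\<bar> < d"
      using de unfolding isCont_def by (rule order_tendstoD(2))
    then obtain \<delta> where \<delta>: "\<delta> > 0" "\<And>y. \<bar>y - x0\<bar> < \<delta> \<Longrightarrow> \<bar>deriv \<eta> y\<bar> < d"
      using de unfolding eventually_at dist_real_def by (metis (full_types) UNIV_I)
    \<comment> \<open>Within r of x0 the derivative of \<eta> stays below d; r < R confines the
      support, and r < 1/2 permits periodizing.\<close>
    define r where "r = min (\<delta> / 2) (min (R / 2) (1/4))"
    have r: "0 < r" "r < \<delta>" "r < R" "r < 1/2" using \<delta>(1) R by (auto simp: r_def min_def)
    have eta_bd: "\<bar>\<eta> y\<bar> \<le> d * r" if "\<bar>y - x0\<bar> \<le> r" for y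
    proof -
      have "norm (\<eta> y - \<eta> x0) \<le> d * norm (y - x0)"
      proof (rule field_differentiable_bound[where S="cball x0 r"])
        fix z assume z: "z \<in> cball x0 r"
        show "(\<eta> has_field_derivative deriv \<eta> z) (at z within cball x0 r)"
          using smooth_DERIV[OF s] by (rule has_field_derivative_at_within)
        show "norm (deriv \<eta> z) \<le> d"
          using \<delta>(2)[of z] z r by (auto simp: dist_real_def abs_minus_commute)
      qed (use that r in \<open>auto simp: dist_real_def abs_minus_commute\<close>)
      also have "\<dots> \<le> d * r" using that d by (intro mult_left_mono) auto
      finally show ?thesis using e0 by simp
    qed
    define ct where "ct = (\<lambda>y. bump ((2 / r) * (y - x0)))"
    have lin: "smooth (\<lambda>y. (2 / r) * (y - x0))" by (intro smooth_mult smooth_diff smooth_const smooth_ident)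
    have sx: "smooth ct" unfolding ct_def by (rule smooth_compose[OF smooth_bump lin])
    have lin_d: "deriv (\<lambda>y. (2 / r) * (y - x0)) y = 2 / r" for y
      by (rule DERIV_imp_deriv) (use r in \<open>auto intro!: derivative_eq_intros\<close>)
    have dx: "\<bar>deriv ct y\<bar> \<le> B * (2 / r)" for y
      unfolding ct_def deriv_compose_smooth[OF smooth_bump lin] lin_d abs_mult
      using B B0 r by (intro mult_mono) auto
    have arg: "\<bar>(2 / r) * (y - x0)\<bar> = \<bar>y - x0\<bar> / (r / 2)" for y
      using r by (subst abs_mult) (simp add: mult.commute)
    have x0: "ct y = 0" if "\<bar>y - x0\<bar> \<ge> r" for y
      unfolding ct_def by (rule bump_eq_0, unfold arg) (use that r in \<open>simp add: le_divide_eq\<close>)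
    have x1: "ct y = 1" if "\<bar>y - x0\<bar> < r / 2" for y
      unfolding ct_def by (rule bump_eq_1, unfold arg) (use that r in \<open>simp add: divide_le_eq\<close>)
    define h where "h = (\<lambda>y. ct y * \<eta> y)"
    have sh: "smooth h" unfolding h_def by (intro smooth_mult sx s)
    have h0: "h y = 0" if "\<bar>y - x0\<bar> \<ge> r" for y using x0[OF that] by (simp add: h_def)
    have dh: "\<bar>deriv h y\<bar> \<le> 1/2" for y
    proof (cases "\<bar>y - x0\<bar> \<le> r")
      case True
      have "deriv h y = ct y * deriv \<eta> y + deriv ct y * \<eta> y"
        unfolding h_def by (rule DERIV_imp_deriv) (use DERIV_mult[OF smooth_DERIV[OF sx] smooth_DERIV[OF s]] in \<open>simp add: mult.commute add.commute\<close>)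
      also have "\<bar>\<dots>\<bar> \<le> \<bar>ct y\<bar> * \<bar>deriv \<eta> y\<bar> + \<bar>deriv ct y\<bar> * \<bar>\<eta> y\<bar>"
        by (metis abs_mult abs_triangle_ineq)
      also have "\<dots> \<le> 1 * d + (B * (2 / r)) * (d * r)"
        using bump_range \<delta>(2)[of y] True r dx eta_bd[OF True] B0 d unfolding ct_def[symmetric]
        by (intro add_mono mult_mono) (auto simp: ct_def abs_le_iff order_trans[OF _ bump_range(1)])
      also have "\<dots> = d * (2 * B + 1)" using r by (simp add: algebra_simps)
      finally show ?thesis using d(2) by simp
    next
      case False
      have o: "open {y. r < \<bar>y - x0\<bar>}" by (intro open_Collect_less continuous_intros)
      have "deriv h y = deriv (\<lambda>z. 0) y"
        by (rule deriv_local_cong[OF o _ _ sh smooth_const]) (use False h0 in auto)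
      then show ?thesis by simp
    qed
    define v where "v = periodize x0 h"
    have v: "v \<in> fn_space Circle" unfolding v_def by (rule periodize_fn_space[of r x0 h, OF h0 r(1,4) sh])
    have dv: "\<bar>deriv v y\<bar> \<le> 1/2" for y unfolding v_def by (rule periodize_deriv_bound[of r x0 h, OF h0 r(1,4) sh dh])
    have sv: "smooth v" using v by (rule fn_space_smooth)
    define f where "f = (\<lambda>y. y + v y)"
    have "deriv f y = 1 + deriv v y" for y unfolding f_def
      by (rule DERIV_imp_deriv) (intro DERIV_add DERIV_ident smooth_DERIV[OF sv])
    then have "deriv f y \<ge> 1/2" for y using dv[of y] by (simp add: abs_le_iff)
    moreover have "smooth f" unfolding f_def by (intro smooth_add smooth_ident sv)
    ultimately have f: "f \<in> Diffeo Circle"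
      by (intro DiffeoI[of f "1/2"]) (use v in \<open>auto simp: f_def fn_space_def\<close>)
    have vb: "\<bar>v y\<bar> < R" for y
    proof -
      have "\<bar>h z\<bar> \<le> d * r" for z
      proof (cases "\<bar>z - x0\<bar> \<le> r")
        case True
        have "\<bar>h z\<bar> \<le> 1 * (d * r)" unfolding h_def abs_mult
          using bump_range eta_bd[OF True] by (intro mult_mono) (auto simp: ct_def)
        then show ?thesis by simp
      qed (use h0 d r in auto)
      then have "\<bar>v y\<bar> \<le> d * r" unfolding v_def periodize_def by blast
      also have "\<dots> \<le> 1 * r" using d r by (intro mult_right_mono) auto
      finally show ?thesis using r by simp
    qed
    show "\<exists>f\<in>Diffeo Circle. \<exists>\<epsilon>>0. (\<forall>y. \<bar>y - x0\<bar> < \<epsilon> \<longrightarrow> f y = y + \<eta> y) \<and>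
       (\<forall>y. (\<forall>n::int. \<bar>y - of_int n - x0\<bar> \<ge> R) \<longrightarrow> f y = y) \<and> (\<forall>y. \<bar>f y - y\<bar> < R)"
    proof (intro bexI[OF _ f] exI[of _ "r/2"] conjI allI impI)
      fix y assume "\<bar>y - x0\<bar> < r / 2"
      then show "f y = y + \<eta> y"
        using periodize_eq[of r x0 h y, OF h0 r(4)] r x1[of y] by (simp add: f_def v_def h_def)
    next
      fix y assume *: "\<forall>n::int. \<bar>y - of_int n - x0\<bar> \<ge> R"
      have "v y = 0" unfolding v_def
        by (rule periodize_zero[of r x0 h, OF h0]) (use * r in \<open>auto intro: order_trans[of r R]\<close>)
      then show "f y = y" by (simp add: f_def)
    qed (use vb r in \<open>auto simp: f_def\<close>)
  qed
qed

section \<open>Locality on the circle for different weights\<close>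

lemma fn_space_periodic_int:
  assumes "\<phi> \<in> fn_space Circle" shows "\<phi> (x + of_int n) = \<phi> x"
proof -
  have *: "\<phi> (x + of_nat m) = \<phi> x" for m x
  proof (induction m)
    case (Suc m)
    have "\<phi> (x + of_nat (Suc m)) = \<phi> ((x + of_nat m) + 1)" by (simp add: algebra_simps)
    then show ?case using assms Suc by (simp add: fn_space_def)
  qed simp
  show ?thesis
  proof (cases "n \<ge> 0")
    case True
    then show ?thesis using *[of x "nat n"] by simp
  next
    case False
    then show ?thesis using *[of "x + of_int n" "nat (- n)"] by simp
  qed
qed

lemma Diffeo_periodic_int:
  assumes "f \<in> Diffeo Circle" shows "f (x + of_int n) = f x + of_int n"
proof -
  have "(\<lambda>y. f y - y) \<in> fn_space Circle"
    using DiffeoD[OF assms] by (auto simp: fn_space_def intro: smooth_intros)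
  from fn_space_periodic_int[OF this, of x n] show ?thesis by simp
qed

text \<open>A point within 2 * R of the lattice x0 + Z is sent to one within 3 * R, and a is zero at
  both. Every other point has a ball of radius R on which f is the identity.\<close>

lemma Circle_supported_fixed:
  assumes f: "f \<in> Diffeo Circle" and a: "a \<in> op_coeffs k Circle" and R: "R > 0"
    and a0: "\<And>i y. \<bar>y - x0\<bar> < 3 * R \<Longrightarrow> a i y = 0"
    and id: "\<And>y. (\<And>n::int. \<bar>y - of_int n - x0\<bar> \<ge> R) \<Longrightarrow> f y = y" and mv: "\<And>y. \<bar>f y - y\<bar> < R"
  shows "cact k lam mu f a = a"
proof (intro ext)
  fix j z
  define y where "y = inv f z"
  have z: "z = f y" using DiffeoD(6)[OF f] by (simp add: y_def)
  show "cact k lam mu f a j z = a j z"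
  proof (cases "\<exists>n::int. \<bar>y - of_int n - x0\<bar> < 2 * R")
    case True
    then obtain n :: int where n: "\<bar>y - of_int n - x0\<bar> < 2 * R" by blast
    have per: "a i w = a i (w - of_int n)" for i w
      using fn_space_periodic_int[OF coeffsD(1)[OF a], of i "w - of_int n" n] by simp
    have "a i y = 0" for i using per[of i y] a0[of "y - of_int n" i] n R by simp
    then have "cact k lam mu f a j z = 0" unfolding z by (rule cact_zero_at[OF f])
    moreover have "\<bar>z - of_int n - x0\<bar> < 3 * R" using n mv[of y] z by linarith
    ultimately show ?thesis using per[of j z] a0 by simp
  next
    case False
    have "f w = w" if "w \<in> ball y R" for w
    proof (rule id)
      fix n :: int
      have "\<bar>y - of_int n - x0\<bar> \<ge> 2 * R" using False by (simp add: not_less)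
      moreover have "\<bar>y - w\<bar> < R" using that by (simp add: dist_real_def)
      ultimately show "\<bar>w - of_int n - x0\<bar> \<ge> R" by linarith
    qed
    moreover have "y \<in> ball y R" using R by simp
    ultimately show ?thesis using cact_ident[OF f open_ball _ _ a, of y y R lam mu j] z by metis
  qed
qed

lemma Diffeo_affine: "s > 0 \<Longrightarrow> (\<lambda>x. s * x + c) \<in> Diffeo Line"
proof (rule DiffeoI)
  show "smooth (\<lambda>x. s * x + c)" by (intro smooth_intros)
  have "deriv (\<lambda>x. s * x + c) x = s" for x by (rule DERIV_imp_deriv) (auto intro!: derivative_eq_intros)
  then show "s > 0 \<Longrightarrow> s \<le> deriv (\<lambda>x. s * x + c) x" for x by simp
qed auto

lemma jet_coeff_affine:
  fixes lam :: "'k::powr_field"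
  assumes "s > 0"
  shows "jet_coeff lam (\<lambda>x. s * x + c) i j = (\<lambda>x. if i = j then of_real s powr (lam + of_nat i) else 0)"
proof -
  have d: "deriv (\<lambda>x. s * x + c) x = s" for x by (rule DERIV_imp_deriv) (auto intro!: derivative_eq_intros)
  show ?thesis
  proof (induction i arbitrary: j)
    case (Suc i)
    have v: "vd (jet_coeff lam (\<lambda>x. s * x + c) i j) x = 0" for x j
      unfolding Suc by simp
    have "(of_real s :: 'k) powr (1 + (lam + of_nat i)) = of_real s powr of_nat 1 * of_real s powr (lam + of_nat i)"
      by (simp only: powr_of_real_add[OF assms] of_nat_1)
    then have "(of_real s :: 'k) powr (1 + (lam + of_nat i)) = of_real s * of_real s powr (lam + of_nat i)"
      by (simp only: powr_of_real_of_nat[OF assms] power_one_right)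
    then show ?case using Suc v by (cases j) (auto simp: d add_ac)
  qed (auto simp: d)
qed

text \<open>Differentiates the constant function exp (z * t) in t. Only s near 1 is available, since
  \<open>small_germ_extension\<close> reaches only dilations near the identity.\<close>

lemma powr_eq_1_near_imp_zero:
  fixes z :: "'k::powr_field"
  assumes "d > 0" "\<And>s. 1 < s \<Longrightarrow> s < 1 + d \<Longrightarrow> of_real s powr z = 1"
  shows "z = 0"
proof -
  define e where "e = ln (1 + d)"
  have e: "e > 0" using assms(1) by (simp add: e_def)
  have 1: "exp (z * of_real t) = 1" if "t \<in> {0<..<e}" for t
  proof -
    have "1 < exp t" "exp t < 1 + d"
      using that assms(1) by (auto simp: e_def) (metis exp_less_mono exp_ln add_pos_pos zero_less_one)
    then show ?thesis using assms(2)[of "exp t"] powr_of_real_eq[of "exp t" z] by simp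
  qed
  have h: "e / 2 \<in> {0<..<e}" using e by simp
  have "((\<lambda>t. exp (z * of_real t)) has_vector_derivative 1 * (z * 1) * exp (z * of_real (e/2))) (at (e/2))"
  proof -
    have "((\<lambda>t. z * of_real t) has_vector_derivative z * 1) (at (e/2))"
      by (intro has_vector_derivative_mult_right) (auto intro!: derivative_eq_intros)
    then show ?thesis using field_vector_diff_chain_at[OF _ DERIV_exp] by (force simp: o_def)
  qed
  then have "((\<lambda>t. 1) has_vector_derivative 1 * (z * 1) * exp (z * of_real (e/2))) (at (e/2))"
    by (rule has_vector_derivative_transform_within_open[OF _ open_greaterThanLessThan h]) (rule 1)
  from vector_derivative_at[OF this] have "z * exp (z * of_real (e/2)) = 0" by simp
  then show ?thesis by simp
qed

lemma nderiv_exp_linear: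
  fixes c :: "'k::{real_normed_field,banach}"
  shows "nderiv n (\<lambda>y. exp (c * of_real (y - x0))) y = c ^ n * exp (c * of_real (y - x0))"
proof -
  have "nderiv n (\<lambda>y. exp (c * of_real (y - x0))) = (\<lambda>y. c ^ n * exp (c * of_real (y - x0)))"
  proof (induction n)
    case (Suc n)
    have "((\<lambda>y. exp (c * of_real (y - x0))) has_vector_derivative c * exp (c * of_real (y - x0))) (at y)" for y
    proof -
      have "((\<lambda>y. c * of_real (y - x0)) has_vector_derivative c * 1) (at y)"
        using has_vector_derivative_of_real[of "\<lambda>y. y - x0" 1 "at y", where 'a='k]
        by (intro has_vector_derivative_mult_right) (auto intro!: derivative_eq_intros)
      then show ?thesis using field_vector_diff_chain_at[OF _ DERIV_exp] by (force simp: o_def)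
    qed
    then have "((\<lambda>y. c ^ n * exp (c * of_real (y - x0))) has_vector_derivative c ^ n * (c * exp (c * of_real (y - x0)))) (at y)" for y
      by (rule has_vector_derivative_mult_right)
    then show ?case unfolding nderiv.simps Suc by (intro ext) (simp add: vector_derivative_at mult_ac)
  qed simp
  then show ?thesis by simp
qed

text \<open>Equal weights are left out because multiplication by a constant is then an invariant
  operator, which invariance of T a alone cannot exclude.\<close>

lemma Circle_local_neq:
  fixes lam mu :: "'k::powr_field"
  assumes T: "T \<in> Cend k lam mu Circle" and ne: "lam \<noteq> mu" "(lam, mu) \<noteq> (0, 1)"
  shows "Cend_local Circle k T"
  unfolding Cend_local_def
proof (intro ballI allI impI)
  fix a :: "nat \<Rightarrow> real \<Rightarrow> 'k" and S x1 j
  assume a: "a \<in> op_coeffs k Circle" and S: "open S" "x1 \<in> S" "\<forall>i. \<forall>y\<in>S. a i y = 0"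
  obtain d where d: "d > 0" and germ: "\<And>\<eta> x0 R. smooth \<eta> \<Longrightarrow> \<eta> x0 = 0 \<Longrightarrow> \<bar>deriv \<eta> x0\<bar> < d \<Longrightarrow> R > 0 \<Longrightarrow>
    (\<exists>f\<in>Diffeo Circle. \<exists>\<epsilon>>0. (\<forall>y. \<bar>y - x0\<bar> < \<epsilon> \<longrightarrow> f y = y + \<eta> y) \<and>
       (\<forall>y. (\<forall>n::int. \<bar>y - of_int n - x0\<bar> \<ge> R) \<longrightarrow> f y = y) \<and> (\<forall>y. \<bar>f y - y\<bar> < R))"
    using small_germ_extension by metis
  define b where "b = T a"
  have b: "b \<in> op_coeffs k Circle" unfolding b_def by (rule CendD(1)[OF T a])
  \<comment> \<open>The extension of a germ close to the identity at x0 moves only points near the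
    lattice of x0, where a vanishes. So it fixes a, and by equivariance it fixes T a.\<close>
  have inv: "\<exists>f\<in>Diffeo Circle. \<exists>\<epsilon>>0. (\<forall>y. \<bar>y - x0\<bar> < \<epsilon> \<longrightarrow> f y = y + \<eta> y) \<and> cact k lam mu f b = b"
    if x0: "x0 \<in> S" and e: "smooth \<eta>" "\<eta> x0 = 0" "\<bar>deriv \<eta> x0\<bar> < d" for x0 \<eta>
  proof -
    obtain R0 where R0: "R0 > 0" "ball x0 R0 \<subseteq> S" using S(1) x0 openE by blast
    have R: "R0 / 3 > 0" using R0 by simp
    obtain f \<epsilon> where f: "f \<in> Diffeo Circle" "\<epsilon> > 0" "\<And>y. \<bar>y - x0\<bar> < \<epsilon> \<Longrightarrow> f y = y + \<eta> y"
      "\<And>y. (\<forall>n::int. \<bar>y - of_int n - x0\<bar> \<ge> R0 / 3) \<Longrightarrow> f y = y" "\<And>y. \<bar>f y - y\<bar> < R0 / 3"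
      using germ[OF e R] by blast
    have "cact k lam mu f a = a"
    proof (rule Circle_supported_fixed[OF f(1) a R])
      show "a i y = 0" if "\<bar>y - x0\<bar> < 3 * (R0 / 3)" for i y
        using that S(3) R0(2) by (auto simp: subset_iff dist_real_def abs_minus_commute)
    qed (use f in auto)
    then have "cact k lam mu f b = b" using CendD(4)[OF T f(1) a] by (simp add: b_def)
    then show ?thesis using f by blast
  qed
  \<comment> \<open>The dilation by s about x0 multiplies the j-th coefficient at x0 by s^(lam + j -
    mu), which must then be 1.\<close>
  have weight: "lam + of_nat j = mu" if x0: "x0 \<in> S" and nz: "b j x0 \<noteq> 0" for x0 j
  proof -
    have jk: "j \<le> k" using nz coeffsD(2)[OF b] by (meson not_le)
    have "of_real s powr (lam + of_nat j - mu) = (1::'k)" if s: "1 < s" "s < 1 + d" for s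
    proof -
      define \<eta> where "\<eta> = (\<lambda>y. (s - 1) * (y - x0))"
      have "deriv \<eta> x0 = s - 1" unfolding \<eta>_def
        by (rule DERIV_imp_deriv) (auto intro!: derivative_eq_intros)
      then have "\<bar>deriv \<eta> x0\<bar> < d" using s by simp
      moreover have "smooth \<eta>" unfolding \<eta>_def by (intro smooth_intros)
      ultimately obtain f \<epsilon> where f: "f \<in> Diffeo Circle" "\<epsilon> > 0"
        "\<And>y. \<bar>y - x0\<bar> < \<epsilon> \<Longrightarrow> f y = y + \<eta> y" "cact k lam mu f b = b"
        using inv[OF x0, of \<eta>] by (auto simp: \<eta>_def)
      have fx: "f x0 = x0" using f(2) f(3)[of x0] by (simp add: \<eta>_def)
      define g where "g = (\<lambda>y. s * y + (x0 - s * x0))"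
      have g: "g \<in> Diffeo Line" unfolding g_def using s by (intro Diffeo_affine) auto
      have gx: "g x0 = x0" by (simp add: g_def)
      have "b j x0 = cact k lam mu f b j (f x0)" using f(4) fx by simp
      also have "\<dots> = cact k lam mu g b j (f x0)"
        by (rule cact_germ[OF f(1) g open_ball[of x0 \<epsilon>]])
           (use f(2,3) in \<open>auto simp: g_def \<eta>_def dist_real_def abs_minus_commute algebra_simps\<close>)
      also have "\<dots> = cact k lam mu g b j (g x0)" by (simp add: fx gx)
      also have "\<dots> = of_real s powr (- mu) * (b j x0 * of_real s powr (lam + of_nat j))"
      proof -
        have dg: "deriv g x0 = s" unfolding g_def
          by (rule DERIV_imp_deriv) (auto intro!: derivative_eq_intros)
        have "(\<Sum>i\<le>k. b i x0 * jet_coeff lam g i j x0) = b j x0 * of_real s powr (lam + of_nat j)"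
          using s jk unfolding g_def by (subst jet_coeff_affine) (simp_all add: if_distrib cong: if_cong)
        then show ?thesis using cact_at[OF g, of k lam mu b j x0] dg jk by simp
      qed
      also have "\<dots> = b j x0 * of_real s powr (- mu + (lam + of_nat j))"
        using s by (subst powr_of_real_add) (simp_all add: mult_ac)
      finally show ?thesis using nz by (simp add: algebra_simps)
    qed
    then have "lam + of_nat j - mu = 0" by (rule powr_eq_1_near_imp_zero[OF d])
    then show ?thesis by simp
  qed
  show "T a j x1 = 0"
  proof (rule ccontr)
    assume nz: "T a j x1 \<noteq> 0"
    then have mu: "mu = lam + of_nat j" using weight[OF S(2), of j] by (simp add: b_def)
    have j1: "j \<ge> 1" using mu ne(1) by (cases j) auto
    have jk: "j \<le> k" using nz coeffsD(2)[OF b] unfolding b_def by (meson not_le)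
    have only: "b i x1 = 0" if "i \<noteq> j" for i
    proof (rule ccontr)
      assume "b i x1 \<noteq> 0"
      then show False using weight[OF S(2), of i] mu that by simp
    qed
    have op: "op_at k b \<phi> x1 = b j x1 * nderiv j \<phi> x1" for \<phi>
    proof -
      have "op_at k b \<phi> x1 = (\<Sum>i\<le>k. if i = j then b j x1 * nderiv j \<phi> x1 else 0)"
        unfolding op_at_def by (rule sum.cong) (use only in auto)
      then show ?thesis using jk by simp
    qed
    \<comment> \<open>Makes f equal to x1 + exp (y - x1) - 1 near x1, a germ with fixed point x1 and
      derivative 1. The constant density 1 becomes exp (lam * (y - x1)), and comparing j-th
      derivatives at x1 gives lam ^ j = 0.\<close>
    define \<eta> where "\<eta> = (\<lambda>y. exp (y - x1) - 1 - (y - x1))"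
    have "deriv \<eta> x1 = 0" unfolding \<eta>_def
      by (rule DERIV_imp_deriv) (auto intro!: derivative_eq_intros)
    moreover have "smooth \<eta>" unfolding \<eta>_def by (intro smooth_intros)
    ultimately obtain f \<epsilon> where f: "f \<in> Diffeo Circle" "\<epsilon> > 0"
      "\<And>y. \<bar>y - x1\<bar> < \<epsilon> \<Longrightarrow> f y = y + \<eta> y" "cact k lam mu f b = b"
      using inv[OF S(2), of \<eta>] d by (auto simp: \<eta>_def)
    define U where "U = ball x1 \<epsilon>"
    have U: "open U" "x1 \<in> U" using f(2) by (auto simp: U_def)
    have fU: "f y = x1 + exp (y - x1) - 1" if "y \<in> U" for y
      using f(3)[of y] that by (auto simp: U_def \<eta>_def dist_real_def abs_minus_commute)
    have fx: "f x1 = x1" using fU[OF U(2)] by simp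
    have ifx: "inv f x1 = x1" using DiffeoD(5)[OF f(1), of x1] fx by simp
    have df: "deriv f y = exp (y - x1)" if "y \<in> U" for y
    proof -
      have "deriv f y = deriv (\<lambda>y. x1 + exp (y - x1) - 1) y"
        by (rule deriv_local_cong[OF U(1) that fU DiffeoD(1)[OF f(1)]]) (auto intro!: smooth_intros)
      also have "\<dots> = exp (y - x1)" by (rule DERIV_imp_deriv) (auto intro!: derivative_eq_intros)
      finally show ?thesis .
    qed
    have key: "nderiv j \<phi> x1 = nderiv j (rho lam f \<phi>) x1" if "smooth \<phi>" for \<phi>
    proof -
      have "deriv (inv f) x1 = 1" using deriv_inv_Diffeo[OF f(1), of x1] ifx df[OF U(2)] by simp
      then have "op_at k b \<phi> x1 = op_at k b (rho lam f \<phi>) x1"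
        using op_at_cact[OF f(1) that, of k lam mu b x1] f(4) ifx by (simp add: rho_def)
      then have "b j x1 * nderiv j \<phi> x1 = b j x1 * nderiv j (rho lam f \<phi>) x1" unfolding op .
      then show ?thesis using nz by (simp add: b_def)
    qed
    have pw: "(of_real (deriv f y) :: 'k) powr lam = exp (lam * of_real (y - x1))" if "y \<in> U" for y
      unfolding df[OF that] by (subst powr_of_real_eq) simp_all
    have "nderiv j (rho lam f (\<lambda>x. 1)) x1 = nderiv j (\<lambda>y. exp (lam * of_real (y - x1))) x1"
      by (rule nderiv_local_cong[OF U]) (simp add: rho_def pw)
    also have "\<dots> = lam ^ j * exp (lam * of_real (x1 - x1))" by (rule nderiv_exp_linear)
    finally have "lam ^ j = 0" using key[OF smooth_const, of 1] j1 by (simp add: nderiv_const)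
    then have lam: "lam = 0" using j1 by simp
    then have "j \<noteq> 1" using ne(2) mu by auto
    then have j2: "j \<ge> 2" using j1 by linarith
    \<comment> \<open>For lam = 0 and j \<ge> 2 the test function y - x1 has j-th derivative 0,
      while its image exp (y - x1) - 1 has j-th derivative 1.\<close>
    have sl: "smooth (\<lambda>y. of_real (y - x1) :: 'k)" by (intro smooth_intros)
    have "nderiv j (\<lambda>y. of_real (y - x1) :: 'k) x1 = 0"
    proof -
      have "vd (\<lambda>y. of_real (y - x1) :: 'k) y = 1" for y
        using has_vector_derivative_of_real[of "\<lambda>y. y - x1" 1 "at y", where 'a='k]
        by (intro vector_derivative_at) (auto intro!: derivative_eq_intros)
      then have "vd (\<lambda>y. of_real (y - x1) :: 'k) = (\<lambda>y. 1)" by blast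
      moreover obtain m where "j = Suc m" "m \<noteq> 0" using j2 by (cases j) auto
      ultimately show ?thesis using nderiv_vd[of m "\<lambda>y. of_real (y - x1) :: 'k"]
        by (metis nderiv_const)
    qed
    moreover have "nderiv j (rho lam f (\<lambda>y. of_real (y - x1))) x1 = nderiv j (\<lambda>y. exp (1 * of_real (y - x1)) + (-1) :: 'k) x1"
      by (rule nderiv_local_cong[OF U]) (simp add: rho_def lam fU df exp_of_real[symmetric])
    moreover have "nderiv j (\<lambda>y. exp (1 * of_real (y - x1)) + (-1) :: 'k) x1 = 1"
      using j2 by (subst nderiv_add, (intro smooth_intros)+, subst nderiv_exp_linear) (simp add: nderiv_const)
    ultimately show False using key[OF sl] by simp
  qed
qed

section \<open>Locality on the circle for equal weights\<close>

lemma fn_space_bounded: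
  fixes \<phi> :: "real \<Rightarrow> real"
  assumes "\<phi> \<in> fn_space Circle"
  shows "\<exists>B>0. \<forall>y. \<bar>\<phi> y\<bar> \<le> B"
proof -
  have "compact (\<phi> ` {0..1})"
    by (rule compact_continuous_image[OF smooth_continuous_on[OF fn_space_smooth[OF assms]]]) simp
  then obtain B where B: "B > 0" "\<And>y. y \<in> {0..1} \<Longrightarrow> \<bar>\<phi> y\<bar> \<le> B"
    using compact_imp_bounded bounded_pos by (metis imageI real_norm_def)
  have "\<bar>\<phi> y\<bar> \<le> B" for y
    using fn_space_periodic_int[OF assms, of "y - of_int \<lfloor>y\<rfloor>" "\<lfloor>y\<rfloor>"] B(2)[of "y - of_int \<lfloor>y\<rfloor>"]
    by simp linarith
  then show ?thesis using B(1) by blast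
qed

lemma fn_space_pos_lower_bound:
  fixes \<phi> :: "real \<Rightarrow> real"
  assumes "\<phi> \<in> fn_space Circle" "\<And>y. \<phi> y > 0"
  shows "\<exists>c>0. \<forall>y. c \<le> \<phi> y"
proof -
  have "(\<lambda>y. inverse (\<phi> y)) \<in> fn_space Circle"
    using assms by (auto simp: fn_space_def intro!: smooth_inverse simp: less_imp_neq[symmetric])
  then obtain B where B: "B > 0" "\<And>y. \<bar>inverse (\<phi> y)\<bar> \<le> B" using fn_space_bounded by blast
  have "inverse B \<le> \<phi> y" for y
    using B(1) B(2)[of y] assms(2)[of y] by (simp add: field_simps)
  then show ?thesis using B(1) by (intro exI[of _ "inverse B"]) auto
qed

lemma fn_space_inverse_power:
  fixes \<phi> :: "real \<Rightarrow> real"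
  assumes "\<phi> \<in> fn_space M" "\<And>y. \<phi> y > 0"
  shows "(\<lambda>y. inverse (\<phi> y ^ n)) \<in> fn_space M"
  using assms by (auto simp: fn_space_def intro!: smooth_inverse smooth_power simp: less_imp_neq[symmetric])

lemma smooth_antiderivative:
  fixes u :: "real \<Rightarrow> real"
  assumes "smooth u"
  obtains G where "smooth G" "\<And>y. (G has_real_derivative u y) (at y)"
proof -
  have "\<exists>F. \<forall>x::real. -\<infinity> < ereal x \<longrightarrow> ereal x < \<infinity> \<longrightarrow> (F has_vector_derivative u x) (at x)"
    by (rule einterval_antiderivative) (auto simp: smooth_isCont[OF assms])
  then obtain G where G: "\<And>x. (G has_vector_derivative u x) (at x)" by auto
  show ?thesis
    by (rule that[of G]) (use G assms smoothI_derivative in \<open>auto simp: has_real_derivative_iff_has_vector_derivative\<close>)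
qed

text \<open>Division by the total mass turns the primitive of \<rho> into a map commuting with the
  unit translation.\<close>

lemma circle_diffeo_of_density:
  fixes \<rho> :: "real \<Rightarrow> real"
  assumes r: "\<rho> \<in> fn_space Circle" "\<And>y. \<rho> y > 0" and M: "(\<rho> has_integral M) {x0..x0+1}"
  shows "M > 0 \<and> (\<exists>g\<in>Diffeo Circle. g x0 = x0 \<and> (\<forall>y. deriv g y = \<rho> y / M))"
proof -
  obtain c where c: "c > 0" "\<And>y. c \<le> \<rho> y" using fn_space_pos_lower_bound[OF r] by blast
  obtain G where G: "smooth G" "\<And>y. (G has_real_derivative \<rho> y) (at y)"
    using smooth_antiderivative[OF fn_space_smooth[OF r(1)]] by blast
  have "(\<rho> has_integral (G (x0+1) - G x0)) {x0..x0+1}"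
    by (rule fundamental_theorem_of_calculus)
       (use G(2) in \<open>auto simp: has_real_derivative_iff_has_vector_derivative intro: has_vector_derivative_at_within\<close>)
  then have MG: "M = G (x0 + 1) - G x0" using M has_integral_unique by blast
  have "((\<lambda>y. c) has_integral c * (x0 + 1 - x0)) {x0..x0+1}"
    using has_integral_const_real[of c x0 "x0+1"] by (simp add: mult.commute)
  from has_integral_le[OF this M] have "c \<le> M" using c by simp
  then have M0: "M > 0" using c by simp
  have "\<exists>k. \<forall>y\<in>UNIV. G (y + 1) - G y = k"
  proof (rule has_field_derivative_zero_constant)
    fix y :: real
    have "((\<lambda>y. G (y + 1)) has_real_derivative \<rho> (y + 1) * 1) (at y)"
      by (rule DERIV_chain2[OF G(2)]) (auto intro!: derivative_eq_intros)
    moreover have "\<rho> (y + 1) = \<rho> y" using r(1) by (simp add: fn_space_def)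
    ultimately show "((\<lambda>y. G (y + 1) - G y) has_real_derivative 0) (at y within UNIV)"
      using DERIV_diff[OF _ G(2), of "\<lambda>y. G (y+1)" "\<rho> y" y] by simp
  qed simp
  then obtain k where "\<And>y. G (y + 1) - G y = k" by blast
  then have per: "G (y + 1) = G y + M" for y using MG by (metis add.commute diff_add_cancel)
  define g where "g = (\<lambda>y. x0 + (G y - G x0) * (1 / M))"
  have g': "(g has_real_derivative \<rho> y / M) (at y)" for y
    unfolding g_def using M0 G(2)[of y] by (auto intro!: derivative_eq_intros)
  then have dg: "deriv g y = \<rho> y / M" for y by (rule DERIV_imp_deriv)
  have "g \<in> Diffeo Circle"
  proof (rule DiffeoI)
    show "smooth g" unfolding g_def by (intro smooth_add smooth_mult smooth_diff smooth_const G(1))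
    show "c / M \<le> deriv g y" for y using dg c M0 by (simp add: divide_right_mono)
    show "0 < c / M" using c M0 by simp
    show "g (y + 1) = g y + 1" for y unfolding g_def per using M0 by (simp add: field_simps)
  qed
  moreover have "g x0 = x0" by (simp add: g_def)
  ultimately show ?thesis using M0 dg by blast
qed

text \<open>Real symbols are singled out because derivatives of diffeomorphisms produce these; for
  fixed n, j and x0 the value is a real-linear functional of q.\<close>

definition fixed_order :: "((nat \<Rightarrow> real \<Rightarrow> 'k) \<Rightarrow> nat \<Rightarrow> real \<Rightarrow> 'k::real_normed_field) \<Rightarrow> nat \<Rightarrow> real \<Rightarrow> nat \<Rightarrow> (real \<Rightarrow> real) \<Rightarrow> 'k" where
  "fixed_order T j x0 n q = T (monomial n (\<lambda>y. of_real (q y))) j x0"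

lemma fixed_order_linear:
  assumes T: "T \<in> Cend k lam mu M" and n: "n \<le> k" and p: "p \<in> fn_space M" and q: "q \<in> fn_space M"
  shows "fixed_order T j x0 n (\<lambda>y. p y + q y) = fixed_order T j x0 n p + fixed_order T j x0 n q"
    "fixed_order T j x0 n (\<lambda>y. p y - q y) = fixed_order T j x0 n p - fixed_order T j x0 n q"
    "fixed_order T j x0 n (\<lambda>y. c * p y) = of_real c * fixed_order T j x0 n p"
proof -
  have mp: "monomial n (\<lambda>y. of_real (p y)) \<in> op_coeffs k M" and mq: "monomial n (\<lambda>y. of_real (q y)) \<in> op_coeffs k M"
    using n p q by (auto intro!: monomial_coeffs fn_space_of_real)
  show "fixed_order T j x0 n (\<lambda>y. p y + q y) = fixed_order T j x0 n p + fixed_order T j x0 n q"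
  proof -
    have "monomial n (\<lambda>y. of_real (p y + q y) :: 'a) = (\<lambda>i y. monomial n (\<lambda>y. of_real (p y)) i y + monomial n (\<lambda>y. of_real (q y)) i y)"
      by (auto simp: monomial_def fun_eq_iff)
    then show ?thesis using Cend_add_at[OF T mp mq, of j x0] by (simp add: fixed_order_def)
  qed
  show "fixed_order T j x0 n (\<lambda>y. p y - q y) = fixed_order T j x0 n p - fixed_order T j x0 n q"
  proof -
    have "monomial n (\<lambda>y. of_real (p y - q y) :: 'a) = (\<lambda>i y. monomial n (\<lambda>y. of_real (p y)) i y - monomial n (\<lambda>y. of_real (q y)) i y)"
      by (auto simp: monomial_def fun_eq_iff)
    then show ?thesis using Cend_diff_at[OF T mp mq, of j x0] by (simp add: fixed_order_def)
  qed
  show "fixed_order T j x0 n (\<lambda>y. c * p y) = of_real c * fixed_order T j x0 n p"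
  proof -
    have "monomial n (\<lambda>y. of_real (c * p y) :: 'a) = (\<lambda>i y. of_real c * monomial n (\<lambda>y. of_real (p y)) i y)"
      by (auto simp: monomial_def fun_eq_iff)
    then show ?thesis using Cend_smul_at[OF T mp, of "of_real c" j x0] by (simp add: fixed_order_def)
  qed
qed

text \<open>A function q vanishing near x0 is a coboundary: with u equal to the coordinate away
  from x0 and g = id + eps q one has u o g - u = eps q.\<close>
lemma Circle_local_order_0:
  assumes T: "T \<in> Cend k lam lam Circle" and q: "q \<in> fn_space Circle"
    and r0: "r0 > 0" "\<And>y. \<bar>y - x0\<bar> < r0 \<Longrightarrow> q y = 0"
  shows "fixed_order T j x0 0 q = 0"
proof -
  define r where "r = min r0 (1/8)"
  have r: "0 < r" "r \<le> 1/8" "\<And>y. \<bar>y - x0\<bar> < r \<Longrightarrow> q y = 0" using r0 by (auto simp: r_def)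
  have sq: "smooth q" using q by (rule fn_space_smooth)
  have dq: "deriv q \<in> fn_space Circle"
  proof -
    have "deriv q = vd q" using deriv_eq_vd[OF sq] by blast
    then show ?thesis using fn_space_vd[OF q] by simp
  qed
  obtain B1 where B1: "B1 > 0" "\<And>y. \<bar>q y\<bar> \<le> B1" using fn_space_bounded[OF q] by blast
  obtain B2 where B2: "B2 > 0" "\<And>y. \<bar>deriv q y\<bar> \<le> B2" using fn_space_bounded[OF dq] by blast
  \<comment> \<open>Small enough that g moves points by at most r / 2 and has derivative at least
    1/2.\<close>
  define e where "e = min (r / (2 * B1)) (1 / (2 * B2))"
  have e: "e > 0" using r B1 B2 by (simp add: e_def)
  have eq: "\<bar>e * q y\<bar> \<le> r / 2" for y
  proof -
    have "\<bar>e * q y\<bar> \<le> (r / (2 * B1)) * B1" unfolding abs_mult using e B1 r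
      by (intro mult_mono) (auto simp: e_def)
    then show ?thesis using B1 by simp
  qed
  have edq: "\<bar>e * deriv q y\<bar> \<le> 1 / 2" for y
  proof -
    have "\<bar>e * deriv q y\<bar> \<le> (1 / (2 * B2)) * B2" unfolding abs_mult using e B2
      by (intro mult_mono) (auto simp: e_def)
    then show ?thesis using B2 by simp
  qed
  define g where "g = (\<lambda>y. y + e * q y)"
  have dg: "deriv g y = 1 + e * deriv q y" for y unfolding g_def
    by (rule DERIV_imp_deriv) (intro DERIV_add DERIV_ident DERIV_cmult smooth_DERIV[OF sq])
  have g: "g \<in> Diffeo Circle"
  proof (rule DiffeoI[of g "1/2"])
    show "smooth g" unfolding g_def by (intro smooth_add smooth_ident smooth_mult smooth_const sq)
    show "1/2 \<le> deriv g y" for y using edq[of y] by (simp add: dg abs_le_iff)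
    show "g (y + 1) = g y + 1" for y using q by (simp add: g_def fn_space_def)
  qed simp
  define f where "f = inv g"
  have f: "f \<in> Diffeo Circle" unfolding f_def by (rule Diffeo_inv[OF g])
  have fg: "f (g y) = y" for y unfolding f_def by (rule DiffeoD(5)[OF g])
  \<comment> \<open>A coordinate on the circle exists only away from a cut. Here y is kept between
    x0 + r/2 and x0 + 1 - r/2 and damped to 0 within r/4 of the cut at x0.\<close>
  define h where "h = (\<lambda>y. y * (step_fn ((4/r) * (y - x0 - r/4)) * step_fn ((4/r) * (x0 + 1 - r/4 - y))))"
  have sh: "smooth h" unfolding h_def
    by (intro smooth_mult smooth_ident smooth_compose[OF smooth_step_fn] smooth_diff smooth_const smooth_add)
  have h0: "h y = 0" if "\<bar>y - (x0 + 1/2)\<bar> \<ge> 1/2 - r/4" for y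
  proof -
    have "y - x0 - r/4 \<le> 0 \<or> x0 + 1 - r/4 - y \<le> 0" using that by linarith
    then have "(4/r) * (y - x0 - r/4) \<le> 0 \<or> (4/r) * (x0 + 1 - r/4 - y) \<le> 0"
      using r(1) by (meson divide_nonneg_pos mult_nonneg_nonpos zero_le_numeral)
    then have "step_fn ((4/r) * (y - x0 - r/4)) = 0 \<or> step_fn ((4/r) * (x0 + 1 - r/4 - y)) = 0"
      using step_fn_eq_0 by blast
    then show ?thesis unfolding h_def by (metis mult_zero_left mult_zero_right)
  qed
  have h1: "h y = y" if "x0 + r/2 \<le> y" "y \<le> x0 + 1 - r/2" for y
  proof -
    have "(4/r) * (y - x0 - r/4) \<ge> 1" "(4/r) * (x0 + 1 - r/4 - y) \<ge> 1"
      using that r(1) by (simp_all add: field_simps)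
    then show ?thesis using step_fn_eq_1 by (simp only: h_def mult_1_right)
  qed
  have rr: "0 < 1/2 - r/4" "1/2 - r/4 < 1/2" using r by auto
  define u where "u = periodize (x0 + 1/2) h"
  have u: "u \<in> fn_space Circle" unfolding u_def by (rule periodize_fn_space[of "1/2 - r/4" "x0 + 1/2" h, OF h0 rr sh])
  have ueq: "u y = y" if "x0 + r/2 \<le> y" "y \<le> x0 + 1 - r/2" for y
    using periodize_eq[of "1/2 - r/4" "x0 + 1/2" h y, OF h0 rr(2)] h1[OF that] that r(1)
    by (simp add: u_def abs_le_iff field_simps)
  \<comment> \<open>Where q can be nonzero, z has distance at least r from the cut and g z at least
    r / 2, so u is the coordinate at both points; elsewhere g fixes z.\<close>
  have ug: "u (g y) = u y + e * q y" for y
  proof -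
    define n where "n = \<lfloor>y - x0\<rfloor>"
    define z where "z = y - of_int n"
    have z: "x0 \<le> z" "z < x0 + 1" unfolding z_def n_def by linarith+
    have y: "y = z + of_int n" by (simp add: z_def)
    have 1: "u (g z) = u z + e * q z"
    proof (cases "z < x0 + r \<or> z > x0 + 1 - r")
      case True
      then have "q z = 0"
      proof
        assume "z > x0 + 1 - r"
        then have "q (z - 1) = 0" using z by (intro r(3)) auto
        then show ?thesis using q unfolding fn_space_def by (metis (mono_tags, lifting) diff_add_cancel mem_Collect_eq)
      qed (use z r(3) in auto)
      then show ?thesis by (simp add: g_def)
    next
      case False
      then have "u z = z" using r(1) by (intro ueq) auto
      moreover have "u (g z) = g z" using False eq[of z] by (intro ueq) (auto simp: g_def)
      ultimately show ?thesis by (simp add: g_def)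
    qed
    show ?thesis unfolding y Diffeo_periodic_int[OF g] fn_space_periodic_int[OF u] fn_space_periodic_int[OF q]
      by (rule 1)
  qed
  define U :: "nat \<Rightarrow> real \<Rightarrow> 'a" where "U = monomial 0 (\<lambda>y. of_real (u y))"
  have U: "U \<in> op_coeffs k Circle" unfolding U_def by (intro monomial_coeffs fn_space_of_real u) simp
  have cU: "cact k lam lam f U = monomial 0 (\<lambda>y. of_real (u (g y)))"
  proof (intro ext)
    fix i z
    have z: "f (g z) = z" by (rule fg)
    have U0: "U i y = 0" if "i > 0" for i y using that by (simp add: U_def monomial_def)
    show "cact k lam lam f U i z = monomial 0 (\<lambda>y. of_real (u (g y))) i z"
    proof (cases "i = 0")
      case True
      have "cact k lam lam f U 0 (f (g z)) = of_real (deriv f (g z)) powr (lam + of_nat 0 - lam) * U 0 (g z)"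
        by (rule cact_leading(2)[OF f]) (use U0 in simp_all)
      then show ?thesis using True DiffeoD(4)[OF f, of "g z"]
        by (simp add: z powr_of_real_eq U_def monomial_def)
    next
      case False
      have "cact k lam lam f U i (f (g z)) = 0"
        by (rule cact_leading(1)[OF f, of 0]) (use U0 False in simp_all)
      then show ?thesis using False by (simp add: z monomial_def)
    qed
  qed
  have "T (cact k lam lam f U) j x0 = cact k lam lam f (T U) j x0" using CendD(4)[OF T f U] by simp
  also have "\<dots> = T U j x0"
  proof (rule cact_ident[OF f open_ball[of x0 r]])
    show "f y = y" if "y \<in> ball x0 r" for y
      using fg[of y] r(3)[of y] that by (auto simp: g_def dist_real_def abs_minus_commute)
  qed (use r CendD(1)[OF T U] in auto)
  finally have "fixed_order T j x0 0 (\<lambda>y. u (g y)) = fixed_order T j x0 0 u"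
    unfolding cU unfolding U_def fixed_order_def .
  moreover have "fixed_order T j x0 0 (\<lambda>y. u (g y)) = fixed_order T j x0 0 u + of_real e * fixed_order T j x0 0 q"
    unfolding ug using fixed_order_linear(1)[OF T _ u, of 0 "\<lambda>y. e * q y"] fixed_order_linear(3)[OF T _ q q, of 0]
      fn_space_mult[OF fn_space_const q] by simp
  ultimately show ?thesis using e by simp
qed

text \<open>For g with derivative \<rho>/M, the operator (g^-1) d^n has leading coefficient M^n \<rho>^-n, and
  its germ at x0 depends only on the germ of \<rho> and on the total mass M.\<close>
lemma Circle_mass_invariance:
  fixes \<rho>1 \<rho>2 :: "real \<Rightarrow> real" and lam :: "'k::powr_field"
  assumes T: "T \<in> Cend k lam lam Circle" and n: "n \<le> k"
    and IH: "\<And>a r. a \<in> op_coeffs k Circle \<Longrightarrow> (\<And>m y. m \<ge> n \<Longrightarrow> a m y = 0) \<Longrightarrow> r > 0 \<Longrightarrow>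
       (\<And>m y. \<bar>y - x0\<bar> < r \<Longrightarrow> a m y = 0) \<Longrightarrow> T a j x0 = 0"
    and r1: "\<rho>1 \<in> fn_space Circle" "\<And>y. \<rho>1 y > 0" "(\<rho>1 has_integral M) {x0..x0+1}"
    and r2: "\<rho>2 \<in> fn_space Circle" "\<And>y. \<rho>2 y > 0" "(\<rho>2 has_integral M) {x0..x0+1}"
    and r: "r > 0" "\<And>y. \<bar>y - x0\<bar> < r \<Longrightarrow> \<rho>1 y = \<rho>2 y"
  shows "fixed_order T j x0 n (\<lambda>y. inverse (\<rho>1 y ^ n)) = fixed_order T j x0 n (\<lambda>y. inverse (\<rho>2 y ^ n))"
proof -
  have M: "M > 0" using circle_diffeo_of_density[OF r1] by blast
  obtain g1 where g1: "g1 \<in> Diffeo Circle" "g1 x0 = x0" "\<And>y. deriv g1 y = \<rho>1 y / M"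
    using circle_diffeo_of_density[OF r1] by blast
  obtain g2 where g2: "g2 \<in> Diffeo Circle" "g2 x0 = x0" "\<And>y. deriv g2 y = \<rho>2 y / M"
    using circle_diffeo_of_density[OF r2] by blast
  define U :: "nat \<Rightarrow> real \<Rightarrow> 'k" where "U = monomial n (\<lambda>y. 1)"
  have U: "U \<in> op_coeffs k Circle" unfolding U_def by (intro monomial_coeffs fn_space_const n)
  have TU: "T U \<in> op_coeffs k Circle" by (rule CendD(1)[OF T U])
  have U0: "U i y = 0" if "i > n" for i y using that by (simp add: U_def monomial_def)
  have lead: "cact k lam lam (inv g) U m z = (if m = n then of_real (M ^ n * inverse (\<rho> z ^ n)) else 0)"
    if g: "g \<in> Diffeo Circle" "\<And>y. deriv g y = \<rho> y / M" and m: "m \<ge> n" for g \<rho> m z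
  proof -
    have f: "inv g \<in> Diffeo Circle" by (rule Diffeo_inv[OF g(1)])
    have z: "inv g (g z) = z" by (rule DiffeoD(5)[OF g(1)])
    have d: "deriv (inv g) (g z) = M / \<rho> z" using deriv_inv_Diffeo[OF g(1), of "g z"] z g(2) by simp
    show ?thesis
    proof (cases "m = n")
      case True
      have "cact k lam lam (inv g) U n (inv g (g z)) = of_real (deriv (inv g) (g z)) powr (lam + of_nat n - lam) * U n (g z)"
        by (rule cact_leading(2)[OF f U0 n])
      also have "\<dots> = of_real (deriv (inv g) (g z)) ^ n"
        using powr_of_real_of_nat[OF DiffeoD(4)[OF f, of "g z"], of n, where 'k='k] by (simp add: U_def monomial_def)
      finally show ?thesis using True z d by (simp add: power_mult_distrib power_inverse divide_inverse)
    next
      case False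
      have "cact k lam lam (inv g) U m (inv g (g z)) = 0"
        by (rule cact_leading(1)[OF f U0 n]) (use m False in simp_all)
      then show ?thesis using False z by simp
    qed
  qed
  \<comment> \<open>Equality of the masses enters here: both derivatives are divided by the same M,
    so the two diffeomorphisms have the same germ at x0.\<close>
  have "\<exists>c. \<forall>y\<in>ball x0 r. g1 y - g2 y = c"
  proof (rule has_field_derivative_zero_constant)
    fix y assume "y \<in> ball x0 r"
    then have "\<rho>1 y = \<rho>2 y" by (intro r(2)) (simp add: dist_real_def abs_minus_commute)
    then have "deriv g1 y - deriv g2 y = 0" by (simp add: g1(3) g2(3))
    moreover have "((\<lambda>y. g1 y - g2 y) has_real_derivative deriv g1 y - deriv g2 y) (at y)"
      by (rule DERIV_diff[OF smooth_DERIV[OF DiffeoD(1)[OF g1(1)]] smooth_DERIV[OF DiffeoD(1)[OF g2(1)]]])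
    ultimately have "((\<lambda>y. g1 y - g2 y) has_real_derivative 0) (at y)" by simp
    then show "((\<lambda>y. g1 y - g2 y) has_real_derivative 0) (at y within ball x0 r)"
      by (rule has_field_derivative_at_within)
  qed simp
  then obtain c where c: "\<And>y. y \<in> ball x0 r \<Longrightarrow> g1 y - g2 y = c" by blast
  have "c = 0" using c[of x0] r(1) g1(2) g2(2) by simp
  then have gg: "g1 y = g2 y" if "\<bar>y - x0\<bar> < r" for y using c[of y] that by (simp add: dist_real_def abs_minus_commute)
  define f1 where "f1 = inv g1"
  define f2 where "f2 = inv g2"
  have f1: "f1 \<in> Diffeo Circle" and f2: "f2 \<in> Diffeo Circle"
    unfolding f1_def f2_def by (auto intro: Diffeo_inv g1 g2)
  have fg1: "f1 (g1 y) = y" and fg2: "f2 (g2 y) = y" and gf1: "g1 (f1 y) = y" for y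
    unfolding f1_def f2_def by (rule DiffeoD(5,6)[OF g1(1)] DiffeoD(5)[OF g2(1)])+
  define S where "S = {y. \<bar>f1 y - x0\<bar> < r}"
  have S: "open S" unfolding S_def
    by (intro open_Collect_less continuous_intros smooth_continuous_on DiffeoD(1)[OF f1])
  have fS: "f1 y = f2 y" if "y \<in> S" for y
    using gg[of "f1 y"] gf1[of y] fg2[of "f1 y"] that by (simp add: S_def)
  have near: "cact k lam lam f1 a m z = cact k lam lam f2 a m z" if z: "\<bar>z - x0\<bar> < r" for a m z
  proof -
    have "g1 z \<in> S" using z by (simp add: S_def fg1)
    then show ?thesis using cact_germ[OF f1 f2 S, of "g1 z" a a k lam lam m] fS by (simp add: fg1)
  qed
  define A1 where "A1 = cact k lam lam f1 U"
  define A2 where "A2 = cact k lam lam f2 U"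
  have A: "A1 \<in> op_coeffs k Circle" "A2 \<in> op_coeffs k Circle"
    unfolding A1_def A2_def by (auto intro: cact_coeffs U f1 f2)
  have TA: "T A1 j x0 = T A2 j x0"
    unfolding A1_def A2_def CendD(4)[OF T f1 U] CendD(4)[OF T f2 U] by (rule near) (use r in simp)
  \<comment> \<open>The order-n coefficient of A1 - A2. Subtracting \<open>Q\<close> leaves an
    operator of lower order that vanishes near x0, to which the induction hypothesis
    applies.\<close>
  define q where "q = (\<lambda>y. M ^ n * (inverse (\<rho>1 y ^ n) - inverse (\<rho>2 y ^ n)))"
  note i1 = fn_space_inverse_power[OF r1(1,2), of n] and i2 = fn_space_inverse_power[OF r2(1,2), of n]
  have q: "q \<in> fn_space Circle" unfolding q_def by (intro fn_space_mult fn_space_diff fn_space_const i1 i2)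
  define Q :: "nat \<Rightarrow> real \<Rightarrow> 'k" where "Q = monomial n (\<lambda>y. of_real (q y))"
  have Q: "Q \<in> op_coeffs k Circle" unfolding Q_def by (intro monomial_coeffs fn_space_of_real q n)
  have A12: "(\<lambda>m y. A1 m y - A2 m y) \<in> op_coeffs k Circle"
    using csub_coeffs[OF A] by (simp add: csub_def)
  have "T (\<lambda>m y. (\<lambda>m y. A1 m y - A2 m y) m y - Q m y) j x0 = 0"
  proof (rule IH[OF _ _ r(1)])
    show "(\<lambda>m y. (\<lambda>m y. A1 m y - A2 m y) m y - Q m y) \<in> op_coeffs k Circle"
      using csub_coeffs[OF A12 Q] by (simp add: csub_def)
    show "A1 m y - A2 m y - Q m y = 0" if "m \<ge> n" for m y
      unfolding A1_def A2_def f1_def f2_def using lead[OF g1(1,3) that, of y] lead[OF g2(1,3) that, of y]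
      by (simp add: Q_def monomial_def q_def right_diff_distrib)
    show "A1 m y - A2 m y - Q m y = 0" if "\<bar>y - x0\<bar> < r" for m y
      using near[OF that, of U m] r(2)[OF that] by (simp add: A1_def A2_def Q_def monomial_def q_def)
  qed
  then have "T Q j x0 = 0"
    using Cend_diff_at[OF T A12 Q, of j x0] Cend_diff_at[OF T A, of j x0] TA by simp
  then have "fixed_order T j x0 n q = 0" by (simp add: fixed_order_def Q_def)
  then have "of_real (M ^ n) * fixed_order T j x0 n (\<lambda>y. inverse (\<rho>1 y ^ n) - inverse (\<rho>2 y ^ n)) = 0"
    unfolding q_def using fixed_order_linear(3)[OF T n fn_space_diff[OF i1 i2] i1, of j x0 "M ^ n"] by simp
  then have "fixed_order T j x0 n (\<lambda>y. inverse (\<rho>1 y ^ n) - inverse (\<rho>2 y ^ n)) = 0" using M by simp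
  then show ?thesis using fixed_order_linear(2)[OF T n i1 i2, of j x0] by simp
qed

lemma deriv_step_fn_eq_0:
  assumes "t < 0 \<or> t > 1"
  shows "deriv step_fn t = 0"
  using assms
proof
  assume t: "t < 0"
  have "deriv step_fn t = deriv (\<lambda>y. 0) t"
    by (rule deriv_local_cong[of "{..<0}"]) (use t in \<open>auto simp: step_fn_eq_0 smooth_step_fn smooth_const\<close>)
  then show ?thesis by simp
next
  assume t: "t > 1"
  have "deriv step_fn t = deriv (\<lambda>y. 1) t"
    by (rule deriv_local_cong[of "{1<..}"]) (use t in \<open>auto simp: step_fn_eq_1 smooth_step_fn smooth_const\<close>)
  then show ?thesis by simp
qed

text \<open>Unit masses with disjoint supports away from x0, and a background ct that is 1 on the
  first support and 0 on the others. Adding ct to the density 1 makes the first support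
  distinguishable from the other two.\<close>

lemma circle_bumps:
  obtains \<alpha> :: "nat \<Rightarrow> real \<Rightarrow> real" and ct :: "real \<Rightarrow> real" and r :: real where
    "\<And>m. m \<in> {1,2,3} \<Longrightarrow> \<alpha> m \<in> fn_space Circle" "ct \<in> fn_space Circle" "r > 0"
    "\<And>m. m \<in> {1,2,3} \<Longrightarrow> (\<alpha> m has_integral 1) {x0..x0+1}"
    "\<And>m y. m \<in> {1,2,3} \<Longrightarrow> \<bar>y - x0\<bar> < r \<Longrightarrow> \<alpha> m y = 0"
    "\<And>y. ct y \<ge> 0"
    "\<And>y. \<alpha> 1 y = 0 \<or> ct y = 1" "\<And>y. \<alpha> 2 y = 0 \<or> ct y = 0" "\<And>y. \<alpha> 3 y = 0 \<or> ct y = 0"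
    "\<And>y. \<alpha> 2 y = 0 \<or> \<alpha> 3 y = 0"
proof -
  \<comment> \<open>Derivatives of steps of width 1/16 starting at x0 + m/4, hence of integral 1.
    The cutoff c is centred at the midpoint x0 + 9/32 of the first support, and its radius 1/8 does
    not reach the second, which starts at x0 + 1/2.\<close>
  define h where "h = (\<lambda>m y. 16 * deriv step_fn (16 * (y - (x0 + real m / 4))))"
  define c where "c = (\<lambda>y. bump (16 * (y - (x0 + 9/32))))"
  have lin: "smooth (\<lambda>y. 16 * (y - p))" for p :: real
    by (intro smooth_mult smooth_diff smooth_const smooth_ident)
  have sh: "smooth (h m)" for m unfolding h_def
    by (intro smooth_mult smooth_const smooth_compose[OF smooth_deriv[OF smooth_step_fn] lin])
  have sc: "smooth c" unfolding c_def by (rule smooth_compose[OF smooth_bump lin])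
  have h_supp: "x0 + real m / 4 \<le> y" "y \<le> x0 + real m / 4 + 1/16" if "h m y \<noteq> 0" for m y
  proof -
    have "\<not> (16 * (y - (x0 + real m / 4)) < 0 \<or> 16 * (y - (x0 + real m / 4)) > 1)"
      using deriv_step_fn_eq_0 that unfolding h_def by (metis mult_zero_right)
    then have *: "0 \<le> 16 * (y - (x0 + real m / 4))" "16 * (y - (x0 + real m / 4)) \<le> 1" by auto
    show "x0 + real m / 4 \<le> y" using *(1) unfolding zero_le_mult_iff by simp
    show "y \<le> x0 + real m / 4 + 1/16" using *(2) by (simp add: algebra_simps)
  qed
  have h0: "h m y = 0" if "m \<in> {1,2,3}" "\<bar>y - (x0 + 1/2)\<bar> \<ge> 9/20" for m y
  proof (rule ccontr)
    assume "h m y \<noteq> 0"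
    from h_supp[OF this] that show False by (auto simp: abs_if split: if_splits)
  qed
  have c0: "c y = 0" if "\<bar>y - (x0 + 1/2)\<bar> \<ge> 9/20" for y
    unfolding c_def by (rule bump_eq_0) (use that in \<open>auto simp: abs_if split: if_splits\<close>)
  have rr: "(0::real) < 9/20" "(9/20::real) < 1/2" by auto
  define \<alpha> where "\<alpha> = (\<lambda>m. periodize (x0 + 1/2) (h m))"
  define ct where "ct = periodize (x0 + 1/2) c"
  have a: "\<alpha> m \<in> fn_space Circle" if "m \<in> {1,2,3}" for m unfolding \<alpha>_def
    by (rule periodize_fn_space[of "9/20" "x0+1/2" "h m", OF h0[OF that] rr sh])
  have ct: "ct \<in> fn_space Circle" unfolding ct_def by (rule periodize_fn_space[of "9/20" "x0+1/2" c, OF c0 rr sc])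
  have aeq: "\<alpha> m y = h m y" if "m \<in> {1,2,3}" "x0 \<le> y" "y \<le> x0 + 1" for m y
    unfolding \<alpha>_def by (rule periodize_eq[of "9/20" "x0+1/2" "h m", OF h0[OF that(1)] rr(2)]) (use that in \<open>auto simp: abs_if\<close>)
  have ceq: "ct y = c y" if "x0 \<le> y" "y \<le> x0 + 1" for y
    unfolding ct_def by (rule periodize_eq[of "9/20" "x0+1/2" c, OF c0 rr(2)]) (use that in \<open>auto simp: abs_if\<close>)
  have red: "\<exists>z. x0 \<le> z \<and> z \<le> x0 + 1 \<and> (\<forall>m\<in>{1,2,3}. \<alpha> m y = h m z) \<and> ct y = c z" for y
  proof -
    define n where "n = \<lfloor>y - x0\<rfloor>"
    have z: "x0 \<le> y - of_int n" "y - of_int n \<le> x0 + 1" unfolding n_def by linarith+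
    have "\<alpha> m y = h m (y - of_int n)" if "m \<in> {1,2,3}" for m
      using fn_space_periodic_int[OF a[OF that], of "y - of_int n" n] aeq[OF that z] by simp
    moreover have "ct y = c (y - of_int n)"
      using fn_space_periodic_int[OF ct, of "y - of_int n" n] ceq[OF z] by simp
    ultimately show ?thesis using z by blast
  qed
  show ?thesis
  proof (rule that[of \<alpha> ct "1/20"])
    fix m :: nat assume m: "m \<in> {1,2,3}"
    show "\<alpha> m \<in> fn_space Circle" by (rule a[OF m])
    have "((\<lambda>y. step_fn (16 * (y - (x0 + real m / 4)))) has_vector_derivative h m y) (at y)" for y
    proof -
      have "((\<lambda>y. 16 * (y - (x0 + real m / 4))) has_real_derivative 16) (at y)"
        by (auto intro!: derivative_eq_intros)
      from DERIV_chain2[OF smooth_DERIV[OF smooth_step_fn] this] show ?thesis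
        by (simp add: h_def has_real_derivative_iff_has_vector_derivative mult.commute)
    qed
    then have "(h m has_integral (step_fn (16 * (x0 + 1 - (x0 + real m / 4))) - step_fn (16 * (x0 - (x0 + real m / 4))))) {x0..x0+1}"
      by (intro fundamental_theorem_of_calculus) (auto intro: has_vector_derivative_at_within)
    moreover have "step_fn (16 * (x0 + 1 - (x0 + real m / 4))) = 1" by (rule step_fn_eq_1) (use m in auto)
    moreover have "step_fn (16 * (x0 - (x0 + real m / 4))) = 0" by (rule step_fn_eq_0) simp
    ultimately have "(h m has_integral 1) {x0..x0+1}" by simp
    then show "(\<alpha> m has_integral 1) {x0..x0+1}"
      by (rule has_integral_eq[rotated]) (use aeq[OF m] in auto)
    fix y assume y: "\<bar>y - x0\<bar> < 1/20"
    show "\<alpha> m y = 0"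
    proof (cases "y \<ge> x0")
      case True
      then have "\<alpha> m y = h m y" using y by (intro aeq[OF m]) auto
      also have "\<dots> = 0" by (rule h0[OF m]) (use y True in auto)
      finally show ?thesis .
    next
      case False
      have "\<alpha> m y = \<alpha> m (y + 1)" using a[OF m] by (simp add: fn_space_def)
      also have "\<dots> = h m (y + 1)" using y False by (intro aeq[OF m]) auto
      also have "\<dots> = 0" by (rule h0[OF m]) (use y False in auto)
      finally show ?thesis .
    qed
  next
    fix y
    obtain z where z: "\<And>m. m \<in> {1,2,3} \<Longrightarrow> \<alpha> m y = h m z" "ct y = c z" using red[of y] by blast
    show "ct y \<ge> 0" unfolding z(2) c_def by (rule bump_range)
    show "\<alpha> 1 y = 0 \<or> ct y = 1"
    proof (cases "h 1 z = 0")
      case False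
      have "c z = 1" unfolding c_def by (rule bump_eq_1) (use h_supp[OF False] in auto)
      then show ?thesis using z by simp
    qed (use z in simp)
    have far: "c z = 0" if "m \<in> {2,3}" "h m z \<noteq> 0" for m
      unfolding c_def by (rule bump_eq_0) (use h_supp[OF that(2)] that(1) in \<open>auto simp: abs_if\<close>)
    show "\<alpha> 2 y = 0 \<or> ct y = 0" "\<alpha> 3 y = 0 \<or> ct y = 0" using far[of 2] far[of 3] z by auto
    show "\<alpha> 2 y = 0 \<or> \<alpha> 3 y = 0" using h_supp[of 2 z] h_supp[of 3 z] z by force
  qed (use ct in auto)
qed

text \<open>Controls how far the mass of (1 + e * q)^(-1/n) is from 1, by a bound that does not
  depend on the exponent.\<close>

lemma powr_near_one:
  fixes x :: real
  assumes "\<bar>x\<bar> \<le> 1/2" "-1 \<le> p" "p \<le> 0"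
  shows "\<bar>(1 + x) powr p - 1\<bar> \<le> 2 * \<bar>x\<bar>"
proof (cases "x \<ge> 0")
  case True
  have "(1 + x) powr (-1) \<le> (1 + x) powr p" "(1 + x) powr p \<le> (1 + x) powr 0"
    using True assms by (intro powr_mono; simp)+
  moreover have "(1 + x) powr (-1) \<ge> 1 - 2 * x"
    using True assms by (simp add: powr_minus field_simps)
  ultimately show ?thesis using True by (simp add: abs_if)
next
  case False
  have x: "1 + x > 0" "x < 0" "x \<ge> -1/2" using assms False by auto
  have "(1 + x) powr p \<le> (1 + x) powr (-1)" "(1 + x) powr 0 \<le> (1 + x) powr p"
    using x assms by (intro powr_mono'; simp)+
  moreover have "(1 + x) powr (-1) \<le> 1 - 2 * x"
  proof -
    have "1 \<le> (1 - 2 * x) * (1 + x)" using mult_nonneg_nonpos[of "1 + 2 * x" x] x by (simp add: algebra_simps)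
    then show ?thesis using x by (simp add: powr_minus divide_le_eq inverse_eq_divide)
  qed
  ultimately show ?thesis using x by (simp add: abs_if)
qed

text \<open>Writing C(\<rho>) for the value on \<rho>^-n, mass invariance compares doubling the density on the support
  of the first bump (scaling C by 2^-n) with placing two unit bumps (scaling by 2): so C is constant.\<close>
lemma Circle_local_order_Suc:
  fixes lam :: "'k::powr_field"
  assumes T: "T \<in> Cend k lam lam Circle" and n: "1 \<le> n" "n \<le> k"
    and IH: "\<And>a r. a \<in> op_coeffs k Circle \<Longrightarrow> (\<And>m y. m \<ge> n \<Longrightarrow> a m y = 0) \<Longrightarrow> r > 0 \<Longrightarrow>
       (\<And>m y. \<bar>y - x0\<bar> < r \<Longrightarrow> a m y = 0) \<Longrightarrow> T a j x0 = 0"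
    and q: "q \<in> fn_space Circle" and r0: "r0 > 0" "\<And>y. \<bar>y - x0\<bar> < r0 \<Longrightarrow> q y = 0"
  shows "fixed_order T j x0 n q = 0"
proof (rule circle_bumps[of x0])
  fix \<alpha> :: "nat \<Rightarrow> real \<Rightarrow> real" and ct :: "real \<Rightarrow> real" and r1 :: real
  assume al: "\<And>m. m \<in> {1,2,3} \<Longrightarrow> \<alpha> m \<in> fn_space Circle" and ct: "ct \<in> fn_space Circle" and r1: "r1 > 0"
    and ai: "\<And>m. m \<in> {1,2,3} \<Longrightarrow> (\<alpha> m has_integral 1) {x0..x0+1}"
    and a0: "\<And>m y. m \<in> {1,2,3} \<Longrightarrow> \<bar>y - x0\<bar> < r1 \<Longrightarrow> \<alpha> m y = 0"
    and ct0: "\<And>y. ct y \<ge> 0"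
    and d1: "\<And>y. \<alpha> 1 y = 0 \<or> ct y = 1" and d2: "\<And>y. \<alpha> 2 y = 0 \<or> ct y = 0" and d3: "\<And>y. \<alpha> 3 y = 0 \<or> ct y = 0"
    and d23: "\<And>y. \<alpha> 2 y = 0 \<or> \<alpha> 3 y = 0"
  have a: "\<alpha> 1 \<in> fn_space Circle" "\<alpha> 2 \<in> fn_space Circle" "\<alpha> 3 \<in> fn_space Circle" using al by auto
  obtain B1 B2 B3 where B: "\<And>y. \<bar>\<alpha> 1 y\<bar> \<le> B1" "\<And>y. \<bar>\<alpha> 2 y\<bar> \<le> B2" "\<And>y. \<bar>\<alpha> 3 y\<bar> \<le> B3" "B1 > 0" "B2 > 0" "B3 > 0"
    using fn_space_bounded[OF a(1)] fn_space_bounded[OF a(2)] fn_space_bounded[OF a(3)] by blast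
  define B where "B = max B1 (max B2 B3)"
  have aB: "\<bar>\<alpha> m y\<bar> \<le> B" if "m \<in> {1,2,3}" for m y
    using that B(1)[of y] B(2)[of y] B(3)[of y] by (auto simp: B_def)
  have B0: "B > 0" using B(4) by (simp add: B_def)
  define C where "C = (\<lambda>\<rho>. fixed_order T j x0 n (\<lambda>y. inverse (\<rho> y ^ n)))"
  have mass: "C \<rho> = C \<rho>'" if "\<rho> \<in> fn_space Circle" "\<And>y. \<rho> y > 0" "(\<rho> has_integral M) {x0..x0+1}"
     "\<rho>' \<in> fn_space Circle" "\<And>y. \<rho>' y > 0" "(\<rho>' has_integral M) {x0..x0+1}" "s > 0" "\<And>y. \<bar>y - x0\<bar> < s \<Longrightarrow> \<rho> y = \<rho>' y"
    for \<rho> \<rho>' M s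
    unfolding C_def by (rule Circle_mass_invariance[OF T n(2) IH that])
  have C_diff: "C \<rho> - C \<rho>' = fixed_order T j x0 n (\<lambda>y. inverse (\<rho> y ^ n) - inverse (\<rho>' y ^ n))"
    if "\<rho> \<in> fn_space Circle" "\<And>y. \<rho> y > 0" "\<rho>' \<in> fn_space Circle" "\<And>y. \<rho>' y > 0" for \<rho> \<rho>'
    unfolding C_def using fixed_order_linear(2)[OF T n(2) fn_space_inverse_power[OF that(1,2)] fn_space_inverse_power[OF that(3,4)]] by simp
  have one: "(\<lambda>y. 1::real) \<in> fn_space Circle" by (rule fn_space_const)
  have i1: "((\<lambda>y. 1::real) has_integral 1) {x0..x0+1}" using has_integral_const_real[of "1::real" x0 "x0+1"] by simp
  have const: "C (\<lambda>y. 1 + t * \<alpha> 1 y) = C (\<lambda>y. 1)" if t: "\<bar>t\<bar> \<le> 1 / (4 * B)" for t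
  proof -
    have tb: "\<bar>t * \<alpha> m y\<bar> \<le> 1/4" if "m \<in> {1,2,3}" for m y
    proof -
      have "\<bar>t * \<alpha> m y\<bar> \<le> (1 / (4 * B)) * B" unfolding abs_mult
        using t aB[OF that, of y] B0 by (intro mult_mono) auto
      then show ?thesis using B0 by simp
    qed
    have tf: "(\<lambda>y. 1 + t * \<alpha> m y) \<in> fn_space Circle" if "m \<in> {1,2,3}" for m
      by (intro fn_space_add fn_space_mult fn_space_const al that)
    have tp: "1 + t * \<alpha> m y > 0" if "m \<in> {1,2,3}" for m y using tb[OF that, of y] by (simp add: abs_le_iff)
    have ti: "((\<lambda>y. 1 + t * \<alpha> m y) has_integral (1 + t * 1)) {x0..x0+1}" if "m \<in> {1,2,3}" for m
      by (intro has_integral_add has_integral_mult_right i1 ai that)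
    have eqm: "C (\<lambda>y. 1 + t * \<alpha> m y) = C (\<lambda>y. 1 + t * \<alpha> 1 y)" if "m \<in> {1,2,3}" for m
      by (rule mass[OF tf[OF that] tp[OF that] ti[OF that] tf tp ti r1]) (use a0 that in auto)
    \<comment> \<open>A background density with value 2 on the support of \<alpha> 1 and value 1 on
      those of \<alpha> 2 and \<alpha> 3.\<close>
    define b where "b = (\<lambda>y. 1 + ct y)"
    have b: "b \<in> fn_space Circle" unfolding b_def by (intro fn_space_add fn_space_const ct)
    have b1: "b y \<ge> 1" for y using ct0 by (simp add: b_def)
    have bp: "b y > 0" for y using b1[of y] by linarith
    obtain I where I: "(b has_integral I) {x0..x0+1}"
      using integrable_continuous_real[OF smooth_continuous_on[OF fn_space_smooth[OF b]]] by blast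
    \<comment> \<open>L adds mass 2 * t in one place, where the background is 2; R adds t in two
      places, where it is 1. Both have the same mass and the same germ at x0.\<close>
    define L where "L = (\<lambda>y. b y + 2 * t * \<alpha> 1 y)"
    define R where "R = (\<lambda>y. b y + (t * \<alpha> 2 y + t * \<alpha> 3 y))"
    have L: "L \<in> fn_space Circle" unfolding L_def by (intro fn_space_add fn_space_mult fn_space_const a b)
    have R: "R \<in> fn_space Circle" unfolding R_def by (intro fn_space_add fn_space_mult fn_space_const a b)
    have Lp: "L y > 0" for y using tb[of 1 y] b1[of y] by (auto simp: L_def abs_le_iff)
    have Rp: "R y > 0" for y using tb[of 2 y] tb[of 3 y] b1[of y] by (auto simp: R_def abs_le_iff)
    have Li: "(L has_integral (I + 2 * t * 1)) {x0..x0+1}" unfolding L_def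
      by (intro has_integral_add has_integral_mult_right I ai) auto
    have "(R has_integral (I + (t * 1 + t * 1))) {x0..x0+1}" unfolding R_def
      by (intro has_integral_add has_integral_mult_right I ai) auto
    then have Ri: "(R has_integral (I + 2 * t * 1)) {x0..x0+1}" by simp
    have "C L = C R" by (rule mass[OF L Lp Li R Rp Ri r1]) (use a0 in \<open>auto simp: L_def R_def\<close>)
    moreover have "C L - C b = of_real (inverse (2 ^ n)) * (C (\<lambda>y. 1 + t * \<alpha> 1 y) - C (\<lambda>y. 1))"
    proof -
      have "inverse (L y ^ n) - inverse (b y ^ n) = inverse (2 ^ n) * (inverse ((1 + t * \<alpha> 1 y) ^ n) - inverse (1 ^ n))" for y
      proof (cases "\<alpha> 1 y = 0")
        case False
        then have "ct y = 1" using d1 by blast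
        then have "L y = 2 * (1 + t * \<alpha> 1 y)" "b y = 2" by (auto simp: L_def b_def)
        then show ?thesis by (simp only: power_mult_distrib inverse_mult_distrib) (simp add: right_diff_distrib)
      qed (simp add: L_def)
      then have "C L - C b = fixed_order T j x0 n (\<lambda>y. inverse (2 ^ n) * (inverse ((1 + t * \<alpha> 1 y) ^ n) - inverse (1 ^ n)))"
        unfolding C_diff[OF L Lp b bp] by presburger
      also have "\<dots> = of_real (inverse (2 ^ n)) * fixed_order T j x0 n (\<lambda>y. inverse ((1 + t * \<alpha> 1 y) ^ n) - inverse (1 ^ n))"
        by (rule fixed_order_linear(3)[OF T n(2) fn_space_diff b]) (rule fn_space_inverse_power[OF tf tp] fn_space_const; simp)+
      also have "fixed_order T j x0 n (\<lambda>y. inverse ((1 + t * \<alpha> 1 y) ^ n) - inverse (1 ^ n)) = C (\<lambda>y. 1 + t * \<alpha> 1 y) - C (\<lambda>y. 1)"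
        using C_diff[OF tf tp one, of 1] by simp
      finally show ?thesis .
    qed
    moreover have "C R - C b = (C (\<lambda>y. 1 + t * \<alpha> 2 y) - C (\<lambda>y. 1)) + (C (\<lambda>y. 1 + t * \<alpha> 3 y) - C (\<lambda>y. 1))"
    proof -
      have "inverse (R y ^ n) - inverse (b y ^ n) = (inverse ((1 + t * \<alpha> 2 y) ^ n) - inverse (1 ^ n)) + (inverse ((1 + t * \<alpha> 3 y) ^ n) - inverse (1 ^ n))" for y
        using d2[of y] d3[of y] d23[of y] by (auto simp: R_def b_def)
      then have "C R - C b = fixed_order T j x0 n (\<lambda>y. (inverse ((1 + t * \<alpha> 2 y) ^ n) - inverse (1 ^ n)) + (inverse ((1 + t * \<alpha> 3 y) ^ n) - inverse (1 ^ n)))"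
        unfolding C_diff[OF R Rp b bp] by presburger
      also have "\<dots> = fixed_order T j x0 n (\<lambda>y. inverse ((1 + t * \<alpha> 2 y) ^ n) - inverse (1 ^ n)) + fixed_order T j x0 n (\<lambda>y. inverse ((1 + t * \<alpha> 3 y) ^ n) - inverse (1 ^ n))"
        by (rule fixed_order_linear(1)[OF T n(2)]; rule fn_space_diff; (rule fn_space_inverse_power[OF tf tp] fn_space_const; simp))
      finally show ?thesis using C_diff[OF tf tp one, of 2] C_diff[OF tf tp one, of 3] by simp
    qed
    \<comment> \<open>A bump of relative height t over background 2 contributes 2^(-n) * D, two of
      them over background 1 contribute 2 * D; hence D = 0.\<close>
    moreover define D where "D = C (\<lambda>y. 1 + t * \<alpha> 1 y) - C (\<lambda>y. 1)"
    ultimately have "of_real (inverse (2 ^ n)) * D = D + D" using eqm[of 2] eqm[of 3] by simp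
    then have "of_real (inverse (2 ^ n) - 2) * D = 0" by (simp add: left_diff_distrib)
    moreover have "inverse (2 ^ n) - 2 \<noteq> (0::real)"
    proof -
      have "inverse ((2::real) ^ n) \<le> 1" by (simp add: inverse_le_1_iff)
      then show ?thesis by linarith
    qed
    ultimately have "D = 0" by (metis mult_eq_0_iff of_real_eq_0_iff)
    then show ?thesis by (simp add: D_def)
  qed
  obtain Q where Q: "Q > 0" "\<And>y. \<bar>q y\<bar> \<le> Q" using fn_space_bounded[OF q] by blast
  \<comment> \<open>The first bound is the domain of \<open>powr_near_one\<close>; the second brings
    M within 1 / (4 * B) of 1, the range of t in \<open>const\<close>.\<close>
  define e where "e = min (1 / (2 * Q)) (1 / (8 * B * Q))"
  have e: "e > 0" using Q B0 by (simp add: e_def)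
  have eq: "\<bar>e * q y\<bar> \<le> 1/2" "2 * \<bar>e * q y\<bar> \<le> 1 / (4 * B)" for y
  proof -
    have "\<bar>e * q y\<bar> \<le> (1 / (2 * Q)) * Q" unfolding abs_mult using e Q by (intro mult_mono) (auto simp: e_def)
    then show "\<bar>e * q y\<bar> \<le> 1/2" using Q by simp
    have "\<bar>e * q y\<bar> \<le> (1 / (8 * B * Q)) * Q" unfolding abs_mult using e Q B0 by (intro mult_mono) (auto simp: e_def)
    then show "2 * \<bar>e * q y\<bar> \<le> 1 / (4 * B)" using Q by simp
  qed
  have pos: "1 + e * q y > 0" for y using eq(1)[of y] by (simp add: abs_le_iff)
  \<comment> \<open>The exponent for which the inverse n-th power of \<rho> is 1 + e * q, so that C
    at \<rho> minus C at 1 is the value on e * q.\<close>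
  define p where "p = - (1 / real n)"
  have p: "-1 \<le> p" "p \<le> 0" "p * real n = -1" using n by (auto simp: p_def)
  define \<rho> where "\<rho> = (\<lambda>y. (1 + e * q y) powr p)"
  have rf: "\<rho> \<in> fn_space Circle" unfolding \<rho>_def
    using fn_space_powr[OF fn_space_add[OF fn_space_const fn_space_mult[OF fn_space_const q]] pos, of p] by simp
  have rp: "\<rho> y > 0" for y using pos[of y] by (simp add: \<rho>_def)
  obtain M where M: "(\<rho> has_integral M) {x0..x0+1}"
    using integrable_continuous_real[OF smooth_continuous_on[OF fn_space_smooth[OF rf]]] by blast
  have "\<bar>M - 1\<bar> \<le> 1 / (4 * B)"
  proof -
    have i: "((\<lambda>y. \<rho> y - 1) has_integral (M - 1)) {x0..x0+1}" by (rule has_integral_diff[OF M i1])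
    have bd: "\<bar>\<rho> y - 1\<bar> \<le> 1 / (4 * B)" for y
      using powr_near_one[OF eq(1)[of y] p(1,2)] eq(2)[of y] by (simp add: \<rho>_def)
    have "norm (M - 1) \<le> (1 / (4 * B)) * measure lborel {x0..x0+1}"
      by (rule has_integral_bound_real[OF _ _ i, where S="{}"]) (use bd B0 in auto)
    then show ?thesis by simp
  qed
  then have c: "C (\<lambda>y. 1 + (M - 1) * \<alpha> 1 y) = C (\<lambda>y. 1)" by (rule const)
  \<comment> \<open>Both densities are 1 near x0 and both have mass M. The perturbation by q is thus
    traded for a multiple of \<alpha> 1, on which C is already known to be constant.\<close>
  have "C \<rho> = C (\<lambda>y. 1 + (M - 1) * \<alpha> 1 y)"
  proof (rule mass[OF rf rp M])
    have "((\<lambda>y. 1 + (M - 1) * \<alpha> 1 y) has_integral (1 + (M - 1) * 1)) {x0..x0+1}"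
      by (intro has_integral_add has_integral_mult_right i1 ai) auto
    then show "((\<lambda>y. 1 + (M - 1) * \<alpha> 1 y) has_integral M) {x0..x0+1}" by simp
    show "(\<lambda>y. 1 + (M - 1) * \<alpha> 1 y) \<in> fn_space Circle" by (intro fn_space_add fn_space_mult fn_space_const a)
    show "0 < 1 + (M - 1) * \<alpha> 1 y" for y
    proof -
      have "\<bar>(M - 1) * \<alpha> 1 y\<bar> \<le> (1 / (4 * B)) * B" unfolding abs_mult
        using \<open>\<bar>M - 1\<bar> \<le> 1 / (4 * B)\<close> aB[of 1 y] B0 by (intro mult_mono) auto
      then have "\<bar>(M - 1) * \<alpha> 1 y\<bar> \<le> 1/4" using B0 by simp
      then show ?thesis by (simp add: abs_le_iff)
    qed
    show "min r0 r1 > 0" using r0 r1 by simp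
    show "\<rho> y = 1 + (M - 1) * \<alpha> 1 y" if "\<bar>y - x0\<bar> < min r0 r1" for y
      using that r0(2)[of y] a0[of 1 y] by (simp add: \<rho>_def)
  qed
  then have "C \<rho> - C (\<lambda>y. 1) = 0" using c by simp
  moreover have "C \<rho> - C (\<lambda>y. 1) = fixed_order T j x0 n (\<lambda>y. e * q y)"
  proof -
    have "inverse (\<rho> y ^ n) - inverse (1 ^ n) = e * q y" for y
    proof -
      have "\<rho> y ^ n = (1 + e * q y) powr (p * real n)"
        using pos[of y] by (simp add: \<rho>_def powr_powr flip: powr_realpow)
      then show ?thesis using pos[of y] by (simp add: p(3) powr_minus)
    qed
    then show ?thesis using C_diff[OF rf rp one] by simp
  qed
  ultimately show ?thesis using fixed_order_linear(3)[OF T n(2) q q, of j x0 e] e by simp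
qed

text \<open>Induction on the order is forced because mass invariance controls leading coefficients
  only. Complex symbols are split into real and imaginary parts to reach
  \<open>fixed_order\<close>.\<close>

lemma Circle_local_eq:
  fixes lam :: complex
  assumes T: "T \<in> Cend k lam lam Circle"
  shows "Cend_local Circle k T"
  unfolding Cend_local_def
proof (intro ballI allI impI)
  fix a :: "nat \<Rightarrow> real \<Rightarrow> complex" and S x0 j
  assume a: "a \<in> op_coeffs k Circle" and S: "open S" "x0 \<in> S" "\<forall>i. \<forall>y\<in>S. a i y = 0"
  have main: "T a j x0 = 0" if "a \<in> op_coeffs k Circle" "\<And>m y. m \<ge> n \<Longrightarrow> a m y = 0" "r > 0"
    "\<And>m y. \<bar>y - x0\<bar> < r \<Longrightarrow> a m y = 0" for a r n
    using that
  proof (induction n arbitrary: a r)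
    case 0
    then have "a = (\<lambda>i x. 0)" by (auto simp: fun_eq_iff)
    then show ?case using Cend_zero[OF T] by simp
  next
    case (Suc n)
    show ?case
    proof (cases "n \<le> k")
      case False
      then have "a m y = 0" if "m \<ge> n" for m y using coeffsD(2)[OF Suc.prems(1)] that by auto
      then show ?thesis using Suc.IH[OF Suc.prems(1) _ Suc.prems(3,4)] by blast
    next
      case True
      have real: "fixed_order T j x0 n q = 0" if q: "q \<in> fn_space Circle" "\<And>y. \<bar>y - x0\<bar> < r \<Longrightarrow> q y = 0" for q
      proof (cases "n = 0")
        case True
        then show ?thesis using Circle_local_order_0[OF T q(1) Suc.prems(3) q(2)] by simp
      next
        case False
        then have "1 \<le> n" by simp
        then show ?thesis
          by (rule Circle_local_order_Suc[OF T _ \<open>n \<le> k\<close> Suc.IH q(1) Suc.prems(3) q(2)])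
      qed
      note an = coeffsD(1)[OF Suc.prems(1), of n]
      have re: "(\<lambda>y. Re (a n y)) \<in> fn_space Circle" and im: "(\<lambda>y. Im (a n y)) \<in> fn_space Circle"
        using an smooth_bounded_linear[OF bounded_linear_Re] smooth_bounded_linear[OF bounded_linear_Im]
        by (auto simp: fn_space_def)
      define u where "u = monomial n (\<lambda>y. complex_of_real (Re (a n y)))"
      define v where "v = monomial n (\<lambda>y. complex_of_real (Im (a n y)))"
      have u: "u \<in> op_coeffs k Circle" and v: "v \<in> op_coeffs k Circle"
        unfolding u_def v_def by (intro monomial_coeffs fn_space_of_real re im True)+
      have iv: "(\<lambda>i y. \<i> * v i y) \<in> op_coeffs k Circle" using csmul_coeffs[OF v] by (simp add: csmul_def)
      define w where "w = (\<lambda>i y. u i y + \<i> * v i y)"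
      have w: "w \<in> op_coeffs k Circle" using cadd_coeffs[OF u iv] by (simp add: cadd_def w_def)
      have wn: "w m y = (if m = n then a n y else 0)" for m y
        using complex_eq[of "a n y"] by (simp add: w_def u_def v_def monomial_def)
      have "T w j x0 = T u j x0 + \<i> * T v j x0"
        unfolding w_def using Cend_add_at[OF T u iv, of j x0] Cend_smul_at[OF T v, of "\<i>" j x0] by simp
      also have "T u j x0 = 0" using real[OF re] Suc.prems(4) by (simp add: fixed_order_def u_def)
      also have "T v j x0 = 0" using real[OF im] Suc.prems(4) by (simp add: fixed_order_def v_def)
      finally have Tw: "T w j x0 = 0" by simp
      have "T (\<lambda>m y. a m y - w m y) j x0 = 0"
      proof (rule Suc.IH[OF _ _ Suc.prems(3)])
        show "(\<lambda>m y. a m y - w m y) \<in> op_coeffs k Circle" using csub_coeffs[OF Suc.prems(1) w] by (simp add: csub_def)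
      qed (use Suc.prems(2,4) in \<open>auto simp: wn not_less_eq_eq\<close>)
      then show ?thesis using Cend_diff_at[OF T Suc.prems(1) w, of j x0] Tw by simp
    qed
  qed
  obtain r where r: "r > 0" "ball x0 r \<subseteq> S" using S(1,2) openE by blast
  show "T a j x0 = 0"
    by (rule main[OF a _ r(1), of "Suc k"])
       (use coeffsD(2)[OF a] r(2) S(3) in \<open>auto simp: subset_iff dist_real_def abs_minus_commute\<close>)
qed

lemma Cend_local_Circle:
  fixes lam mu :: complex
  assumes "T \<in> Cend k lam mu Circle" "(lam, mu) \<noteq> (0, 1)"
  shows "Cend_local Circle k T"
  using Circle_local_eq Circle_local_neq assms by blast

section \<open>Restriction from the line to the circle\<close>

text \<open>\<open>small_germ_extension\<close> reaches only derivatives near 1. So the derivative s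
  of f at x is written as \<sigma> ^ n with \<sigma> close to 1, the dilation germ by \<sigma> is
  extended and iterated, and what remains of f has derivative 1 at x.\<close>

lemma circle_germ_extension:
  assumes f: "f \<in> Diffeo Line"
  shows "\<exists>g\<in>Diffeo Circle. \<exists>\<epsilon>>0. \<forall>y. \<bar>y - x\<bar> < \<epsilon> \<longrightarrow> g y = f y"
proof -
  obtain d where d: "d > 0" and germ: "\<And>\<eta> x0 R. smooth \<eta> \<Longrightarrow> \<eta> x0 = 0 \<Longrightarrow> \<bar>deriv \<eta> x0\<bar> < d \<Longrightarrow> R > 0 \<Longrightarrow>
    (\<exists>f\<in>Diffeo Circle. \<exists>\<epsilon>>0. (\<forall>y. \<bar>y - x0\<bar> < \<epsilon> \<longrightarrow> f y = y + \<eta> y) \<and>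
       (\<forall>y. (\<forall>n::int. \<bar>y - of_int n - x0\<bar> \<ge> R) \<longrightarrow> f y = y) \<and> (\<forall>y. \<bar>f y - y\<bar> < R))"
    using small_germ_extension by metis
  have near: "\<exists>g\<in>Diffeo Circle. \<exists>\<epsilon>>0. \<forall>y. \<bar>y - x\<bar> < \<epsilon> \<longrightarrow> g y = y + \<eta> y"
    if "smooth \<eta>" "\<eta> x = 0" "\<bar>deriv \<eta> x\<bar> < d" for \<eta>
    using germ[OF that, of 1] by auto
  define s where "s = deriv f x"
  have s: "s > 0" unfolding s_def by (rule DiffeoD(4)[OF f])
  have "\<forall>\<^sub>F n in sequentially. \<bar>root n s - 1\<bar> < d"
    using tendstoD[OF LIMSEQ_root_const[OF s] d] by (simp add: dist_real_def)
  then obtain n0 where n0: "\<And>n. n \<ge> n0 \<Longrightarrow> \<bar>root n s - 1\<bar> < d" by (auto simp: eventually_sequentially)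
  define n where "n = Suc n0"
  define \<sigma> where "\<sigma> = root n s"
  have sg: "\<bar>\<sigma> - 1\<bar> < d" "\<sigma> ^ n = s" "\<sigma> > 0"
    using n0[of n] s real_root_pow_pos2[of n s] unfolding \<sigma>_def by (auto simp: n_def)
  define \<eta>1 where "\<eta>1 = (\<lambda>y. (\<sigma> - 1) * (y - x))"
  have "deriv \<eta>1 x = \<sigma> - 1" unfolding \<eta>1_def
    by (rule DERIV_imp_deriv) (auto intro!: derivative_eq_intros)
  moreover have "smooth \<eta>1" unfolding \<eta>1_def by (intro smooth_intros)
  ultimately obtain D \<delta> where D: "D \<in> Diffeo Circle" "\<delta> > 0" "\<And>y. \<bar>y - x\<bar> < \<delta> \<Longrightarrow> D y = y + (\<sigma> - 1) * (y - x)"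
    using near[of \<eta>1] sg(1) by (auto simp: \<eta>1_def)
  have pow: "\<exists>G\<in>Diffeo Circle. \<exists>\<epsilon>>0. \<forall>y. \<bar>y - x\<bar> < \<epsilon> \<longrightarrow> G y = x + \<sigma> ^ m * (y - x)" for m
  proof (induction m)
    case 0
    show ?case using Diffeo_shift[of 0 Circle] by (intro bexI[of _ "\<lambda>y. y + 0"] exI[of _ 1]) auto
  next
    case (Suc m)
    then obtain G \<epsilon> where G: "G \<in> Diffeo Circle" "\<epsilon> > 0" "\<And>y. \<bar>y - x\<bar> < \<epsilon> \<Longrightarrow> G y = x + \<sigma> ^ m * (y - x)" by blast
    have c: "(\<lambda>y. D (G y)) \<in> Diffeo Circle" by (rule Diffeo_compose[OF D(1) G(1)])
    show ?case
    proof (intro bexI[OF _ c] exI[of _ "min \<epsilon> (\<delta> / \<sigma> ^ m)"] conjI allI impI)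
      show "0 < min \<epsilon> (\<delta> / \<sigma> ^ m)" using G(2) D(2) sg(3) by simp
      fix y assume y: "\<bar>y - x\<bar> < min \<epsilon> (\<delta> / \<sigma> ^ m)"
      then have Gy: "G y = x + \<sigma> ^ m * (y - x)" by (intro G(3)) simp
      have "\<bar>y - x\<bar> * \<sigma> ^ m < \<delta>" using y sg(3) by (simp add: pos_less_divide_eq)
      then have "\<bar>G y - x\<bar> < \<delta>" unfolding Gy using sg(3) by (simp add: abs_mult mult.commute)
      then have "D (G y) = G y + (\<sigma> - 1) * (G y - x)" by (rule D(3))
      then show "D (G y) = x + \<sigma> ^ Suc m * (y - x)" unfolding Gy by (simp add: algebra_simps)
    qed
  qed
  obtain G \<epsilon> where G: "G \<in> Diffeo Circle" "\<epsilon> > 0" "\<And>y. \<bar>y - x\<bar> < \<epsilon> \<Longrightarrow> G y = x + s * (y - x)"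
    using pow[of n] sg(2) by auto
  \<comment> \<open>Then y + \<eta> y equals x + (f y - f x) / s, with derivative 1 at x; composing
    with G and with the translation by f x - x gives back f.\<close>
  define \<eta> where "\<eta> = (\<lambda>y. (f y - f x) * inverse s - (y - x))"
  have sf: "smooth f" by (rule DiffeoD(1)[OF f])
  have "(\<eta> has_real_derivative (deriv f x - 0) * inverse s - (1 - 0)) (at x)" unfolding \<eta>_def
    by (intro DERIV_diff DERIV_cmult_right smooth_DERIV[OF sf] DERIV_const DERIV_ident)
  then have "deriv \<eta> x = 0" using s by (intro DERIV_imp_deriv) (simp add: s_def)
  moreover have "smooth \<eta>" unfolding \<eta>_def by (intro smooth_diff smooth_mult smooth_const smooth_ident sf)
  ultimately obtain g \<epsilon>1 where g: "g \<in> Diffeo Circle" "\<epsilon>1 > 0" "\<And>y. \<bar>y - x\<bar> < \<epsilon>1 \<Longrightarrow> g y = y + \<eta> y"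
    using near[of \<eta>] d by (auto simp: \<eta>_def)
  have gx: "g x = x" using g(2) g(3)[of x] by (simp add: \<eta>_def)
  have "isCont g x" by (rule smooth_isCont[OF DiffeoD(1)[OF g(1)]])
  then obtain \<epsilon>2 where e2: "\<epsilon>2 > 0" "\<And>y. \<bar>y - x\<bar> < \<epsilon>2 \<Longrightarrow> \<bar>g y - x\<bar> < \<epsilon>"
    using G(2) gx unfolding continuous_at_eps_delta dist_real_def by metis
  have c: "(\<lambda>y. G (g y) + (f x - x)) \<in> Diffeo Circle"
    by (rule Diffeo_compose[OF Diffeo_shift Diffeo_compose[OF G(1) g(1)]])
  show ?thesis
  proof (intro bexI[OF _ c] exI[of _ "min \<epsilon>1 \<epsilon>2"] conjI allI impI)
    fix y assume y: "\<bar>y - x\<bar> < min \<epsilon>1 \<epsilon>2"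
    have "G (g y) = x + s * (g y - x)" using y e2(2) by (intro G(3)) simp
    moreover have "g y = y + \<eta> y" using y by (intro g(3)) simp
    then have "g y - x = (f y - f x) * inverse s" by (simp add: \<eta>_def)
    ultimately have "G (g y) = x + (s * inverse s) * (f y - f x)" by (simp add: mult_ac)
    then show "G (g y) + (f x - x) = f y" using s by simp
  qed (use g(2) e2(1) in simp)
qed

text \<open>The scale 8 makes the cutoff 1 within 1/8 of x and 0 beyond 1/4, well inside the
  fundamental interval around x.\<close>

definition periodic_germ :: "real \<Rightarrow> (nat \<Rightarrow> real \<Rightarrow> 'k::real_normed_field) \<Rightarrow> nat \<Rightarrow> real \<Rightarrow> 'k" where
  "periodic_germ x a = (\<lambda>i. periodize x (\<lambda>y. of_real (bump (8 * (y - x))) * a i y))"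

lemma periodic_germ:
  assumes "a \<in> op_coeffs k M"
  shows "periodic_germ x a \<in> op_coeffs k Circle" "\<And>i y. y \<in> ball x (1/8) \<Longrightarrow> periodic_germ x a i y = a i y"
proof -
  have lin: "smooth (\<lambda>y. 8 * (y - x))" by (intro smooth_mult smooth_diff smooth_const smooth_ident)
  define h where "h = (\<lambda>i y. of_real (bump (8 * (y - x))) * a i y)"
  have h: "smooth (h i)" for i unfolding h_def
    by (intro smooth_mult smooth_of_real smooth_compose[OF smooth_bump lin] coeffs_smooth[OF assms])
  have h0: "h i y = 0" if "\<bar>y - x\<bar> \<ge> 1/4" for i y
  proof -
    have "2 \<le> 8 * \<bar>y - x\<bar>" using that by simp
    also have "8 * \<bar>y - x\<bar> = \<bar>8 * (y - x)\<bar>" by (subst abs_mult) simp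
    finally have "bump (8 * (y - x)) = 0" by (rule bump_eq_0)
    then show ?thesis by (simp only: h_def of_real_0 mult_zero_left)
  qed
  have rr: "(0::real) < 1/4" "(1/4::real) < 1/2" by auto
  have e: "periodic_germ x a i = periodize x (h i)" for i by (simp add: periodic_germ_def h_def)
  have "periodic_germ x a i \<in> fn_space Circle" for i
    unfolding e by (rule periodize_fn_space[of "1/4" x "h i", OF h0 rr h])
  moreover have "periodic_germ x a i y = 0" if "i > k" for i y
    using coeffsD(2)[OF assms that] by (simp add: periodic_germ_def periodize_def)
  ultimately show "periodic_germ x a \<in> op_coeffs k Circle" by (auto simp: op_coeffs_def)
  fix i y assume y: "y \<in> ball x (1/8)"
  then have "\<bar>y - x\<bar> < 1/8" by (simp add: dist_real_def abs_minus_commute)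
  then have "periodic_germ x a i y = h i y" unfolding e
    by (intro periodize_eq[of "1/4" x "h i" y, OF h0 rr(2)]) auto
  moreover have "\<bar>8 * (y - x)\<bar> = 8 * \<bar>y - x\<bar>" by (subst abs_mult) simp
  then have "\<bar>8 * (y - x)\<bar> \<le> 1" using \<open>\<bar>y - x\<bar> < 1/8\<close> by simp
  then have "bump (8 * (y - x)) = 1" by (rule bump_eq_1)
  then have "h i y = a i y" by (simp only: h_def of_real_1 mult_1_left)
  ultimately show "periodic_germ x a i y = a i y" by simp
qed

text \<open>Periodicity is invariance under the unit translation, itself a diffeomorphism of the
  line.\<close>

lemma Cend_Line_periodic:
  assumes T: "T \<in> Cend k lam mu Line" and a: "a \<in> op_coeffs k Circle"
  shows "T a \<in> op_coeffs k Circle"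
proof -
  have aL: "a \<in> op_coeffs k Line" by (rule coeffs_mono[OF a])
  have TL: "T a \<in> op_coeffs k Line" by (rule CendD(1)[OF T aL])
  have sh: "cact k lam mu (\<lambda>x. x + 1) b j (x + 1) = b j x" if "b \<in> op_coeffs k Line" for b j x
    by (rule cact_shift[OF Diffeo_shift[of 1 Line] open_UNIV _ _ that]) auto
  have "cact k lam mu (\<lambda>x. x + 1) a j x = a j x" for j x
  proof -
    have "a j (x - 1 + 1) = a j (x - 1)" using coeffsD(1)[OF a, of j] unfolding fn_space_def by blast
    then show ?thesis using sh[OF aL, of j "x - 1"] by simp
  qed
  then have "cact k lam mu (\<lambda>x. x + 1) a = a" by blast
  then have "T a = cact k lam mu (\<lambda>x. x + 1) (T a)" using CendD(4)[OF T Diffeo_shift aL] by metis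
  then have "T a j (x + 1) = T a j x" for j x using sh[OF TL, of j x] by metis
  then show ?thesis using TL by (auto simp: op_coeffs_def fn_space_def)
qed

lemma Cend_restrict:
  assumes T: "T \<in> Cend k lam mu Line"
  shows "restrict T (op_coeffs k Circle) \<in> Cend k lam mu Circle"
proof -
  note L = coeffs_mono
  show ?thesis unfolding Cend_def equiv_end_def
    using Cend_Line_periodic[OF T] CendD(2)[OF T L L] CendD(3)[OF T L] CendD(4)[OF T Diffeo_Line L]
    by (auto simp: cadd_coeffs csmul_coeffs cact_coeffs)
qed

text \<open>By locality T a at x depends only on the germ of a at x, and this germ has a periodic
  representative.\<close>

lemma Cend_restrict_inj:
  "inj_on (\<lambda>T. restrict T (op_coeffs k Circle)) (Cend k lam mu Line)"
proof (rule inj_onI)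
  fix T T' assume T: "T \<in> Cend k lam mu Line" and T': "T' \<in> Cend k lam mu Line"
    and e: "restrict T (op_coeffs k Circle) = restrict T' (op_coeffs k Circle)"
  have "T a j x = T' a j x" if a: "a \<in> op_coeffs k Line" for a j x
  proof -
    note g = periodic_germ[OF a, where x=x]
    have eq: "S a j x = S (periodic_germ x a) j x" if "S \<in> Cend k lam mu Line" for S
      by (rule Cend_local_cong[OF that Cend_local_Line[OF that] a coeffs_mono[OF g(1)] open_ball[of x "1/8"]])
         (use g(2) in auto)
    have "T (periodic_germ x a) = T' (periodic_germ x a)"
      using fun_cong[OF e, of "periodic_germ x a"] g(1) by simp
    then show ?thesis using eq[OF T] eq[OF T'] by simp
  qed
  then have "T a = T' a" if "a \<in> op_coeffs k Line" for a using that by blast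
  moreover have "T \<in> extensional (op_coeffs k Line)" "T' \<in> extensional (op_coeffs k Line)"
    using T T' by (auto simp: Cend_def equiv_end_def)
  ultimately show "T = T'" by (rule extensionalityI[rotated 2])
qed

text \<open>T a at x is read off from S at a periodic extension of the germ of a at x. By locality
  of S any other extension gives the same value (\<open>key\<close>), and smoothness, linearity and
  equivariance all rest on this freedom.\<close>

lemma Cend_extend:
  assumes S: "S \<in> Cend k lam mu Circle" and loc: "Cend_local Circle k S"
  shows "\<exists>T\<in>Cend k lam mu Line. restrict T (op_coeffs k Circle) = S"
proof -
  define T where "T = restrict (\<lambda>a j x. S (periodic_germ x a) j x) (op_coeffs k Line)"
  have key: "T a j x = S b j x"
    if a: "a \<in> op_coeffs k Line" and b: "b \<in> op_coeffs k Circle" "open U" "x \<in> U" "\<And>i y. y \<in> U \<Longrightarrow> b i y = a i y" for a b U j x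
  proof -
    note g = periodic_germ[OF a, where x=x]
    have "S (periodic_germ x a) j x = S b j x"
      by (rule Cend_local_cong[OF S loc g(1) b(1) open_Int[OF open_ball[of x "1/8"] b(2)]])
         (use g(2) b(3,4) in auto)
    then show ?thesis using a by (simp add: T_def)
  qed
  have pg: "T a j y = S (periodic_germ x a) j y" if a: "a \<in> op_coeffs k Line" and y: "y \<in> ball x (1/8)" for a j x y
    by (rule key[OF a periodic_germ(1)[OF a] open_ball y periodic_germ(2)[OF a]])
  have Tc: "T a \<in> op_coeffs k Line" if a: "a \<in> op_coeffs k Line" for a
  proof -
    have Sc: "S (periodic_germ x a) \<in> op_coeffs k Circle" for x by (rule CendD(1)[OF S periodic_germ(1)[OF a]])
    have "smooth (T a j)" for j
    proof (rule smooth_local)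
      fix x
      show "\<exists>g U. open U \<and> x \<in> U \<and> smooth g \<and> (\<forall>y\<in>U. T a j y = g y)"
        by (intro exI[of _ "S (periodic_germ x a) j"] exI[of _ "ball x (1/8)"] conjI ballI pg[OF a]
             coeffs_smooth[OF Sc]) auto
    qed
    moreover have "T a j x = 0" if "j > k" for j x
      using pg[OF a, of x x j] coeffsD(2)[OF Sc that] by simp
    ultimately show ?thesis by (auto simp: op_coeffs_def fn_space_def)
  qed
  have "T \<in> Cend k lam mu Line" unfolding Cend_def equiv_end_def mem_Collect_eq
  proof (intro conjI ballI allI)
    show "T \<in> extensional (op_coeffs k Line)" by (simp add: T_def)
    fix a :: "nat \<Rightarrow> real \<Rightarrow> 'a" assume a: "a \<in> op_coeffs k Line"
    show "T a \<in> op_coeffs k Line" by (rule Tc[OF a])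
    { fix b :: "nat \<Rightarrow> real \<Rightarrow> 'a" assume b: "b \<in> op_coeffs k Line"
      show "T (cadd a b) = cadd (T a) (T b)"
      proof (intro ext)
        fix j x
        note g = periodic_germ[OF a, where x=x] and h = periodic_germ[OF b, where x=x]
        have "T (cadd a b) j x = S (cadd (periodic_germ x a) (periodic_germ x b)) j x"
          by (rule key[OF cadd_coeffs[OF a b] cadd_coeffs[OF g(1) h(1)] open_ball[of x "1/8"]])
             (simp_all add: cadd_def g(2) h(2))
        also have "\<dots> = T a j x + T b j x"
          using CendD(2)[OF S g(1) h(1)] pg[OF a, of x x j] pg[OF b, of x x j] by (simp add: cadd_def)
        finally show "T (cadd a b) j x = cadd (T a) (T b) j x" by (simp add: cadd_def)
      qed }
    { fix c
      show "T (csmul c a) = csmul c (T a)"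
      proof (intro ext)
        fix j x
        note g = periodic_germ[OF a, where x=x]
        have "T (csmul c a) j x = S (csmul c (periodic_germ x a)) j x"
          by (rule key[OF csmul_coeffs[OF a] csmul_coeffs[OF g(1)] open_ball[of x "1/8"]])
             (simp_all add: csmul_def g(2))
        also have "\<dots> = c * T a j x"
          using CendD(3)[OF S g(1)] pg[OF a, of x x j] by (simp add: csmul_def)
        finally show "T (csmul c a) j x = csmul c (T a) j x" by (simp add: csmul_def)
      qed }
    fix f assume f: "f \<in> Diffeo Line"
    show "T (cact k lam mu f a) = cact k lam mu f (T a)"
    proof (intro ext)
      fix j y
      define x where "x = inv f y"
      have y: "y = f x" using DiffeoD(6)[OF f] by (simp add: x_def)
      \<comment> \<open>A circle diffeomorphism with the germ of f at x carries equivariance of S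
        over to T at the single point f x.\<close>
      obtain g \<epsilon> where g: "g \<in> Diffeo Circle" "\<epsilon> > 0" "\<And>z. \<bar>z - x\<bar> < \<epsilon> \<Longrightarrow> g z = f z"
        using circle_germ_extension[OF f] by blast
      note p = periodic_germ[OF a, where x=x]
      define V where "V = ball x (min \<epsilon> (1/8))"
      have V: "open V" "x \<in> V" using g(2) by (auto simp: V_def)
      have gf: "g z = f z" if "z \<in> V" for z
        using that g(3)[of z] by (auto simp: V_def dist_real_def abs_minus_commute)
      define U where "U = {w. inv f w \<in> V}"
      have U: "open U" unfolding U_def vimage_def[symmetric]
        by (rule open_vimage[OF V(1)]) (rule smooth_continuous_on[OF DiffeoD(3)[OF f]])
      have "T (cact k lam mu f a) j y = S (cact k lam mu g (periodic_germ x a)) j y"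
      proof (rule key[OF cact_coeffs[OF a f] cact_coeffs[OF p(1) g(1)] U])
        show "y \<in> U" using V(2) by (simp add: U_def x_def)
        fix i w assume w: "w \<in> U"
        define v where "v = inv f w"
        have v: "v \<in> V" "w = f v" using w DiffeoD(6)[OF f] by (auto simp: U_def v_def)
        have "cact k lam mu g (periodic_germ x a) i (g v) = cact k lam mu f a i (g v)"
          by (rule cact_germ[OF g(1) f V(1) v(1) gf]) (use v(1) p(2) in \<open>auto simp: V_def\<close>)
        then show "cact k lam mu g (periodic_germ x a) i w = cact k lam mu f a i w"
          using gf[OF v(1)] v(2) by simp
      qed
      also have "\<dots> = cact k lam mu g (S (periodic_germ x a)) j (g x)"
        using CendD(4)[OF S g(1) p(1)] gf[OF V(2)] y by simp
      also have "\<dots> = cact k lam mu f (T a) j (g x)"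
        by (rule cact_germ[OF g(1) f V gf]) (use pg[OF a, of x x] in auto)
      finally show "T (cact k lam mu f a) j y = cact k lam mu f (T a) j y"
        using gf[OF V(2)] y by simp
    qed
  qed
  moreover have "restrict T (op_coeffs k Circle) = S"
  proof (rule extensionalityI[where A="op_coeffs k Circle"])
    show "S \<in> extensional (op_coeffs k Circle)" using S by (simp add: Cend_def equiv_end_def)
    fix a :: "nat \<Rightarrow> real \<Rightarrow> 'a" assume a: "a \<in> op_coeffs k Circle"
    have "T a j x = S a j x" for j x by (rule key[OF coeffs_mono[OF a] a open_UNIV]) auto
    then show "restrict T (op_coeffs k Circle) a = S a" using a by auto
  qed simp
  ultimately show ?thesis by blast
qed

lemma Cend_alg_Line_iso_Circle:
  fixes lam mu :: complex
  assumes "(lam, mu) \<noteq> (0, 1)"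
  shows "alg_isomorphic (Cend_alg k lam mu Line) (Cend_alg k lam mu Circle)"
proof -
  define R where "R = (\<lambda>T :: (nat \<Rightarrow> real \<Rightarrow> complex) \<Rightarrow> nat \<Rightarrow> real \<Rightarrow> complex. restrict T (op_coeffs k Circle))"
  have "bij_betw R (Cend k lam mu Line) (Cend k lam mu Circle)"
    unfolding bij_betw_def
  proof
    show "inj_on R (Cend k lam mu Line)" unfolding R_def by (rule Cend_restrict_inj)
    show "R ` Cend k lam mu Line = Cend k lam mu Circle"
      using Cend_restrict Cend_extend[OF _ Cend_local_Circle[OF _ assms]] unfolding R_def by fast
  qed
  moreover have "R (restrict (\<lambda>A. cadd (S A) (T A)) (op_coeffs k Line)) = restrict (\<lambda>A. cadd (R S A) (R T A)) (op_coeffs k Circle)" for S T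
    unfolding R_def by (rule ext) (auto simp: restrict_def coeffs_mono)
  moreover have "R (restrict (\<lambda>A. csmul c (T A)) (op_coeffs k Line)) = restrict (\<lambda>A. csmul c (R T A)) (op_coeffs k Circle)" for c T
    unfolding R_def by (rule ext) (auto simp: restrict_def coeffs_mono)
  moreover have "R (compose (op_coeffs k Line) S T) = compose (op_coeffs k Circle) (R S) (R T)"
    if "T \<in> Cend k lam mu Line" for S T
    unfolding R_def using Cend_Line_periodic[OF that] by (auto simp: compose_def restrict_def coeffs_mono)
  ultimately show ?thesis
    unfolding alg_isomorphic_def Cend_alg_def equiv_end_alg_def Cend_def[symmetric]
    by (intro exI[of _ R]) simp
qed

section \<open>Scalar invariants of endomorphisms in the case (0, 1)\<close>

lemma cact_shift_global:
  assumes "a \<in> op_coeffs k N"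
  shows "cact k lam mu (\<lambda>x. x + c) a j z = a j (z - c)"
  using cact_shift[OF Diffeo_shift[of c Line] open_UNIV UNIV_I refl assms, of lam mu j "z - c"] by simp

lemma cact_scale_global:
  assumes "s > 0" "a \<in> op_coeffs k N"
  shows "cact k lam mu (\<lambda>x. s * x) a j (s * x) = of_real s powr (lam + of_nat j - mu) * a j x"
proof (cases "j \<le> k")
  case True
  have f: "(\<lambda>x. s * x) \<in> Diffeo Line" using Diffeo_affine[OF assms(1), of 0] by simp
  have d: "deriv (\<lambda>x. s * x) x = s" by (rule DERIV_imp_deriv) (auto intro!: derivative_eq_intros)
  have "(\<Sum>i\<le>k. a i x * jet_coeff lam (\<lambda>x. s * x) i j x) = a j x * of_real s powr (lam + of_nat j)"
    using True jet_coeff_affine[OF assms(1), of lam 0] by (simp add: if_distrib cong: if_cong)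
  moreover have "(of_real s :: 'a) powr (lam + of_nat j - mu) = of_real s powr (- mu) * of_real s powr (lam + of_nat j)"
    using powr_of_real_add[OF assms(1), of "- mu" "lam + of_nat j"] by (simp add: algebra_simps)
  ultimately show ?thesis using cact_at[OF f, of k lam mu a j x] True d by simp
qed (use coeffsD(2)[OF assms(2), of j] in \<open>simp add: cact_def\<close>)

type_synonym rcoeffs = "nat \<Rightarrow> real \<Rightarrow> real"

text \<open>The scalar c_i. Evaluation at 0 suffices because T (d^i) has constant coefficients, see
  \<open>Cend_monomial_1\<close>.\<close>

definition eig :: "nat \<Rightarrow> (rcoeffs \<Rightarrow> rcoeffs) \<Rightarrow> real" where
  "eig i T = T (monomial i (\<lambda>x. 1)) i 0"

text \<open>The scalar e: by \<open>Cend_monomial_x\<close> the zeroth coefficient of T (x d) is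
  constant as well.\<close>

definition cross :: "(rcoeffs \<Rightarrow> rcoeffs) \<Rightarrow> real" where
  "cross T = T (monomial 1 (\<lambda>x. x)) 0 0"

lemma monomial_Line: "n \<le> k \<Longrightarrow> smooth q \<Longrightarrow> monomial n q \<in> op_coeffs k Line"
  by (intro monomial_coeffs) (simp_all add: fn_space_def)

lemma Cend_shift:
  assumes T: "T \<in> Cend k lam mu Line" and a: "a \<in> op_coeffs k Line"
  shows "T (\<lambda>j z. a j (z - c)) j z = T a j (z - c)"
proof -
  have "cact k lam mu (\<lambda>x. x + c) a = (\<lambda>j z. a j (z - c))" by (intro ext) (rule cact_shift_global[OF a])
  then show ?thesis
    using CendD(4)[OF T Diffeo_shift a, of c] cact_shift_global[OF CendD(1)[OF T a], of lam mu c j z] by metis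
qed

text \<open>Translations force constant coefficients; the dilation by 2 multiplies coefficient j by
  2^(j - 1), which separates the orders.\<close>

lemma Cend_monomial_1:
  fixes T :: "rcoeffs \<Rightarrow> rcoeffs"
  assumes T: "T \<in> Cend k 0 1 Line" and i: "i \<le> k"
  shows "T (monomial i (\<lambda>x. 1)) j z = (if j = i then eig i T else 0)"
proof -
  define D :: rcoeffs where "D = monomial i (\<lambda>x. 1)"
  have D: "D \<in> op_coeffs k Line" unfolding D_def by (rule monomial_Line[OF i smooth_const])
  have TD: "T D \<in> op_coeffs k Line" by (rule CendD(1)[OF T D])
  have "T D j z = T D j (z - z)" for j z
    using Cend_shift[OF T D, of z j z] by (simp add: D_def monomial_def)
  then have const: "T D j z = T D j 0" for j z by simp
  have f: "(\<lambda>x. 2 * x) \<in> Diffeo Line" using Diffeo_affine[of 2 0] by simp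
  have "cact k 0 1 (\<lambda>x. 2 * x) D = csmul (2 powr (real i - 1)) D"
  proof (intro ext)
    fix j z
    show "cact k 0 1 (\<lambda>x. 2 * x) D j z = csmul (2 powr (real i - 1)) D j z"
      using cact_scale_global[OF _ D, of 2 0 1 j "z/2"] by (simp add: csmul_def D_def monomial_def)
  qed
  then have e: "cact k 0 1 (\<lambda>x. 2 * x) (T D) = csmul (2 powr (real i - 1)) (T D)"
    using CendD(3)[OF T D] CendD(4)[OF T f D] by simp
  have "T D j 0 = 0" if "j \<noteq> i" for j
  proof -
    have "cact k 0 1 (\<lambda>x. 2 * x) (T D) j 0 = 2 powr (real j - 1) * T D j 0"
      using cact_scale_global[OF _ TD, of 2 0 1 j 0] by simp
    then have "2 powr (real j - 1) * T D j 0 = 2 powr (real i - 1) * T D j 0"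
      unfolding e csmul_def by (rule sym)
    moreover have "(2::real) powr (real j - 1) \<noteq> 2 powr (real i - 1)" using that by (simp add: powr_inj)
    ultimately show ?thesis using mult_cancel_right by metis
  qed
  then show ?thesis using const[of j z] by (simp add: eig_def D_def)
qed

text \<open>Translation by c changes x d by -c d, so T (x d) is affine with slope T d. The dilation
  by 2 scales x d by 1/2, which matches the weight 2^(j - 1) of coefficient j at 0 only for j =
  0.\<close>

lemma Cend_monomial_x:
  fixes T :: "rcoeffs \<Rightarrow> rcoeffs"
  assumes T: "T \<in> Cend k 0 1 Line" and k: "1 \<le> k"
  shows "T (monomial 1 (\<lambda>x. x)) j z = (if j = 1 then eig 1 T * z else if j = 0 then cross T else 0)"
proof -
  define D :: rcoeffs where "D = monomial 1 (\<lambda>x. x)"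
  define E :: rcoeffs where "E = monomial 1 (\<lambda>x. 1)"
  have D: "D \<in> op_coeffs k Line" unfolding D_def by (rule monomial_Line[OF k smooth_ident])
  have E: "E \<in> op_coeffs k Line" unfolding E_def by (rule monomial_Line[OF k smooth_const])
  have TD: "T D \<in> op_coeffs k Line" by (rule CendD(1)[OF T D])
  have cE: "(\<lambda>i x. c * E i x) \<in> op_coeffs k Line" for c using csmul_coeffs[OF E] by (simp add: csmul_def)
  have "(\<lambda>j z. D j (z - c)) = (\<lambda>j z. D j z - c * E j z)" for c
    by (auto simp: D_def E_def monomial_def)
  then have sh: "T D j (z - c) = T D j z - c * T E j z" for j z c
    using Cend_shift[OF T D, of c j z] Cend_diff_at[OF T D cE[of c], of j z] Cend_smul_at[OF T E, of c j z] by simp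
  have TE: "T E j z = (if j = 1 then eig 1 T else 0)" for j z
    unfolding E_def by (rule Cend_monomial_1[OF T k])
  have lin: "T D j z = T D j 0 + z * (if j = 1 then eig 1 T else 0)" for j z
    using sh[of j z z] unfolding TE by simp
  have f: "(\<lambda>x. 2 * x) \<in> Diffeo Line" using Diffeo_affine[of 2 0] by simp
  have "cact k 0 1 (\<lambda>x. 2 * x) D = csmul (1/2) D"
  proof (intro ext)
    fix j z
    show "cact k 0 1 (\<lambda>x. 2 * x) D j z = csmul (1/2) D j z"
      using cact_scale_global[OF _ D, of 2 0 1 j "z/2"] by (simp add: csmul_def D_def monomial_def)
  qed
  then have e: "cact k 0 1 (\<lambda>x. 2 * x) (T D) = csmul (1/2) (T D)"
    using CendD(3)[OF T D] CendD(4)[OF T f D] by simp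
  have "T D j 0 = 0" if "j \<noteq> 0" for j
  proof -
    have "cact k 0 1 (\<lambda>x. 2 * x) (T D) j 0 = 2 powr (real j - 1) * T D j 0"
      using cact_scale_global[OF _ TD, of 2 0 1 j 0] by simp
    then have "2 powr (real j - 1) * T D j 0 = (1/2) * T D j 0"
      unfolding e csmul_def by (rule sym)
    moreover have "2 powr (real j - 1) \<ge> 2 powr 0" using that by (intro powr_mono) auto
    ultimately show ?thesis by auto
  qed
  then show ?thesis using lin[of j z] unfolding cross_def D_def[symmetric] by auto
qed

lemma eig_linear:
  assumes "S \<in> Cend k 0 1 Line" "T \<in> Cend k 0 1 Line" "i \<le> k"
  shows "eig i (restrict (\<lambda>A. cadd (S A) (T A)) (op_coeffs k Line)) = eig i S + eig i T"
    "eig i (restrict (\<lambda>A. csmul c (T A)) (op_coeffs k Line)) = c * eig i T"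
    "eig i (compose (op_coeffs k Line) S T) = eig i S * eig i T"
proof -
  have m: "(monomial i (\<lambda>x. 1) :: rcoeffs) \<in> op_coeffs k Line" by (rule monomial_Line[OF assms(3) smooth_const])
  have "T (monomial i (\<lambda>x. 1)) = csmul (eig i T) (monomial i (\<lambda>x. 1))"
    using Cend_monomial_1[OF assms(2,3)] by (auto simp: csmul_def monomial_def fun_eq_iff)
  then have "S (T (monomial i (\<lambda>x. 1))) = csmul (eig i T) (S (monomial i (\<lambda>x. 1)))"
    using CendD(3)[OF assms(1) m] by simp
  then show "eig i (compose (op_coeffs k Line) S T) = eig i S * eig i T"
    using m by (simp add: eig_def compose_def csmul_def)
  show "eig i (restrict (\<lambda>A. cadd (S A) (T A)) (op_coeffs k Line)) = eig i S + eig i T"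
    "eig i (restrict (\<lambda>A. csmul c (T A)) (op_coeffs k Line)) = c * eig i T"
    using m by (simp_all add: eig_def cadd_def csmul_def)
qed

text \<open>The operators x d and 1 span a stable plane, on which T is triangular with diagonal
  entries c_1, c_0 and off-diagonal entry e; the product formula is that of such matrices.\<close>

lemma cross_linear:
  assumes S: "S \<in> Cend k 0 1 Line" and T: "T \<in> Cend k 0 1 Line" and k: "1 \<le> k"
  shows "cross (restrict (\<lambda>A. cadd (S A) (T A)) (op_coeffs k Line)) = cross S + cross T"
    "cross (restrict (\<lambda>A. csmul c (T A)) (op_coeffs k Line)) = c * cross T"
    "cross (compose (op_coeffs k Line) S T) = cross S * eig 1 T + eig 0 S * cross T"
proof -
  define D :: rcoeffs where "D = monomial 1 (\<lambda>x. x)"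
  define E :: rcoeffs where "E = monomial 0 (\<lambda>x. 1)"
  have D: "D \<in> op_coeffs k Line" unfolding D_def by (rule monomial_Line[OF k smooth_ident])
  have E: "E \<in> op_coeffs k Line" unfolding E_def by (rule monomial_Line[OF _ smooth_const]) simp
  show "cross (restrict (\<lambda>A. cadd (S A) (T A)) (op_coeffs k Line)) = cross S + cross T"
    "cross (restrict (\<lambda>A. csmul c (T A)) (op_coeffs k Line)) = c * cross T"
    unfolding cross_def D_def[symmetric] using D by (simp_all add: cadd_def csmul_def)
  have "T D = cadd (csmul (eig 1 T) D) (csmul (cross T) E)"
    using Cend_monomial_x[OF T k] by (auto simp: cadd_def csmul_def D_def E_def monomial_def fun_eq_iff)
  then have "S (T D) = cadd (csmul (eig 1 T) (S D)) (csmul (cross T) (S E))"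
    using CendD(2,3)[OF S] D E csmul_coeffs by metis
  moreover have "S E 0 0 = eig 0 S" by (simp add: eig_def E_def)
  ultimately show "cross (compose (op_coeffs k Line) S T) = cross S * eig 1 T + eig 0 S * cross T"
    unfolding cross_def D_def[symmetric] using D \<open>S E 0 0 = eig 0 S\<close>
    by (simp add: compose_def cadd_def csmul_def cross_def D_def[symmetric] del: One_nat_def)
qed

section \<open>Normal forms of positive symbols\<close>

text \<open>A symbol of order n is a density of weight 1 - n, so for n different from 1 prescribing
  it amounts to prescribing the derivative of \<open>inv f\<close>. Periodicity of a bounds that
  derivative from below and thus makes its primitive onto.\<close>

lemma normal_form_diffeo:
  assumes n: "n \<le> k" "n \<noteq> 1" and a: "a \<in> fn_space Circle" "\<And>y. a y > (0::real)"
  obtains f where "f \<in> Diffeo Line" "\<And>z. deriv (inv f) z = a z powr (1 / (1 - real n))"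
    "\<And>m z. m \<ge> n \<Longrightarrow> cact k 0 1 f (monomial n (\<lambda>x. 1)) m z = (if m = n then a z else 0)"
proof -
  define p where "p = 1 / (1 - real n)"
  define u where "u = (\<lambda>y. a y powr p)"
  have p: "p * (1 - real n) = 1" using n(2) by (simp add: p_def)
  have u: "u \<in> fn_space Circle" unfolding u_def using fn_space_powr[OF a, of p] by simp
  have up: "u y > 0" for y unfolding u_def using a(2)[of y] by simp
  obtain c where c: "c > 0" "\<And>y. c \<le> u y" using fn_space_pos_lower_bound[OF u up] by blast
  obtain g where g: "smooth g" "\<And>y. (g has_real_derivative u y) (at y)"
    using smooth_antiderivative[OF fn_space_smooth[OF u]] by blast
  have dg: "deriv g y = u y" for y using g(2) by (rule DERIV_imp_deriv)
  have gD: "g \<in> Diffeo Line" by (rule DiffeoI[OF g(1) _ c(1)]) (use c(2) dg in auto)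
  define f where "f = inv g"
  have f: "f \<in> Diffeo Line" unfolding f_def by (rule Diffeo_inv[OF gD])
  have fi: "inv f = g" unfolding f_def using DiffeoD(2)[OF gD] by (rule inv_inv_eq)
  have fg: "f (g y) = y" for y unfolding f_def by (rule DiffeoD(5)[OF gD])
  show ?thesis
  proof (rule that[OF f])
    show "deriv (inv f) z = a z powr (1 / (1 - real n))" for z unfolding fi dg u_def p_def ..
    fix m z assume m: "m \<ge> n"
    define U :: rcoeffs where "U = monomial n (\<lambda>x. 1)"
    have U0: "U i y = 0" if "i > n" for i y using that by (simp add: U_def monomial_def)
    show "cact k 0 1 f (monomial n (\<lambda>x. 1)) m z = (if m = n then a z else 0)"
    proof (cases "m = n")
      case True
      have d: "deriv f (g z) = inverse (u z)"
        using deriv_inv_Diffeo[OF gD, of "g z"] fg[of z] dg by (simp add: f_def)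
      have "cact k 0 1 f U n (f (g z)) = of_real (deriv f (g z)) powr (0 + of_nat n - 1) * U n (g z)"
        by (rule cact_leading(2)[OF f _ n(1)]) (rule U0)
      also have "\<dots> = u z powr (1 - real n)"
        unfolding d using up[of z] by (simp add: U_def monomial_def inverse_powr powr_minus[symmetric])
      also have "\<dots> = a z" using a(2)[of z] by (simp add: u_def powr_powr p)
      finally show ?thesis using True by (simp add: fg U_def)
    next
      case False
      have "cact k 0 1 f U m (f (g z)) = 0"
        by (rule cact_leading(1)[OF f _ n(1)]) (use m False U0 in simp_all)
      then show ?thesis using False by (simp add: fg U_def)
    qed
  qed
qed

text \<open>The image of d^n under f has leading coefficient a and further terms of lower order,
  which T kills by hypothesis.\<close>

lemma Cend_normal_form:
  fixes T :: "rcoeffs \<Rightarrow> rcoeffs"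
  assumes T: "T \<in> Cend k 0 1 Line" and n: "n \<le> k" "n \<noteq> 1"
    and IH: "\<And>b. b \<in> op_coeffs k Line \<Longrightarrow> (\<And>m y. m \<ge> n \<Longrightarrow> b m y = 0) \<Longrightarrow> T b = (\<lambda>j y. 0)"
    and a: "a \<in> fn_space Circle" "\<And>y. a y > (0::real)"
  obtains f where "f \<in> Diffeo Line" "\<And>z. deriv (inv f) z = a z powr (1 / (1 - real n))"
    "T (monomial n a) = cact k 0 1 f (csmul (eig n T) (monomial n (\<lambda>x. 1)))"
proof -
  obtain f where f: "f \<in> Diffeo Line" "\<And>z. deriv (inv f) z = a z powr (1 / (1 - real n))"
    "\<And>m z. m \<ge> n \<Longrightarrow> cact k 0 1 f (monomial n (\<lambda>x. 1)) m z = (if m = n then a z else 0)"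
    using normal_form_diffeo[OF n a] by blast
  define U :: rcoeffs where "U = monomial n (\<lambda>x. 1)"
  have U: "U \<in> op_coeffs k Line" unfolding U_def by (rule monomial_Line[OF n(1) smooth_const])
  have fU: "cact k 0 1 f U \<in> op_coeffs k Line" by (rule cact_coeffs[OF U f(1)])
  have Q: "monomial n a \<in> op_coeffs k Line" by (rule monomial_Line[OF n(1) fn_space_smooth[OF a(1)]])
  have "T (csub (cact k 0 1 f U) (monomial n a)) = (\<lambda>j y. 0)"
    by (rule IH[OF csub_coeffs[OF fU Q]]) (use f(3) in \<open>simp add: csub_def U_def monomial_def\<close>)
  then have "T (monomial n a) = T (cact k 0 1 f U)"
    unfolding Cend_csub[OF T fU Q] by (simp add: csub_def fun_eq_iff)
  also have "\<dots> = cact k 0 1 f (T U)" by (rule CendD(4)[OF T f(1) U])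
  also have "T U = csmul (eig n T) U"
    using Cend_monomial_1[OF T n(1)] by (auto simp: csmul_def U_def monomial_def fun_eq_iff)
  finally show ?thesis using that f(1,2) by (simp add: U_def)
qed

lemma cact_zero: "f \<in> Diffeo Line \<Longrightarrow> cact k lam mu f (\<lambda>i x. 0) = (\<lambda>i x. 0)"
  by (simp add: cact_def fun_eq_iff)

section \<open>The scalars of order at least 4\<close>

text \<open>For m = 1 and m = 2 the two numbers coincide, being 2 and 6, so orders 2 and 3 escape
  the argument of \<open>eig_eq_0\<close>. From 20 < 24 on, the left side grows by a factor of at
  most 4, the right side by m + 2.\<close>

lemma central_binomial_less_fact: "m \<ge> 3 \<Longrightarrow> (2 * m) choose m < fact (m + 1)"
proof (induction m rule: dec_induct)
  case base
  show ?case by (simp add: numeral_eq_Suc)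
next
  case (step m)
  have le: "(2 * m) choose i \<le> (2 * m) choose m" for i
    using binomial_maximum[of "2 * m" i] by simp
  obtain m' where m': "m = Suc m'" using step by (cases m) auto
  have "(2 * Suc m) choose Suc m = (((2 * m) choose m') + ((2 * m) choose m)) + (((2 * m) choose m) + ((2 * m) choose (Suc m)))"
    by (simp add: m' numeral_2_eq_2)
  also have "\<dots> \<le> 4 * ((2 * m) choose m)" using le[of m'] le[of "Suc m"] by linarith
  also have "\<dots> < 4 * fact (m + 1)" using step by simp
  also have "\<dots> \<le> (m + 2) * fact (m + 1)" using step by (intro mult_right_mono) auto
  also have "\<dots> = fact (Suc m + 1)" by simp
  finally show ?case .
qed

text \<open>The equation expresses all derivatives through f, so f need not be solved for. At a
  point where f is 1, the n-th derivative is 1 for e = 0 and n! for e = 1.\<close>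

lemma nderiv_of_ODE:
  assumes f: "smooth f" and U: "open U" and ode: "\<And>x. x \<in> U \<Longrightarrow> deriv f x = f x ^ (Suc e)" and x: "x \<in> U"
  shows "nderiv i f x = (\<Prod>l<i. 1 + real (e * l)) * f x ^ (1 + e * i)"
proof -
  have "\<forall>x\<in>U. nderiv i f x = (\<Prod>l<i. 1 + real (e * l)) * f x ^ (1 + e * i)"
  proof (induction i)
    case (Suc i)
    show ?case
    proof
      fix x assume x: "x \<in> U"
      have "nderiv (Suc i) f x = vd (\<lambda>x. (\<Prod>l<i. 1 + real (e * l)) * f x ^ (1 + e * i)) x"
        using vd_local_cong[OF U x, of "nderiv i f" "\<lambda>x. (\<Prod>l<i. 1 + real (e * l)) * f x ^ (1 + e * i)"] Suc by simp
      also have "\<dots> = (\<Prod>l<i. 1 + real (e * l)) * (of_nat (1 + e * i) * (deriv f x * f x ^ (1 + e * i - Suc 0)))"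
        unfolding deriv_eq_vd[symmetric, OF smooth_mult[OF smooth_const smooth_power[OF f]]]
        by (rule DERIV_imp_deriv) (intro DERIV_cmult DERIV_power smooth_DERIV[OF f])
      finally show "nderiv (Suc i) f x = (\<Prod>l<Suc i. 1 + real (e * l)) * f x ^ (1 + e * Suc i)"
        unfolding ode[OF x] by (simp add: power_add mult_ac)
    qed
  qed simp
  then show ?thesis using x by blast
qed

text \<open>If T kills lower orders, its value on y^l d^n applied to the coordinate function is a
  translation covariant functional of y^l, homogeneous of degree l - (n-1). Normal forms for
  y^(n-1) and y^(2(n-1)) evaluate it in two incompatible ways.\<close>
lemma eig_eq_0:
  fixes T :: "rcoeffs \<Rightarrow> rcoeffs"
  assumes T: "T \<in> Cend k 0 1 Line" and n: "n \<le> k" "n \<ge> 4"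
    and IH: "\<And>b. b \<in> op_coeffs k Line \<Longrightarrow> (\<And>m y. m \<ge> n \<Longrightarrow> b m y = 0) \<Longrightarrow> T b = (\<lambda>j y. 0)"
  shows "eig n T = 0"
proof -
  define m where "m = n - 1"
  have m: "m \<ge> 3" "n = m + 1" using n by (auto simp: m_def)
  have n1: "n \<noteq> 1" using n by simp
  define Y :: "nat \<Rightarrow> rcoeffs" where "Y = (\<lambda>l. monomial n (\<lambda>y. y ^ l))"
  have Y: "Y l \<in> op_coeffs k Line" for l unfolding Y_def by (rule monomial_Line[OF n(1)]) (intro smooth_power smooth_ident)
  have TY: "T (Y l) \<in> op_coeffs k Line" for l by (rule CendD(1)[OF T Y])
  \<comment> \<open>The symbol y^((e+1) * m) is brought to normal form by a solution of f' =
    f^(e+1). Tested on the coordinate function at the point 1, its image under T is c_n times the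
    n-th derivative of f.\<close>
  have at1: "T (Y (Suc e * m)) 1 1 = eig n T * (\<Prod>l<n. 1 + real (e * l))" for e
  proof -
    define N where "N = Suc e * m"
    have lin: "smooth (\<lambda>y::real. 8 * (y - 1))" by (intro smooth_mult smooth_diff smooth_const smooth_ident)
    \<comment> \<open>Normal forms require a positive periodic symbol. The function 1 +
      \<open>periodize 1 h\<close> agrees with y^N near 1 and is positive, as a convex combination
      of 1 and a power of a positive number.\<close>
    define h where "h = (\<lambda>y::real. bump (8 * (y - 1)) * (y ^ N - 1))"
    have sh: "smooth h" unfolding h_def
      by (intro smooth_mult smooth_compose[OF smooth_bump lin] smooth_diff smooth_const smooth_power smooth_ident)
    have b0: "bump (8 * (y - 1)) = 0" if "\<bar>y - 1\<bar> \<ge> 1/4" for y :: real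
    proof -
      have "2 \<le> 8 * \<bar>y - 1\<bar>" using that by simp
      also have "8 * \<bar>y - 1\<bar> = \<bar>8 * (y - 1)\<bar>" by (subst abs_mult) simp
      finally show ?thesis by (rule bump_eq_0)
    qed
    have h0: "h y = 0" if "\<bar>y - 1\<bar> \<ge> 1/4" for y using b0[OF that] by (simp add: h_def)
    have rr: "(0::real) < 1/4" "(1/4::real) < 1/2" by auto
    define a where "a = (\<lambda>y. 1 + periodize 1 h y)"
    have a: "a \<in> fn_space Circle" unfolding a_def
      by (intro fn_space_add fn_space_const periodize_fn_space[of "1/4" 1 h, OF h0 rr sh])
    have ap: "a y > 0" for y
    proof -
      have "1 + h z > 0" for z
      proof (cases "\<bar>z - 1\<bar> \<ge> 1/4")
        case False
        then have "z > 0" by (auto simp: abs_if split: if_splits)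
        then have zN: "z ^ N > 0" by simp
        have "1 + h z = (1 - bump (8 * (z - 1))) + bump (8 * (z - 1)) * z ^ N" by (simp add: h_def algebra_simps)
        also have "\<dots> > 0"
        proof (cases "bump (8 * (z - 1)) = 0")
          case False
          then have "bump (8 * (z - 1)) > 0" using bump_range(1)[of "8 * (z - 1)"] by simp
          then have "bump (8 * (z - 1)) * z ^ N > 0" using zN by simp
          then show ?thesis using bump_range(2)[of "8 * (z - 1)"] by linarith
        qed simp
        finally show ?thesis .
      qed (simp add: h0)
      then show ?thesis unfolding a_def periodize_def by blast
    qed
    define V where "V = ball (1::real) (1/8)"
    have V: "open V" "1 \<in> V" by (auto simp: V_def)
    have aV: "a y = y ^ N" "y > 0" if "y \<in> V" for y
    proof -
      have y: "\<bar>y - 1\<bar> < 1/8" using that by (simp add: V_def dist_real_def abs_minus_commute)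
      then show "y > 0" by (auto simp: abs_if split: if_splits)
      have "8 * \<bar>y - 1\<bar> = \<bar>8 * (y - 1)\<bar>" by (subst abs_mult) simp
      then have "\<bar>8 * (y - 1)\<bar> \<le> 1" using y by simp
      then have "bump (8 * (y - 1)) = 1" by (rule bump_eq_1)
      moreover have "periodize 1 h y = h y" by (rule periodize_eq[of "1/4" 1 h y, OF h0 rr(2)]) (use y in linarith)+
      ultimately show "a y = y ^ N" by (simp add: a_def h_def)
    qed
    obtain f where f: "f \<in> Diffeo Line" "\<And>z. deriv (inv f) z = a z powr (1 / (1 - real n))"
      "T (monomial n a) = cact k 0 1 f (csmul (eig n T) (monomial n (\<lambda>x. 1)))"
      using Cend_normal_form[OF T n(1) n1 IH a ap] by blast
    define U where "U = {x. f x \<in> V}"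
    have U: "open U" unfolding U_def vimage_def[symmetric]
      by (rule open_vimage[OF V(1) smooth_continuous_on[OF DiffeoD(1)[OF f(1)]]])
    \<comment> \<open>The exponent is (e+1) * m / (1 - n) = -(e+1), because m = n - 1.\<close>
    have f'V: "deriv (inv f) y = inverse (y ^ Suc e)" if "y \<in> V" for y
    proof -
      have "deriv (inv f) y = (y powr real N) powr (1 / (1 - real n))"
        unfolding f(2) using aV[OF that] by (simp add: powr_realpow)
      also have "\<dots> = y powr (real N * (1 / (1 - real n)))" by (rule powr_powr)
      also have "real N * (1 / (1 - real n)) = - real (Suc e)" using m by (simp add: N_def divide_simps algebra_simps)
      also have "y powr (- real (Suc e)) = inverse (y ^ Suc e)"
        using aV(2)[OF that] by (simp add: powr_minus powr_realpow del: of_nat_Suc)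
      finally show ?thesis .
    qed
    have ode: "deriv f x = f x ^ Suc e" if "x \<in> U" for x
    proof -
      have "f x \<in> V" using that by (simp add: U_def)
      then have "inverse (deriv f x) = inverse (f x ^ Suc e)"
        using f'V deriv_inv_Diffeo[OF f(1), of "f x"] DiffeoD(5)[OF f(1), of x] by simp
      then show ?thesis by (metis inverse_inverse_eq)
    qed
    define x1 where "x1 = inv f 1"
    have x1: "f x1 = 1" "x1 \<in> U" using DiffeoD(6)[OF f(1), of 1] V(2) by (auto simp: x1_def U_def)
    have rho: "rho 0 f (\<lambda>y. y) = f"
      using DiffeoD(4)[OF f(1)] by (auto simp: rho_def fun_eq_iff less_imp_neq[symmetric])
    have "op_at k (T (monomial n a)) (\<lambda>y. y) 1 = rho 1 (inv f) (op_at k (csmul (eig n T) (monomial n (\<lambda>x. 1))) (rho 0 f (\<lambda>y. y))) 1"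
      unfolding f(3) by (rule op_at_cact[OF f(1) smooth_ident])
    also have "\<dots> = op_at k (csmul (eig n T) (monomial n (\<lambda>x. 1))) f x1"
      unfolding rho using f'V[OF V(2)] by (simp add: rho_def x1_def)
    also have "\<dots> = eig n T * nderiv n f x1"
      using n(1) by (simp add: op_at_def csmul_def monomial_def if_distrib if_distribR cong: if_cong)
    also have "nderiv n f x1 = (\<Prod>l<n. 1 + real (e * l))"
      using nderiv_of_ODE[OF DiffeoD(1)[OF f(1)] U ode x1(2), of n] x1(1) by simp
    finally have 1: "op_at k (T (monomial n a)) (\<lambda>y. y) 1 = eig n T * (\<Prod>l<n. 1 + real (e * l))" .
    have nd: "nderiv i (\<lambda>y::real. y) 1 = (if i = 0 \<or> i = 1 then 1 else 0)" for i
    proof (cases i)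
      case (Suc i')
      then show ?thesis using nderiv_vd[of i' "\<lambda>y::real. y"] nderiv_const[of i' "1::real" 1] by simp
    qed simp
    have op: "op_at k b (\<lambda>y. y) 1 = b 0 1 + b 1 1" for b :: rcoeffs
    proof -
      have "op_at k b (\<lambda>y. y) 1 = (\<Sum>i\<in>{0,1}. b i 1)"
        unfolding op_at_def nd by (rule sum.mono_neutral_cong_right) (use n in auto)
      then show ?thesis by simp
    qed
    have "T (monomial n a) j 1 = T (Y N) j 1" for j
      by (rule Cend_local_cong[OF T Cend_local_Line[OF T] monomial_Line[OF n(1) fn_space_smooth[OF a]] Y V])
         (use aV in \<open>auto simp: Y_def monomial_def\<close>)
    \<comment> \<open>The operator kills constants because d^n does, so the test on the coordinate
      function shows the first-order coefficient alone.\<close>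
    moreover have "T (monomial n a) 0 1 = 0"
    proof -
      have r1: "rho 0 f (\<lambda>y. 1) = (\<lambda>y. 1)"
        using DiffeoD(4)[OF f(1)] by (auto simp: rho_def fun_eq_iff less_imp_neq[symmetric])
      have "op_at k (T (monomial n a)) (\<lambda>y. 1) 1 = rho 1 (inv f) (op_at k (csmul (eig n T) (monomial n (\<lambda>x. 1))) (rho 0 f (\<lambda>y. 1))) 1"
        unfolding f(3) by (rule op_at_cact[OF f(1) smooth_const])
      then show ?thesis unfolding r1
        using n by (simp add: op_at_def rho_def csmul_def monomial_def nderiv_const if_distrib if_distribR cong: if_cong)
    qed
    ultimately show ?thesis using 1 unfolding op N_def by simp
  qed
  \<comment> \<open>Under dilation y^l d^n has weight m - l and coefficient j at 0 has weight j - 1;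
    only l + j = m + 1 survives.\<close>
  have scale: "2 powr (real m - real l) * T (Y l) j 0 = 2 powr (real j - 1) * T (Y l) j 0" for l j
  proof -
    have f: "(\<lambda>x. 2 * x) \<in> Diffeo Line" using Diffeo_affine[of 2 0] by simp
    have "cact k 0 1 (\<lambda>x. 2 * x) (Y l) = csmul (2 powr (real m - real l)) (Y l)"
    proof (intro ext)
      fix j z
      have "2 powr (real m - real l) = 2 powr real m / 2 ^ l" by (simp add: powr_diff powr_realpow)
      then show "cact k 0 1 (\<lambda>x. 2 * x) (Y l) j z = csmul (2 powr (real m - real l)) (Y l) j z"
        using cact_scale_global[OF _ Y[of l], of 2 0 1 j "z/2"] by (simp add: csmul_def Y_def monomial_def m power_divide)
    qed
    then have e: "cact k 0 1 (\<lambda>x. 2 * x) (T (Y l)) = csmul (2 powr (real m - real l)) (T (Y l))"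
      using CendD(3)[OF T Y[of l]] CendD(4)[OF T f Y[of l]] by simp
    show ?thesis
      using cact_scale_global[OF _ TY[of l], of 2 0 1 j 0] fun_cong[OF fun_cong[OF e, of j], of 0] by (simp add: csmul_def)
  qed
  have deg: "T (Y l) j 0 = 0" if "l + j \<noteq> m + 1" for l j
  proof -
    have "real m - real l \<noteq> real j - 1" using that by linarith
    then have "(2::real) powr (real m - real l) \<noteq> 2 powr (real j - 1)" by (simp add: powr_inj)
    then show ?thesis using scale[of l j] by simp
  qed
  \<comment> \<open>Translation by -1 turns y^l into (y + 1)^l. For j = 1 the weight count leaves
    only the binomial term i = m.\<close>
  have expand: "T (Y l) j 1 = (\<Sum>i\<le>l. of_nat (l choose i) * T (Y i) j 0)" for l j
  proof -
    have fin: "(\<Sum>i\<in>I. T (Y i) j 0 * w i) = T (\<lambda>p y. \<Sum>i\<in>I. w i * Y i p y) j 0 \<and> (\<lambda>p y. \<Sum>i\<in>I. w i * Y i p y) \<in> op_coeffs k Line"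
      if "finite I" for I w using that
    proof (induction I)
      case empty
      show ?case using Cend_zero[OF T] zero_coeffs by simp
    next
      case (insert i I)
      have c: "(\<lambda>p y. w i * Y i p y) \<in> op_coeffs k Line" using csmul_coeffs[OF Y] by (simp add: csmul_def)
      have "T (\<lambda>p y. w i * Y i p y + (\<Sum>i\<in>I. w i * Y i p y)) j 0 = w i * T (Y i) j 0 + T (\<lambda>p y. \<Sum>i\<in>I. w i * Y i p y) j 0"
        using Cend_add_at[OF T c conjunct2[OF insert.IH]] Cend_smul_at[OF T Y] by simp
      moreover have "(\<lambda>p y. w i * Y i p y + (\<Sum>i\<in>I. w i * Y i p y)) \<in> op_coeffs k Line"
        using cadd_coeffs[OF c conjunct2[OF insert.IH]] by (simp add: cadd_def)
      ultimately show ?case using insert by simp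
    qed
    have "(\<lambda>p z. Y l p (z - (-1))) = (\<lambda>p z. \<Sum>i\<le>l. of_nat (l choose i) * Y i p z)"
    proof (intro ext)
      fix p z
      show "Y l p (z - (-1)) = (\<Sum>i\<le>l. of_nat (l choose i) * Y i p z)"
        using binomial_ring[of z 1 l] by (simp add: Y_def monomial_def)
    qed
    then have "T (Y l) j (0 - (-1)) = T (\<lambda>p z. \<Sum>i\<le>l. of_nat (l choose i) * Y i p z) j 0"
      using Cend_shift[OF T Y, of l "-1" j 0] by simp
    also have "\<dots> = (\<Sum>i\<le>l. T (Y i) j 0 * of_nat (l choose i))" using fin[of "{..l}" "\<lambda>i. of_nat (l choose i)"] by simp
    finally show ?thesis by (simp add: mult.commute)
  qed
  have ex1: "T (Y l) 1 1 = of_nat (l choose m) * T (Y m) 1 0" for l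
  proof -
    have "T (Y l) 1 1 = (\<Sum>i\<le>l. if i = m then of_nat (l choose m) * T (Y m) 1 0 else 0)"
      unfolding expand by (rule sum.cong) (use deg[of _ 1] in auto)
    then show ?thesis by (simp add: binomial_eq_0)
  qed
  \<comment> \<open>Taking l = m identifies this value with c_n; taking l = 2 * m yields (2m choose
    m) * c_n = n! * c_n, which forces c_n = 0.\<close>
  have "T (Y m) 1 0 = eig n T"
    using at1[of 0] ex1[of m] by simp
  moreover have "of_nat ((2 * m) choose m) * T (Y m) 1 0 = eig n T * fact n"
  proof -
    have s: "Suc 1 * m = 2 * m" by simp
    have "(\<Prod>l<n. 1 + real (1 * l)) = fact n"
      by (simp add: fact_prod_Suc lessThan_atLeast0)
    then show ?thesis using at1[of 1] ex1[of "2 * m"] unfolding s by simp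
  qed
  moreover have "real ((2 * m) choose m) < fact n"
    using central_binomial_less_fact[OF m(1)] unfolding m(2) by (metis of_nat_fact of_nat_less_iff)
  ultimately show ?thesis by (metis mult.commute mult_cancel_right less_irrefl)
qed

text \<open>Normal forms reach positive symbols and, for n = 1, increasing ones, as images of x d. A
  small multiple of q added to 1 or to x stays in these classes, and T already kills d^n,
  respectively x d.\<close>

lemma Cend_order_zero_periodic:
  fixes T :: "rcoeffs \<Rightarrow> rcoeffs"
  assumes T: "T \<in> Cend k 0 1 Line" and n: "n \<le> k" and z: "eig n T = 0" "n = 1 \<Longrightarrow> cross T = 0"
    and IH: "\<And>b. b \<in> op_coeffs k Line \<Longrightarrow> (\<And>m y. m \<ge> n \<Longrightarrow> b m y = 0) \<Longrightarrow> T b = (\<lambda>j y. 0)"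
    and q: "q \<in> fn_space Circle"
  shows "T (monomial n q) j x = 0"
proof -
  have sq: "smooth q" by (rule fn_space_smooth[OF q])
  have qL: "monomial n q \<in> op_coeffs k Line" by (rule monomial_Line[OF n sq])
  have eq: "(\<lambda>i y. e * monomial n q i y) \<in> op_coeffs k Line" for e
    using csmul_coeffs[OF qL] by (simp add: csmul_def)
  show ?thesis
  proof (cases "n = 1")
    case False
    obtain B where B: "B > 0" "\<And>y. \<bar>q y\<bar> \<le> B" using fn_space_bounded[OF q] by blast
    define e where "e = 1 / (2 * B)"
    have e: "e > 0" using B by (simp add: e_def)
    define a where "a = (\<lambda>y. 1 + e * q y)"
    have a: "a \<in> fn_space Circle" unfolding a_def by (intro fn_space_add fn_space_mult fn_space_const q)
    have ap: "a y > 0" for y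
    proof -
      have "\<bar>e * q y\<bar> \<le> e * B" unfolding abs_mult using e B(2)[of y] by (intro mult_mono) auto
      also have "\<dots> = 1/2" using B by (simp add: e_def)
      finally show ?thesis by (simp add: a_def abs_le_iff)
    qed
    obtain f where f: "f \<in> Diffeo Line" "T (monomial n a) = cact k 0 1 f (csmul (eig n T) (monomial n (\<lambda>x. 1)))"
      using Cend_normal_form[OF T n False IH a ap] by blast
    have Ta: "T (monomial n a) = (\<lambda>i x. 0)"
      unfolding f(2) z(1) using cact_zero[OF f(1)] by (simp add: csmul_def)
    have one: "(monomial n (\<lambda>x. 1) :: rcoeffs) \<in> op_coeffs k Line" by (rule monomial_Line[OF n smooth_const])
    have "monomial n a = (\<lambda>i y. monomial n (\<lambda>x. 1) i y + e * monomial n q i y)"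
      by (auto simp: monomial_def a_def)
    then have "T (monomial n a) j x = T (monomial n (\<lambda>x. 1)) j x + e * T (monomial n q) j x"
      using Cend_add_at[OF T one eq[of e], of j x] Cend_smul_at[OF T qL, of e j x] by simp
    moreover have "T (monomial n (\<lambda>x. 1)) j x = 0"
      unfolding Cend_monomial_1[OF T n] z(1) by simp
    ultimately show ?thesis using Ta e by simp
  next
    case True
    have k: "1 \<le> k" using n True by simp
    have dq: "deriv q \<in> fn_space Circle"
    proof -
      have "deriv q = vd q" using deriv_eq_vd[OF sq] by blast
      then show ?thesis using fn_space_vd[OF q] by simp
    qed
    obtain B where B: "B > 0" "\<And>y. \<bar>deriv q y\<bar> \<le> B" using fn_space_bounded[OF dq] by blast
    define e where "e = 1 / (2 * B)"
    have e: "e > 0" using B by (simp add: e_def)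
    define g where "g = (\<lambda>y. y + e * q y)"
    have sg: "smooth g" unfolding g_def by (intro smooth_add smooth_ident smooth_mult smooth_const sq)
    have dg: "deriv g y = 1 + e * deriv q y" for y unfolding g_def
      by (rule DERIV_imp_deriv) (intro DERIV_add DERIV_ident DERIV_cmult smooth_DERIV[OF sq])
    have "1/2 \<le> deriv g y" for y
    proof -
      have "\<bar>e * deriv q y\<bar> \<le> e * B" unfolding abs_mult using e B(2)[of y] by (intro mult_mono) auto
      also have "\<dots> = 1/2" using B by (simp add: e_def)
      finally show ?thesis by (simp add: dg abs_le_iff)
    qed
    then have g: "g \<in> Diffeo Line" by (intro DiffeoI[OF sg, of "1/2"]) auto
    define f where "f = inv g"
    have f: "f \<in> Diffeo Line" unfolding f_def by (rule Diffeo_inv[OF g])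
    have fg: "f (g y) = y" for y unfolding f_def by (rule DiffeoD(5)[OF g])
    define D :: rcoeffs where "D = monomial 1 (\<lambda>x. x)"
    have D: "D \<in> op_coeffs k Line" unfolding D_def by (rule monomial_Line[OF k smooth_ident])
    have D0: "D i y = 0" if "i > 1" for i y using that by (simp add: D_def monomial_def)
    have gL: "monomial 1 g \<in> op_coeffs k Line" by (rule monomial_Line[OF k sg])
    have fD: "cact k 0 1 f D \<in> op_coeffs k Line" by (rule cact_coeffs[OF D f])
    have "T (csub (cact k 0 1 f D) (monomial 1 g)) = (\<lambda>j y. 0)"
    proof (rule IH[OF csub_coeffs[OF fD gL]])
      fix m y assume m: "m \<ge> n"
      have "cact k 0 1 f D m (f (g y)) = monomial 1 g m y"
      proof (cases "m = 1")
        case True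
        have "cact k 0 1 f D 1 (f (g y)) = of_real (deriv f (g y)) powr (0 + of_nat 1 - 1) * D 1 (g y)"
          by (rule cact_leading(2)[OF f _ k]) (rule D0)
        then show ?thesis using True DiffeoD(4)[OF f, of "g y"] by (simp add: D_def monomial_def)
      next
        case False
        have "cact k 0 1 f D m (f (g y)) = 0"
          by (rule cact_leading(1)[OF f _ k]) (use D0 m False \<open>n = 1\<close> in simp_all)
        then show ?thesis using False by (simp add: monomial_def)
      qed
      then show "csub (cact k 0 1 f D) (monomial 1 g) m y = 0" by (simp add: csub_def fg)
    qed
    then have "T (monomial 1 g) = T (cact k 0 1 f D)"
      unfolding Cend_csub[OF T fD gL] by (simp add: csub_def fun_eq_iff)
    also have "\<dots> = cact k 0 1 f (T D)" by (rule CendD(4)[OF T f D])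
    also have "T D = (\<lambda>i x. 0)"
      using Cend_monomial_x[OF T k] z True unfolding D_def by (auto simp: fun_eq_iff)
    finally have Tg: "T (monomial 1 g) = (\<lambda>i x. 0)" using cact_zero[OF f] by simp
    have "monomial 1 g = (\<lambda>i y. D i y + e * monomial n q i y)"
      by (auto simp: monomial_def g_def D_def True fun_eq_iff)
    then have "T (monomial 1 g) j x = T D j x + e * T (monomial n q) j x"
      using Cend_add_at[OF T D eq[of e], of j x] Cend_smul_at[OF T qL, of e j x] by simp
    then show ?thesis using Tg \<open>T D = (\<lambda>i x. 0)\<close> e by simp
  qed
qed

text \<open>Strips the leading symbol and descends in the order. Locality first replaces b by a
  periodic family near x, because the perturbation argument needs bounded symbols with bounded
  derivatives.\<close>

lemma Cend_eq_0I:
  fixes T :: "rcoeffs \<Rightarrow> rcoeffs"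
  assumes T: "T \<in> Cend k 0 1 Line" and z: "\<And>i. i \<le> k \<Longrightarrow> i \<le> 3 \<Longrightarrow> eig i T = 0" "cross T = 0"
    and a: "a \<in> op_coeffs k Line"
  shows "T a = (\<lambda>j x. 0)"
proof -
  have main: "T b = (\<lambda>j y. 0)" if "b \<in> op_coeffs k Line" "\<And>m y. m \<ge> n \<Longrightarrow> b m y = 0" for b n
    using that
  proof (induction n arbitrary: b)
    case 0
    then have "b = (\<lambda>i x. 0)" by (auto simp: fun_eq_iff)
    then show ?case using Cend_zero[OF T] by simp
  next
    case (Suc n)
    show ?case
    proof (cases "n \<le> k")
      case False
      then have "b m y = 0" if "m \<ge> n" for m y using coeffsD(2)[OF Suc.prems(1)] that by auto
      then show ?thesis using Suc.IH[OF Suc.prems(1)] by blast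
    next
      case True
      have eigz: "eig n T = 0"
      proof (cases "n \<le> 3")
        case False
        then show ?thesis by (intro eig_eq_0[OF T True _ Suc.IH]) auto
      qed (use z True in simp)
      show ?thesis
      proof (intro ext)
        fix j x
        define p where "p = periodic_germ x b"
        have pC: "p \<in> op_coeffs k Circle" unfolding p_def by (rule periodic_germ(1)[OF Suc.prems(1)])
        have p: "p \<in> op_coeffs k Line" by (rule coeffs_mono[OF pC])
        have p0: "p m y = 0" if "m \<ge> Suc n" for m y
          using Suc.prems(2)[OF that] by (simp add: p_def periodic_germ_def periodize_def)
        have e: "T b j x = T p j x"
          by (rule Cend_local_cong[OF T Cend_local_Line[OF T] Suc.prems(1) p open_ball[of x "1/8"]])
             (use periodic_germ(2)[OF Suc.prems(1), where x=x] in \<open>auto simp: p_def\<close>)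
        have pn: "monomial n (p n) \<in> op_coeffs k Line" by (rule monomial_Line[OF True coeffs_smooth[OF p]])
        have "T (csub p (monomial n (p n))) = (\<lambda>j y. 0)"
          by (rule Suc.IH[OF csub_coeffs[OF p pn]]) (use p0 in \<open>auto simp: csub_def monomial_def\<close>)
        then have "T p j x = T (monomial n (p n)) j x"
          unfolding Cend_csub[OF T p pn] by (simp add: csub_def fun_eq_iff)
        also have "\<dots> = 0"
          by (rule Cend_order_zero_periodic[OF T True eigz z(2) Suc.IH coeffsD(1)[OF pC]])
        finally show "T b j x = 0" using e by simp
      qed
    qed
  qed
  show ?thesis by (rule main[OF a, of "Suc k"]) (use coeffsD(2)[OF a] in simp)
qed

section \<open>The adjoint and the potential\<close>

lemma nderiv_mult:
  fixes f g :: "real \<Rightarrow> real"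
  assumes f: "smooth f" and g: "smooth g"
  shows "nderiv n (\<lambda>x. f x * g x) x = (\<Sum>i\<le>n. real (n choose i) * (nderiv (n - i) f x * nderiv i g x))"
proof (induction n arbitrary: x)
  case (Suc n)
  let ?F = "\<lambda>i. nderiv (Suc n - i) f x * nderiv i g x"
  have "nderiv n (\<lambda>x. f x * g x) = (\<lambda>x. \<Sum>i\<le>n. real (n choose i) * (nderiv (n - i) f x * nderiv i g x))"
    using Suc by blast
  then have "nderiv (Suc n) (\<lambda>x. f x * g x) x
      = vd (\<lambda>x. \<Sum>i\<le>n. real (n choose i) * (nderiv (n - i) f x * nderiv i g x)) x"
    by simp
  also have "\<dots> = (\<Sum>i\<le>n. real (n choose i) * (nderiv (n - i) f x * nderiv (Suc i) g x + nderiv (Suc (n - i)) f x * nderiv i g x))"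
  proof (rule vector_derivative_at, rule has_vector_derivative_sum, rule has_vector_derivative_mult_right)
    fix i
    show "((\<lambda>x. nderiv (n - i) f x * nderiv i g x) has_vector_derivative
        nderiv (n - i) f x * nderiv (Suc i) g x + nderiv (Suc (n - i)) f x * nderiv i g x) (at x)"
      unfolding nderiv.simps
      by (rule has_vector_derivative_mult[OF smooth_has_vector_derivative[OF smooth_nderiv[OF f]]
            smooth_has_vector_derivative[OF smooth_nderiv[OF g]]])
  qed
  also have "\<dots> = (\<Sum>i\<le>n. real (n choose i) * ?F (Suc i)) + (\<Sum>i\<le>n. real (n choose i) * ?F i)"
    by (simp add: distrib_left sum.distrib Suc_diff_le del: nderiv.simps)
  also have "(\<Sum>i\<le>n. real (n choose i) * ?F i) = (\<Sum>i\<le>Suc n. real (n choose i) * ?F i)"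
    by (simp add: binomial_eq_0 del: nderiv.simps)
  also have "\<dots> = ?F 0 + (\<Sum>i\<le>n. real (n choose (Suc i)) * ?F (Suc i))"
    by (subst sum.atMost_Suc_shift) (simp del: nderiv.simps)
  finally have "nderiv (Suc n) (\<lambda>x. f x * g x) x
      = ?F 0 + (\<Sum>i\<le>n. real (Suc n choose Suc i) * ?F (Suc i))"
    by (simp add: sum.distrib[symmetric] distrib_right add_ac del: nderiv.simps)
  also have "\<dots> = (\<Sum>i\<le>Suc n. real (Suc n choose i) * ?F i)"
    by (subst sum.atMost_Suc_shift) (simp del: nderiv.simps binomial_Suc_Suc)
  finally show ?case .
qed simp

text \<open>Integration pairs F_0 with F_1, so the adjoint of an operator from F_0 to F_1 has the
  same type. The formula is the Leibniz expansion of the sum of (-1)^i d^i composed with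
  multiplication by a_i.\<close>

definition formal_adjoint :: "nat \<Rightarrow> rcoeffs \<Rightarrow> rcoeffs" where
  "formal_adjoint k a = (\<lambda>j x. \<Sum>i\<le>k. if j \<le> i then (-1) ^ i * real (i choose j) * nderiv (i - j) (a i) x else 0)"

lemma adjoint_coeffs:
  assumes "a \<in> op_coeffs k Line" shows "formal_adjoint k a \<in> op_coeffs k Line"
proof -
  have "smooth (\<lambda>x. if j \<le> i then (-1) ^ i * real (i choose j) * nderiv (i - j) (a i) x else 0)" for i j
    by (cases "j \<le> i") (auto intro!: smooth_mult smooth_const smooth_nderiv coeffs_smooth[OF assms])
  then have "smooth (formal_adjoint k a j)" for j unfolding formal_adjoint_def by (intro smooth_sum)
  moreover have "formal_adjoint k a j x = 0" if "j > k" for j x unfolding formal_adjoint_def by (rule sum.neutral) (use that in auto)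
  ultimately show ?thesis by (auto simp: op_coeffs_def fn_space_def)
qed

lemma op_at_adjoint:
  assumes a: "a \<in> op_coeffs k Line" and p: "smooth \<psi>"
  shows "op_at k (formal_adjoint k a) \<psi> x = (\<Sum>i\<le>k. (-1) ^ i * nderiv i (\<lambda>x. a i x * \<psi> x) x)"
proof -
  have "op_at k (formal_adjoint k a) \<psi> x = (\<Sum>i\<le>k. \<Sum>j\<le>k. (if j \<le> i then (-1) ^ i * real (i choose j) * nderiv (i - j) (a i) x else 0) * nderiv j \<psi> x)"
    unfolding op_at_def formal_adjoint_def sum_distrib_right by (rule sum.swap)
  also have "\<dots> = (\<Sum>i\<le>k. (-1) ^ i * nderiv i (\<lambda>x. a i x * \<psi> x) x)"
  proof (rule sum.cong[OF refl])
    fix i assume i: "i \<in> {..k}"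
    have "(\<Sum>j\<le>k. (if j \<le> i then (-1) ^ i * real (i choose j) * nderiv (i - j) (a i) x else 0) * nderiv j \<psi> x)
      = (\<Sum>j\<le>i. (-1) ^ i * real (i choose j) * nderiv (i - j) (a i) x * nderiv j \<psi> x)"
      by (rule sum.mono_neutral_cong_right) (use i in auto)
    also have "\<dots> = (-1) ^ i * nderiv i (\<lambda>x. a i x * \<psi> x) x"
      by (simp add: nderiv_mult[OF coeffs_smooth[OF a] p] sum_distrib_left mult.assoc)
    finally show "(\<Sum>j\<le>k. (if j \<le> i then (-1) ^ i * real (i choose j) * nderiv (i - j) (a i) x else 0) * nderiv j \<psi> x)
      = (-1) ^ i * nderiv i (\<lambda>x. a i x * \<psi> x) x" .
  qed
  finally show ?thesis .
qed

section \<open>Pairing with compactly supported functions\<close>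

definition cpt_supp :: "(real \<Rightarrow> real) \<Rightarrow> bool" where
  "cpt_supp u \<longleftrightarrow> (\<exists>R. \<forall>x. \<bar>x\<bar> > R \<longrightarrow> u x = 0)"

text \<open>Exactness stands for vanishing of the integral, so that adjoints need no integration theory.\<close>
definition exact_fn :: "(real \<Rightarrow> real) \<Rightarrow> bool" where
  "exact_fn g \<longleftrightarrow> (\<exists>G. cpt_supp G \<and> (\<forall>x. (G has_real_derivative g x) (at x)))"

lemma cpt_supp_lincomb: "cpt_supp u \<Longrightarrow> cpt_supp v \<Longrightarrow> cpt_supp (\<lambda>x. u x + c * v x)"
  unfolding cpt_supp_def
proof (elim exE)
  fix R S assume "\<forall>x. \<bar>x\<bar> > R \<longrightarrow> u x = 0" "\<forall>x. \<bar>x\<bar> > S \<longrightarrow> v x = 0"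
  then show "\<exists>R. \<forall>x. \<bar>x\<bar> > R \<longrightarrow> u x + c * v x = 0" by (intro exI[of _ "max R S"]) auto
qed

lemma cpt_supp_mult: "cpt_supp u \<Longrightarrow> cpt_supp (\<lambda>x. u x * v x)" "cpt_supp u \<Longrightarrow> cpt_supp (\<lambda>x. v x * u x)"
  unfolding cpt_supp_def by auto

lemma cpt_supp_nderiv:
  assumes "cpt_supp u" shows "cpt_supp (nderiv n u)"
proof -
  obtain R where R: "\<And>x. \<bar>x\<bar> > R \<Longrightarrow> u x = 0" using assms by (auto simp: cpt_supp_def)
  have o: "open {x::real. R < \<bar>x\<bar>}" by (intro open_Collect_less continuous_intros)
  have "nderiv n u x = nderiv n (\<lambda>x. 0) x" if "\<bar>x\<bar> > R" for x
    by (rule nderiv_local_cong[OF o]) (use that R in auto)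
  then show ?thesis unfolding cpt_supp_def by (intro exI[of _ R]) (simp add: nderiv_const)
qed

lemma cpt_supp_compose_Diffeo:
  assumes "cpt_supp u" and f: "f \<in> Diffeo Line"
  shows "cpt_supp (\<lambda>x. u (f x))"
proof -
  obtain R where R: "\<And>x. \<bar>x\<bar> > R \<Longrightarrow> u x = 0" using assms by (auto simp: cpt_supp_def)
  have "compact (inv f ` {-R..R})"
    by (rule compact_continuous_image[OF smooth_continuous_on[OF DiffeoD(3)[OF f]]]) simp
  then obtain B where B: "\<And>y. y \<in> {-R..R} \<Longrightarrow> \<bar>inv f y\<bar> \<le> B"
    using compact_imp_bounded bounded_iff by (metis imageI real_norm_def)
  have "u (f x) = 0" if "\<bar>x\<bar> > B" for x
    using B[of "f x"] R[of "f x"] that DiffeoD(5)[OF f, of x] by (cases "f x \<in> {-R..R}") auto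
  then show ?thesis unfolding cpt_supp_def by blast
qed

lemma exact_fn_lincomb: "exact_fn g \<Longrightarrow> exact_fn h \<Longrightarrow> exact_fn (\<lambda>x. g x + c * h x)"
  unfolding exact_fn_def
proof (elim exE conjE)
  fix G H assume "cpt_supp G" "\<forall>x. (G has_real_derivative g x) (at x)" "cpt_supp H" "\<forall>x. (H has_real_derivative h x) (at x)"
  then show "\<exists>G. cpt_supp G \<and> (\<forall>x. (G has_real_derivative g x + c * h x) (at x))"
    by (intro exI[of _ "\<lambda>x. G x + c * H x"]) (auto intro!: cpt_supp_lincomb DERIV_add DERIV_cmult)
qed

lemma exact_fn_zero: "exact_fn (\<lambda>x. 0)"
  unfolding exact_fn_def by (intro exI[of _ "\<lambda>x. 0"]) (auto simp: cpt_supp_def)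

lemma exact_fn_sum: "(\<And>i. i \<in> I \<Longrightarrow> exact_fn (g i)) \<Longrightarrow> exact_fn (\<lambda>x. \<Sum>i\<in>I. g i x)"
proof (induction I rule: infinite_finite_induct)
  case (insert i I)
  then show ?case using exact_fn_lincomb[of "g i" "\<lambda>x. \<Sum>i\<in>I. g i x" 1] by simp
qed (simp_all add: exact_fn_zero)

lemma exact_fn_compose:
  assumes "exact_fn g" and f: "f \<in> Diffeo Line"
  shows "exact_fn (\<lambda>x. g (f x) * deriv f x)"
proof -
  obtain G where G: "cpt_supp G" "\<And>x. (G has_real_derivative g x) (at x)" using assms(1) by (auto simp: exact_fn_def)
  show ?thesis unfolding exact_fn_def
    using cpt_supp_compose_Diffeo[OF G(1) f] DERIV_chain2[OF G(2) smooth_DERIV[OF DiffeoD(1)[OF f]]] by blast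
qed

text \<open>The primitive is nondecreasing and zero far out on both sides, hence zero. This stands
  in for positivity of the integral.\<close>

lemma exact_fn_nonneg:
  assumes "exact_fn g" "\<And>x. g x \<ge> 0"
  shows "g x = 0"
proof -
  obtain G where G: "cpt_supp G" "\<And>x. (G has_real_derivative g x) (at x)" using assms(1) by (auto simp: exact_fn_def)
  obtain R where R: "\<And>x. \<bar>x\<bar> > R \<Longrightarrow> G x = 0" using G(1) by (auto simp: cpt_supp_def)
  have mono: "G x \<le> G y" if "x \<le> y" for x y
    using DERIV_nonneg_imp_nondecreasing[OF that, of G] G(2) assms(2) by blast
  have "G y = 0" for y
  proof -
    have "G (min y (-\<bar>R\<bar> - 1)) = 0" "G (max y (\<bar>R\<bar> + 1)) = 0" by (rule R, simp add: abs_if min_def max_def; linarith)+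
    moreover have "G (min y (-\<bar>R\<bar> - 1)) \<le> G y" "G y \<le> G (max y (\<bar>R\<bar> + 1))" by (rule mono, simp)+
    ultimately show ?thesis by linarith
  qed
  then have "G = (\<lambda>y. 0)" by blast
  then show ?thesis using G(2)[of x] DERIV_unique[OF _ DERIV_const] by blast
qed

lemma integration_by_parts:
  assumes "smooth u" "cpt_supp u" "smooth \<phi>"
  shows "exact_fn (\<lambda>x. u x * nderiv i \<phi> x - (-1) ^ i * nderiv i u x * \<phi> x)"
  using assms(1,2)
proof (induction i arbitrary: u)
  case 0
  then show ?case using exact_fn_zero by simp
next
  case (Suc i)
  have IH: "exact_fn (\<lambda>x. vd u x * nderiv i \<phi> x - (-1) ^ i * nderiv i (vd u) x * \<phi> x)"
    by (rule Suc.IH[OF smooth_vd[OF Suc.prems(1)]]) (use cpt_supp_nderiv[OF Suc.prems(2), of 1] in simp)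
  have "exact_fn (\<lambda>x. u x * nderiv (Suc i) \<phi> x + vd u x * nderiv i \<phi> x)"
    unfolding exact_fn_def
  proof (intro exI conjI allI)
    show "cpt_supp (\<lambda>x. u x * nderiv i \<phi> x)" by (rule cpt_supp_mult(1)[OF Suc.prems(2)])
    show "((\<lambda>x. u x * nderiv i \<phi> x) has_real_derivative u x * nderiv (Suc i) \<phi> x + vd u x * nderiv i \<phi> x) (at x)" for x
      unfolding has_real_derivative_iff_has_vector_derivative nderiv.simps
      by (rule has_vector_derivative_mult[OF smooth_has_vector_derivative[OF Suc.prems(1)]
            smooth_has_vector_derivative[OF smooth_nderiv[OF assms(3)]]])
  qed
  from exact_fn_lincomb[OF this IH, of "-1"] show ?case
    unfolding nderiv_vd by (simp add: algebra_simps del: nderiv.simps)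
qed

lemma exact_fn_adjoint:
  assumes a: "a \<in> op_coeffs k Line" and "smooth \<psi>" "cpt_supp \<psi>" "smooth \<phi>"
  shows "exact_fn (\<lambda>x. \<psi> x * op_at k a \<phi> x - \<phi> x * op_at k (formal_adjoint k a) \<psi> x)"
proof -
  have "exact_fn (\<lambda>x. \<Sum>i\<le>k. (a i x * \<psi> x) * nderiv i \<phi> x - (-1) ^ i * nderiv i (\<lambda>x. a i x * \<psi> x) x * \<phi> x)"
    by (intro exact_fn_sum integration_by_parts smooth_mult coeffs_smooth[OF a] cpt_supp_mult(2) assms)
  then show ?thesis
    unfolding op_at_adjoint[OF a assms(2)] unfolding op_at_def
    by (simp add: sum_distrib_left sum_subtractf mult_ac)
qed

lemma rho_0: "f \<in> Diffeo Line \<Longrightarrow> rho (0::real) f \<phi> = (\<lambda>x. \<phi> (f x))"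
  using DiffeoD(4)[of f Line] by (auto simp: rho_def fun_eq_iff less_imp_neq[symmetric])

lemma op_at_cact_01:
  fixes a :: rcoeffs
  assumes f: "f \<in> Diffeo Line" and "smooth \<phi>"
  shows "op_at k (cact k 0 1 f a) \<phi> (f x) * deriv f x = op_at k a (\<lambda>x. \<phi> (f x)) x"
proof -
  have "deriv f x > 0" by (rule DiffeoD(4)[OF f])
  then show ?thesis
    unfolding op_at_cact[OF assms] rho_0[OF f]
    by (simp add: rho_def DiffeoD(5)[OF f] deriv_inv_Diffeo[OF f])
qed

lemma smooth_op_at: "a \<in> op_coeffs k M \<Longrightarrow> smooth \<phi> \<Longrightarrow> smooth (op_at k a \<phi>)"
  unfolding op_at_def[abs_def]
  by (rule smooth_sum, rule smooth_mult, erule coeffs_smooth, erule smooth_nderiv)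

text \<open>The pairing is nondegenerate: the difference h of the two candidates, applied to \<psi>,
  is itself used as the test function. After pulling back by f the square of h times f' becomes
  exact, hence h = 0.\<close>

lemma adjoint_cact:
  assumes a: "a \<in> op_coeffs k Line" and f: "f \<in> Diffeo Line"
  shows "formal_adjoint k (cact k 0 1 f a) = cact k 0 1 f (formal_adjoint k a)"
proof -
  define b where "b = cact k 0 1 f a"
  define c where "c = cact k 0 1 f (formal_adjoint k a)"
  have sf: "smooth f" by (rule DiffeoD(1)[OF f])
  have b: "b \<in> op_coeffs k Line" unfolding b_def by (rule cact_coeffs[OF a f])
  have ab: "formal_adjoint k b \<in> op_coeffs k Line" by (rule adjoint_coeffs[OF b])
  have c: "c \<in> op_coeffs k Line" unfolding c_def by (rule cact_coeffs[OF adjoint_coeffs[OF a] f])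
  have eq: "op_at k (formal_adjoint k b) \<psi> y = op_at k c \<psi> y" if psi: "smooth \<psi>" "cpt_supp \<psi>" for \<psi> y
  proof -
    define h where "h = (\<lambda>y. op_at k (formal_adjoint k b) \<psi> y - op_at k c \<psi> y)"
    have h: "smooth h" unfolding h_def by (intro smooth_diff smooth_op_at[OF ab] smooth_op_at[OF c] psi)
    have psif: "smooth (\<lambda>x. \<psi> (f x))" "cpt_supp (\<lambda>x. \<psi> (f x))" "smooth (\<lambda>x. h (f x))"
      using smooth_compose[OF psi(1) sf] cpt_supp_compose_Diffeo[OF psi(2) f] smooth_compose[OF h sf] by auto
    have E1: "exact_fn (\<lambda>x. (\<psi> (f x) * op_at k b h (f x) - h (f x) * op_at k (formal_adjoint k b) \<psi> (f x)) * deriv f x)"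
      by (rule exact_fn_compose[OF exact_fn_adjoint[OF b psi h] f])
    have E2: "exact_fn (\<lambda>x. \<psi> (f x) * op_at k a (\<lambda>x. h (f x)) x - h (f x) * op_at k (formal_adjoint k a) (\<lambda>x. \<psi> (f x)) x)"
      by (rule exact_fn_adjoint[OF a psif])
    have "(\<psi> (f x) * op_at k a (\<lambda>x. h (f x)) x - h (f x) * op_at k (formal_adjoint k a) (\<lambda>x. \<psi> (f x)) x)
        + (-1) * ((\<psi> (f x) * op_at k b h (f x) - h (f x) * op_at k (formal_adjoint k b) \<psi> (f x)) * deriv f x)
        = (h (f x))\<^sup>2 * deriv f x" for x
      unfolding op_at_cact_01[OF f h, symmetric] op_at_cact_01[OF f psi(1), symmetric]
      by (simp add: b_def[symmetric] c_def[symmetric] h_def algebra_simps power2_eq_square)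
    with exact_fn_lincomb[OF E2 E1, of "-1"] have "exact_fn (\<lambda>x. (h (f x))\<^sup>2 * deriv f x)" by simp
    then have "(h (f x))\<^sup>2 * deriv f x = 0" for x
      by (rule exact_fn_nonneg) (use DiffeoD(4)[OF f] in \<open>simp add: less_imp_le\<close>)
    from this[of "inv f y"] have "h y = 0"
      using DiffeoD(4)[OF f, of "inv f y"] DiffeoD(6)[OF f, of y] by simp
    then show ?thesis by (simp add: h_def)
  qed
  have "formal_adjoint k b j y = c j y" if j: "j \<le> k" for j y
  proof (rule coeff_eqI[of Line k "formal_adjoint k b" y c j, OF _ j])
    fix \<phi> :: "real \<Rightarrow> real" assume "\<phi> \<in> fn_space Line"
    then have phi: "smooth \<phi>" by (rule fn_space_smooth)
    \<comment> \<open>Operators at y see only the germ of \<phi>, so \<phi> may be replaced by a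
      compactly supported function.\<close>
    define \<psi> where "\<psi> = (\<lambda>x. bump (x + (- y)) * \<phi> x)"
    have "smooth \<psi>" unfolding \<psi>_def
      by (intro smooth_mult phi smooth_compose[OF smooth_bump smooth_add[OF smooth_ident smooth_const]])
    moreover have "cpt_supp \<psi>" unfolding cpt_supp_def \<psi>_def
      by (rule exI[of _ "\<bar>y\<bar> + 2"]) (auto simp: bump_eq_0)
    moreover have "\<psi> x = \<phi> x" if "x \<in> ball y 1" for x
      using that by (simp add: \<psi>_def bump_eq_1 dist_real_def abs_minus_commute)
    ultimately show "op_at k (formal_adjoint k b) \<phi> y = op_at k c \<phi> y"
      using eq[of \<psi> y] op_at_local_cong[OF open_ball, of y y 1 \<phi> \<psi> k] by simp
  qed
  then have "formal_adjoint k b j y = c j y" for j y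
    using coeffsD(2)[OF ab, of j y] coeffsD(2)[OF c, of j y] by (cases "j \<le> k") auto
  then show ?thesis by (simp add: b_def c_def fun_eq_iff)
qed

section \<open>Generators of the algebra in the case (0, 1)\<close>

lemma cact_linear:
  assumes "f \<in> Diffeo Line"
  shows "cact k lam mu f (cadd a b) = cadd (cact k lam mu f a) (cact k lam mu f b)"
    "cact k lam mu f (csmul c a) = csmul c (cact k lam mu f a)"
  by (auto simp: cact_def cadd_def csmul_def fun_eq_iff distrib_right distrib_left sum.distrib sum_distrib_left mult_ac)

lemma CendI:
  fixes T :: "rcoeffs \<Rightarrow> rcoeffs"
  assumes "\<And>a. a \<in> op_coeffs k Line \<Longrightarrow> T a \<in> op_coeffs k Line"
    "\<And>a b. a \<in> op_coeffs k Line \<Longrightarrow> b \<in> op_coeffs k Line \<Longrightarrow> T (cadd a b) = cadd (T a) (T b)"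
    "\<And>a c. a \<in> op_coeffs k Line \<Longrightarrow> T (csmul c a) = csmul c (T a)"
    "\<And>a f. a \<in> op_coeffs k Line \<Longrightarrow> f \<in> Diffeo Line \<Longrightarrow> T (cact k 0 1 f a) = cact k 0 1 f (T a)"
  shows "restrict T (op_coeffs k Line) \<in> Cend k 0 1 Line"
  using assms unfolding Cend_def equiv_end_def
  by (simp add: cadd_coeffs csmul_coeffs cact_coeffs)

lemma Cend_add:
  assumes "S \<in> Cend k 0 1 Line" "T \<in> Cend k 0 1 Line"
  shows "restrict (\<lambda>A. cadd (S A) (T A)) (op_coeffs k Line) \<in> Cend k (0::real) 1 Line"
proof (rule CendI)
  fix a b :: rcoeffs assume a: "a \<in> op_coeffs k Line"
  show "cadd (S a) (T a) \<in> op_coeffs k Line"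
    by (rule cadd_coeffs[OF CendD(1)[OF assms(1) a] CendD(1)[OF assms(2) a]])
  show "cadd (S (csmul c a)) (T (csmul c a)) = csmul c (cadd (S a) (T a))" for c
    by (simp add: CendD(3)[OF assms(1) a] CendD(3)[OF assms(2) a]) (simp add: cadd_def csmul_def distrib_left)
  show "cadd (S (cact k 0 1 f a)) (T (cact k 0 1 f a)) = cact k 0 1 f (cadd (S a) (T a))" if "f \<in> Diffeo Line" for f
    by (simp add: CendD(4)[OF assms(1) that a] CendD(4)[OF assms(2) that a] cact_linear[OF that])
  assume b: "b \<in> op_coeffs k Line"
  show "cadd (S (cadd a b)) (T (cadd a b)) = cadd (cadd (S a) (T a)) (cadd (S b) (T b))"
    by (simp add: CendD(2)[OF assms(1) a b] CendD(2)[OF assms(2) a b]) (simp add: cadd_def add_ac)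
qed

lemma Cend_smul:
  assumes "T \<in> Cend k 0 1 Line"
  shows "restrict (\<lambda>A. csmul d (T A)) (op_coeffs k Line) \<in> Cend k (0::real) 1 Line"
proof (rule CendI)
  fix a b :: rcoeffs assume a: "a \<in> op_coeffs k Line"
  show "csmul d (T a) \<in> op_coeffs k Line" by (rule csmul_coeffs[OF CendD(1)[OF assms a]])
  show "csmul d (T (csmul c a)) = csmul c (csmul d (T a))" for c
    by (simp add: CendD(3)[OF assms a]) (simp add: csmul_def mult_ac)
  show "csmul d (T (cact k 0 1 f a)) = cact k 0 1 f (csmul d (T a))" if "f \<in> Diffeo Line" for f
    by (simp add: CendD(4)[OF assms that a] cact_linear[OF that])
  assume b: "b \<in> op_coeffs k Line"
  show "csmul d (T (cadd a b)) = cadd (csmul d (T a)) (csmul d (T b))"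
    by (simp add: CendD(2)[OF assms a b]) (simp add: cadd_def csmul_def distrib_left)
qed

text \<open>For lam = 0 constant functions are invariant, so no higher coefficient is mixed into the
  zeroth one.\<close>

lemma jet_coeff_0:
  assumes f: "f \<in> Diffeo Line"
  shows "jet_coeff (0::real) f i 0 = (\<lambda>x. if i = 0 then 1 else 0)"
proof (induction i)
  case 0
  show ?case using DiffeoD(4)[OF f] by (auto simp: fun_eq_iff less_imp_neq[symmetric])
next
  case (Suc i)
  then show ?case by (cases "i = 0") (simp_all add: Suc fun_eq_iff)
qed

lemma cact_01_at_0:
  fixes a :: rcoeffs
  assumes f: "f \<in> Diffeo Line"
  shows "cact k 0 1 f a 0 (f x) = a 0 x / deriv f x"
proof -
  have "(\<Sum>i\<le>k. a i x * jet_coeff 0 f i 0 x) = a 0 x"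
    unfolding jet_coeff_0[OF f] by (simp add: if_distrib cong: if_cong)
  then show ?thesis
    using cact_at[OF f, of k 0 1 a 0 x] DiffeoD(4)[OF f, of x] by (simp add: powr_minus divide_inverse)
qed

lemma cact_01_monomial_0:
  fixes q :: "real \<Rightarrow> real"
  assumes f: "f \<in> Diffeo Line"
  shows "cact k 0 1 f (monomial 0 q) = monomial 0 (\<lambda>y. q (inv f y) * deriv (inv f) y)"
proof (intro ext)
  fix j :: nat and y
  have y: "f (inv f y) = y" by (rule DiffeoD(6)[OF f])
  show "cact k 0 1 f (monomial 0 q) j y = monomial 0 (\<lambda>y. q (inv f y) * deriv (inv f) y) j y"
  proof (cases "j = 0")
    case True
    then show ?thesis
      using cact_01_at_0[OF f, of k "monomial 0 q" "inv f y"] deriv_inv_Diffeo[OF f, of y] y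
      by (simp add: monomial_def divide_inverse)
  next
    case False
    have "cact k 0 1 f (monomial 0 q) j (f (inv f y)) = 0"
      by (rule cact_leading(1)[OF f, of 0]) (use False in \<open>simp_all add: monomial_def\<close>)
    then show ?thesis using False by (simp add: y monomial_def)
  qed
qed

lemma cact_01_monomial_1:
  fixes q :: "real \<Rightarrow> real"
  assumes f: "f \<in> Diffeo Line" and k: "1 \<le> k"
  shows "cact k 0 1 f (monomial 1 q) = monomial 1 (\<lambda>y. q (inv f y))"
proof (intro ext)
  fix j :: nat and y
  have y: "f (inv f y) = y" by (rule DiffeoD(6)[OF f])
  have q0: "(monomial 1 q :: rcoeffs) i x = 0" if "i > 1" for i x using that by (simp add: monomial_def)
  consider "j = 0" | "j = 1" | "j > 1" by atomize_elim arith
  then show "cact k 0 1 f (monomial 1 q) j y = monomial 1 (\<lambda>y. q (inv f y)) j y"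
  proof cases
    case 1
    then show ?thesis using cact_01_at_0[OF f, of k "monomial 1 q" "inv f y"] y by (simp add: monomial_def)
  next
    case 2
    have "cact k 0 1 f (monomial 1 q) 1 (f (inv f y)) = of_real (deriv f (inv f y)) powr (0 + of_nat 1 - 1) * monomial 1 q 1 (inv f y)"
      by (rule cact_leading(2)[OF f _ k]) (rule q0)
    then show ?thesis using 2 DiffeoD(4)[OF f, of "inv f y"] by (simp add: y monomial_def)
  next
    case 3
    have "cact k 0 1 f (monomial 1 q) j (f (inv f y)) = 0"
      by (rule cact_leading(1)[OF f _ k]) (use q0 3 in simp_all)
    then show ?thesis using 3 by (simp add: y monomial_def)
  qed
qed

section \<open>The potential and its equivariance\<close>

text \<open>A primitive of A(1) - A*(1), obtained by removing one derivative from each term with i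
  \<ge> 1. The closed formula settles the constant of integration, as equivariance demands.\<close>

definition potential :: "nat \<Rightarrow> rcoeffs \<Rightarrow> real \<Rightarrow> real" where
  "potential k a x = (\<Sum>i\<in>{1..k}. (-1) ^ (i - 1) * nderiv (i - 1) (a i) x)"

definition divergence :: "nat \<Rightarrow> rcoeffs \<Rightarrow> real \<Rightarrow> real" where
  "divergence k a x = a 0 x - formal_adjoint k a 0 x"

lemma smooth_potential: "a \<in> op_coeffs k Line \<Longrightarrow> smooth (potential k a)"
  unfolding potential_def[abs_def] by (intro smooth_sum smooth_mult smooth_const smooth_nderiv coeffs_smooth)

lemma potential_deriv:
  assumes a: "a \<in> op_coeffs k Line"
  shows "(potential k a has_real_derivative divergence k a x) (at x)"
proof -
  have "(potential k a has_real_derivative (\<Sum>i\<in>{1..k}. (-1) ^ (i - 1) * nderiv i (a i) x)) (at x)"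
    unfolding potential_def[abs_def]
  proof (rule DERIV_sum, rule DERIV_cmult)
    fix i assume i: "i \<in> {1..k}"
    then have "nderiv i (a i) x = vd (nderiv (i - 1) (a i)) x" by (cases i) auto
    then show "(nderiv (i - 1) (a i) has_real_derivative nderiv i (a i) x) (at x)"
      using smooth_has_vector_derivative[OF smooth_nderiv[OF coeffs_smooth[OF a]]]
      by (simp add: has_real_derivative_iff_has_vector_derivative)
  qed
  moreover have "divergence k a x = (\<Sum>i\<in>{1..k}. (-1) ^ (i - 1) * nderiv i (a i) x)"
  proof -
    have "formal_adjoint k a 0 x = (\<Sum>i\<le>k. (-1) ^ i * nderiv i (a i) x)" by (simp add: formal_adjoint_def)
    also have "\<dots> = a 0 x + (\<Sum>i\<in>{1..k}. (-1) ^ i * nderiv i (a i) x)"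
      by (simp add: atMost_atLeast0 sum.atLeast_Suc_atMost)
    also have "(\<Sum>i\<in>{1..k}. (-1) ^ i * nderiv i (a i) x) = - (\<Sum>i\<in>{1..k}. (-1) ^ (i - 1) * nderiv i (a i) x)"
      unfolding sum_negf[symmetric]
    proof (rule sum.cong[OF refl])
      fix i assume "i \<in> {1..k}"
      then show "(-1) ^ i * nderiv i (a i) x = - ((-1) ^ (i - 1) * nderiv i (a i) x)" by (cases i) auto
    qed
    finally show ?thesis by (simp add: divergence_def)
  qed
  ultimately show ?thesis by simp
qed

lemma potential_linear:
  assumes "a \<in> op_coeffs k Line" "b \<in> op_coeffs k Line"
  shows "potential k (cadd a b) x = potential k a x + potential k b x"
    "potential k (csmul c a) x = c * potential k a x"
  using nderiv_add[OF coeffs_smooth[OF assms(1)] coeffs_smooth[OF assms(2)]] nderiv_cmult[OF coeffs_smooth[OF assms(1)]]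
  by (simp_all add: potential_def cadd_def csmul_def sum.distrib distrib_left sum_distrib_left mult_ac)

lemma adjoint_linear:
  assumes "a \<in> op_coeffs k Line" "b \<in> op_coeffs k Line"
  shows "formal_adjoint k (cadd a b) = cadd (formal_adjoint k a) (formal_adjoint k b)"
    "formal_adjoint k (csmul c a) = csmul c (formal_adjoint k a)"
  using nderiv_add[OF coeffs_smooth[OF assms(1)] coeffs_smooth[OF assms(2)]] nderiv_cmult[OF coeffs_smooth[OF assms(1)]]
  by (auto simp: formal_adjoint_def cadd_def csmul_def fun_eq_iff sum.distrib[symmetric] distrib_left sum_distrib_left mult_ac
      intro!: sum.cong)

text \<open>A(1) and A*(1) are both 1-densities, the latter by equivariance of the adjoint.\<close>

lemma divergence_cact:
  assumes a: "a \<in> op_coeffs k Line" and f: "f \<in> Diffeo Line"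
  shows "divergence k (cact k 0 1 f a) (f x) = divergence k a x / deriv f x"
  by (simp add: divergence_def adjoint_cact[OF a f] cact_01_at_0[OF f] diff_divide_distrib)

lemma potential_zero:
  assumes "open U" "x \<in> U" "\<And>i y. y \<in> U \<Longrightarrow> a i y = 0"
  shows "potential k a x = 0"
proof -
  have "nderiv n (a i) x = 0" for n i
    using nderiv_local_cong[OF assms(1,2), of "a i" "\<lambda>x. 0" n] assms(3) by (simp add: nderiv_const)
  then show ?thesis by (simp add: potential_def)
qed

text \<open>The two potentials differ by a constant, which vanishes when a does on some open set.\<close>
lemma potential_cact_aux:
  assumes a: "a \<in> op_coeffs k Line" and f: "f \<in> Diffeo Line"
    and U: "open U" "x1 \<in> U" "\<And>i y. y \<in> U \<Longrightarrow> a i y = 0"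
  shows "potential k (cact k 0 1 f a) (f x) = potential k a x"
proof -
  have fa: "cact k 0 1 f a \<in> op_coeffs k Line" by (rule cact_coeffs[OF a f])
  have "\<exists>c. \<forall>x\<in>UNIV. potential k (cact k 0 1 f a) (f x) - potential k a x = c"
  proof (rule has_field_derivative_zero_constant)
    fix x
    have "((\<lambda>x. potential k (cact k 0 1 f a) (f x) - potential k a x) has_real_derivative
        divergence k (cact k 0 1 f a) (f x) * deriv f x - divergence k a x) (at x)"
      by (rule DERIV_diff[OF DERIV_chain2[OF potential_deriv[OF fa] smooth_DERIV[OF DiffeoD(1)[OF f]]] potential_deriv[OF a]])
    then show "((\<lambda>x. potential k (cact k 0 1 f a) (f x) - potential k a x) has_real_derivative 0) (at x within UNIV)"
      using DiffeoD(4)[OF f, of x] by (simp add: divergence_cact[OF a f])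
  qed simp
  then obtain c where c: "\<And>x. potential k (cact k 0 1 f a) (f x) - potential k a x = c" by blast
  define V where "V = {y. inv f y \<in> U}"
  have V: "open V" unfolding V_def vimage_def[symmetric]
    by (rule open_vimage[OF U(1) smooth_continuous_on[OF DiffeoD(3)[OF f]]])
  have "potential k (cact k 0 1 f a) (f x1) = 0"
  proof (rule potential_zero[OF V])
    show "f x1 \<in> V" using U(2) by (simp add: V_def DiffeoD(5)[OF f])
    fix i y assume "y \<in> V"
    then have "cact k 0 1 f a i (f (inv f y)) = 0" by (intro cact_zero_at[OF f] U(3)) (simp add: V_def)
    then show "cact k 0 1 f a i y = 0" by (simp add: DiffeoD(6)[OF f])
  qed
  moreover have "potential k a x1 = 0" by (rule potential_zero[OF U])
  ultimately have "c = 0" using c[of x1] by simp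
  then show ?thesis using c[of x] by simp
qed

text \<open>A general a need not vanish on any open set, so \<open>step_fn\<close> cuts it into two
  summands, each zero on a half-line.\<close>

lemma potential_cact:
  assumes a: "a \<in> op_coeffs k Line" and f: "f \<in> Diffeo Line"
  shows "potential k (cact k 0 1 f a) (f x) = potential k a x"
proof -
  define l where "l = (\<lambda>i x. (1 - step_fn x) * a i x)"
  define r where "r = (\<lambda>i x. step_fn x * a i x)"
  have l: "l \<in> op_coeffs k Line" and r: "r \<in> op_coeffs k Line"
    using coeffsD(2)[OF a] coeffs_smooth[OF a]
    by (auto simp: op_coeffs_def fn_space_def l_def r_def intro!: smooth_mult smooth_diff smooth_const smooth_step_fn)
  have al: "a = cadd l r" by (simp add: cadd_def l_def r_def fun_eq_iff algebra_simps)
  have "potential k (cact k 0 1 f l) (f x) = potential k l x"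
    by (rule potential_cact_aux[OF l f, of "{1<..}" 2]) (auto simp: l_def step_fn_eq_1)
  moreover have "potential k (cact k 0 1 f r) (f x) = potential k r x"
    by (rule potential_cact_aux[OF r f, of "{..<0}" "-1"]) (auto simp: r_def step_fn_eq_0)
  ultimately show ?thesis
    unfolding al cact_linear[OF f] potential_linear(1)[OF l r]
      potential_linear(1)[OF cact_coeffs[OF l f] cact_coeffs[OF r f]] by simp
qed

section \<open>The five generators and their scalars\<close>

definition "end_id k = restrict (\<lambda>a :: rcoeffs. a) (op_coeffs k Line)"
definition "end_adj k = restrict (formal_adjoint k) (op_coeffs k Line)"
definition "end_0 k = restrict (\<lambda>a :: rcoeffs. (monomial 0 (a 0) :: rcoeffs)) (op_coeffs k Line)"
definition "end_pot k = restrict (\<lambda>a. (monomial 1 (potential k a) :: rcoeffs)) (op_coeffs k Line)"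
definition "end_div k = restrict (\<lambda>a. (monomial 0 (divergence k a) :: rcoeffs)) (op_coeffs k Line)"

lemma end_id_Cend: "end_id k \<in> Cend k 0 1 Line"
  unfolding end_id_def by (rule CendI) auto

lemma end_adj_Cend: "end_adj k \<in> Cend k 0 1 Line"
  unfolding end_adj_def by (rule CendI) (auto simp: adjoint_coeffs adjoint_linear adjoint_cact)

lemma end_0_Cend: "end_0 k \<in> Cend k 0 1 Line"
  unfolding end_0_def
proof (rule CendI)
  fix a :: rcoeffs and f assume a: "a \<in> op_coeffs k Line"
  show "monomial 0 (a 0) \<in> op_coeffs k Line" by (rule monomial_Line[OF _ coeffs_smooth[OF a]]) simp
  assume f: "f \<in> Diffeo Line"
  have "cact k 0 1 f a 0 y = a 0 (inv f y) * deriv (inv f) y" for y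
    using cact_01_at_0[OF f, of k a "inv f y"] deriv_inv_Diffeo[OF f, of y]
    by (simp add: DiffeoD(6)[OF f] divide_inverse)
  then show "monomial 0 (cact k 0 1 f a 0) = cact k 0 1 f (monomial 0 (a 0))"
    unfolding cact_01_monomial_0[OF f] by (simp add: monomial_def fun_eq_iff)
qed (auto simp: monomial_def cadd_def csmul_def fun_eq_iff)

lemma end_pot_Cend: assumes k: "1 \<le> k" shows "end_pot k \<in> Cend k 0 1 Line"
  unfolding end_pot_def
proof (rule CendI)
  fix a :: rcoeffs and f assume a: "a \<in> op_coeffs k Line"
  show "monomial 1 (potential k a) \<in> op_coeffs k Line" by (rule monomial_Line[OF k smooth_potential[OF a]])
  assume f: "f \<in> Diffeo Line"
  have "potential k (cact k 0 1 f a) y = potential k a (inv f y)" for y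
    using potential_cact[OF a f, of "inv f y"] by (simp add: DiffeoD(6)[OF f])
  then show "monomial 1 (potential k (cact k 0 1 f a)) = cact k 0 1 f (monomial 1 (potential k a))"
    unfolding cact_01_monomial_1[OF f k] by (simp add: monomial_def fun_eq_iff)
qed (auto simp: monomial_def cadd_def csmul_def fun_eq_iff potential_linear[unfolded cadd_def csmul_def])

lemma end_div_Cend: "end_div k \<in> Cend k 0 1 Line"
  unfolding end_div_def
proof (rule CendI)
  fix a :: rcoeffs and f assume a: "a \<in> op_coeffs k Line"
  have "smooth (divergence k a)"
    unfolding divergence_def[abs_def] by (intro smooth_diff coeffs_smooth[OF a] coeffs_smooth[OF adjoint_coeffs[OF a]])
  then show "monomial 0 (divergence k a) \<in> op_coeffs k Line" by (intro monomial_Line) simp_all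
  assume f: "f \<in> Diffeo Line"
  have "divergence k (cact k 0 1 f a) y = divergence k a (inv f y) * deriv (inv f) y" for y
    using divergence_cact[OF a f, of "inv f y"] deriv_inv_Diffeo[OF f, of y]
    by (simp add: DiffeoD(6)[OF f] divide_inverse)
  then show "monomial 0 (divergence k (cact k 0 1 f a)) = cact k 0 1 f (monomial 0 (divergence k a))"
    unfolding cact_01_monomial_0[OF f] by (simp add: monomial_def fun_eq_iff)
qed (auto simp: divergence_def adjoint_linear[unfolded cadd_def csmul_def] monomial_def cadd_def csmul_def
    fun_eq_iff algebra_simps)

lemma adjoint_monomial:
  assumes "n \<le> k"
  shows "formal_adjoint k (monomial n q) j x = (if j \<le> n then (-1) ^ n * real (n choose j) * nderiv (n - j) q x else 0)"
proof -
  have "monomial n q i = (if i = n then q else (\<lambda>x. 0))" for i by (auto simp: monomial_def)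
  then have "formal_adjoint k (monomial n q) j x = (\<Sum>i\<le>k. if i = n then (if j \<le> n then (-1) ^ n * real (n choose j) * nderiv (n - j) q x else 0) else 0)"
    unfolding formal_adjoint_def by (intro sum.cong) (auto simp: nderiv_const)
  then show ?thesis using assms by simp
qed

lemma potential_monomial:
  "1 \<le> k \<Longrightarrow> potential k (monomial 1 q) x = q x"
proof -
  assume k: "1 \<le> k"
  have "monomial 1 q i = (if i = 1 then q else (\<lambda>x. 0))" for i by (auto simp: monomial_def)
  then have "potential k (monomial 1 q) x = (\<Sum>i\<in>{1..k}. if i = 1 then q x else 0)"
    unfolding potential_def by (intro sum.cong) (auto simp: nderiv_const)
  then show ?thesis using k by simp
qed

lemma eig_generators:
  assumes k: "1 \<le> k" and i: "i \<le> k"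
  shows "eig i (end_id k) = 1" "eig i (end_adj k) = (-1) ^ i" "eig i (end_0 k) = (if i = 0 then 1 else 0)"
    "eig i (end_pot k) = (if i = 1 then 1 else 0)" "eig i (end_div k) = 0"
proof -
  have m: "(monomial i (\<lambda>x. 1) :: rcoeffs) \<in> op_coeffs k Line" by (rule monomial_Line[OF i smooth_const])
  show "eig i (end_id k) = 1" "eig i (end_0 k) = (if i = 0 then 1 else 0)"
    using m by (auto simp: eig_def end_id_def end_0_def) (simp_all add: monomial_def)
  show "eig i (end_adj k) = (-1) ^ i"
    using m by (simp add: eig_def end_adj_def adjoint_monomial[OF i])
  show "eig i (end_pot k) = (if i = 1 then 1 else 0)"
    using m potential_monomial[OF k, of "\<lambda>x. 1" 0] by (auto simp: eig_def end_pot_def) (simp_all add: monomial_def)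
  show "eig i (end_div k) = 0"
  proof (cases "i = 0")
    case True
    have "divergence k (monomial 0 (\<lambda>x. 1)) 0 = 0"
      unfolding divergence_def adjoint_monomial[OF le0] by (simp add: monomial_def)
    then show ?thesis using m True by (simp add: eig_def end_div_def) (simp add: monomial_def)
  next
    case False
    then show ?thesis using m by (simp add: eig_def end_div_def) (simp add: monomial_def)
  qed
qed

lemma cross_generators:
  assumes k: "1 \<le> k"
  shows "cross (end_id k) = 0" "cross (end_adj k) = -1" "cross (end_0 k) = 0"
    "cross (end_pot k) = 0" "cross (end_div k) = 1"
proof -
  define D :: rcoeffs where "D = monomial 1 (\<lambda>x. x)"
  have D: "D \<in> op_coeffs k Line" unfolding D_def by (rule monomial_Line[OF k smooth_ident])
  have D0: "D 0 x = 0" for x by (simp add: D_def monomial_def)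
  \<comment> \<open>The adjoint of x d is -x d - 1.\<close>
  have aD: "formal_adjoint k D 0 0 = -1" unfolding D_def adjoint_monomial[OF k] by simp
  show "cross (end_id k) = 0" "cross (end_adj k) = -1" "cross (end_0 k) = 0"
    "cross (end_pot k) = 0" "cross (end_div k) = 1"
    unfolding cross_def D_def[symmetric] end_id_def end_adj_def end_0_def end_pot_def end_div_def
    using D D0 aD by (simp_all add: monomial_def divergence_def)
qed

section \<open>The case (0, 1)\<close>

text \<open>The rows (c_1, 0) and (e, c_0) follow the product formula in
  \<open>cross_linear\<close>; c_2 and c_3 multiply independently.\<close>

definition invariants :: "nat \<Rightarrow> (rcoeffs \<Rightarrow> rcoeffs) \<Rightarrow> (real^2^2) \<times> (nat \<Rightarrow> real)" where
  "invariants n T = ((\<chi> i j. if i = 0 then (if j = 0 then eig 1 T else 0) else (if j = 0 then cross T else eig 0 T)),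
     (\<lambda>i. if i < n then eig (i + 2) T else 0))"

text \<open>The index type has two elements and counts modulo 2, which turns sums and quantifiers
  over 1 and 2 into ones over 0 and 1.\<close>

lemma two_eq_zero: "(2 :: 2) = 0"
  by simp

lemma forall_2': "(\<forall>i::2. P i) \<longleftrightarrow> P 0 \<and> P 1"
  using forall_2[of P] two_eq_zero by auto

lemma sum_2': "sum f (UNIV :: 2 set) = f 0 + f 1" for f :: "2 \<Rightarrow> real"
  using sum_2[of f] two_eq_zero by (simp add: add.commute)

text \<open>Here n counts the orders among 2 and 3 that do not exceed k.\<close>

lemma Cend_alg_iso_t2_plus_Rn:
  assumes k: "1 \<le> k" and n: "n = min (k - 1) 2"
  shows "alg_isomorphic (Cend_alg k (0::real) 1 Line) (t2_plus_Rn n)"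
proof -
  have acar: "acar (Cend_alg k (0::real) 1 Line) = Cend k 0 1 Line"
    by (simp add: Cend_alg_def equiv_end_alg_def Cend_def)
  have aadd: "aadd (Cend_alg k (0::real) 1 Line) S T = restrict (\<lambda>A. cadd (S A) (T A)) (op_coeffs k Line)"
    and amul: "amul (Cend_alg k (0::real) 1 Line) S T = compose (op_coeffs k Line) S T"
    and asmul: "asmul (Cend_alg k (0::real) 1 Line) c T = restrict (\<lambda>A. csmul c (T A)) (op_coeffs k Line)" for S T c
    by (simp_all add: Cend_alg_def equiv_end_alg_def)
  have k0: "0 \<le> k" by simp
  have nk: "i + 2 \<le> k" if "i < n" for i using that n by linarith
  have inj: "inj_on (invariants n) (Cend k 0 1 Line)"
  proof (rule inj_onI)
    fix S T assume S: "S \<in> Cend k 0 1 Line" and T: "T \<in> Cend k 0 1 Line" and e: "invariants n S = invariants n T"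
    have M: "fst (invariants n S) $ p $ q = fst (invariants n T) $ p $ q" for p q
      unfolding e ..
    note M = M[unfolded invariants_def fst_conv]
    have e1: "eig 1 S = eig 1 T" using M[of 0 0] by simp
    have e0: "eig 0 S = eig 0 T" using M[of 1 1] by simp
    have ec: "cross S = cross T" using M[of 1 0] by simp
    have ei: "eig (i + 2) S = eig (i + 2) T" if "i < n" for i
    proof -
      have "snd (invariants n S) i = snd (invariants n T) i" unfolding e ..
      then show ?thesis using that by (simp add: invariants_def)
    qed
    have eq: "eig i S = eig i T" if "i \<le> k" "i \<le> 3" for i
    proof -
      show ?thesis
      proof (cases "i < 2")
        case True
        then have "i = 0 \<or> i = 1" by linarith
        then show ?thesis using e0 e1 by auto
      next
        case False
        then have "i = (i - 2) + 2" "i - 2 < n" using that n by linarith+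
        then show ?thesis using ei[of "i - 2"] by simp
      qed
    qed
    \<comment> \<open>All scalars of S - T vanish, so \<open>Cend_eq_0I\<close> applies to the
      difference.\<close>
    define T' where "T' = restrict (\<lambda>A. csmul (-1) (T A)) (op_coeffs k Line)"
    have T': "T' \<in> Cend k 0 1 Line" unfolding T'_def by (rule Cend_smul[OF T])
    define U where "U = restrict (\<lambda>A. cadd (S A) (T' A)) (op_coeffs k Line)"
    have U: "U \<in> Cend k 0 1 Line" unfolding U_def by (rule Cend_add[OF S T'])
    have U_eig: "eig i U = 0" if "i \<le> k" "i \<le> 3" for i
      using eig_linear(1)[OF S T' that(1)] eig_linear(2)[OF S T that(1), of "-1"] eq[OF that]
      by (simp add: U_def T'_def)
    have U_cross: "cross U = 0"
      using cross_linear(1)[OF S T' k] cross_linear(2)[OF S T k, of "-1"] ec by (simp add: U_def T'_def)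
    have "S a = T a" if a: "a \<in> op_coeffs k Line" for a
    proof -
      have "U a = (\<lambda>j x. 0)" by (rule Cend_eq_0I[OF U U_eig U_cross a])
      then show ?thesis using a by (simp add: U_def T'_def cadd_def csmul_def fun_eq_iff)
    qed
    moreover have "S \<in> extensional (op_coeffs k Line)" "T \<in> extensional (op_coeffs k Line)"
      using S T by (auto simp: Cend_def equiv_end_def)
    ultimately show "S = T" by (rule extensionalityI[rotated 2])
  qed
  have car: "invariants n T \<in> acar (t2_plus_Rn n)" for T
    by (simp add: invariants_def t2_plus_Rn_def)
  have surj: "\<exists>T\<in>Cend k 0 1 Line. invariants n T = (M, v)" if "(M, v) \<in> acar (t2_plus_Rn n)" for M v
  proof -
    have M01: "M $ 0 $ 1 = 0" and v0: "v i = 0" if "i \<ge> n" for i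
      using that \<open>(M, v) \<in> acar (t2_plus_Rn n)\<close> by (auto simp: t2_plus_Rn_def)
    have M01: "M $ 0 $ 1 = 0" using \<open>(M, v) \<in> acar (t2_plus_Rn n)\<close> by (auto simp: t2_plus_Rn_def)
    \<comment> \<open>Identity and adjoint have scalars 1 and (-1)^i, so these weights give v 0 in
      order 2 and v 1 in order 3; entries of v from n on are 0.\<close>
    define al where "al = (v 0 + v 1) / 2"
    define be where "be = (v 0 - v 1) / 2"
    define P where "P = (\<lambda>S T. restrict (\<lambda>A. cadd (S A) (T A)) (op_coeffs k Line) :: rcoeffs \<Rightarrow> rcoeffs)"
    define Q where "Q = (\<lambda>c T. restrict (\<lambda>A. csmul c (T A)) (op_coeffs k Line) :: rcoeffs \<Rightarrow> rcoeffs)"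
    have P: "P S T \<in> Cend k 0 1 Line" if "S \<in> Cend k 0 1 Line" "T \<in> Cend k 0 1 Line" for S T
      unfolding P_def by (rule Cend_add[OF that])
    have Q: "Q c T \<in> Cend k 0 1 Line" if "T \<in> Cend k 0 1 Line" for c T
      unfolding Q_def by (rule Cend_smul[OF that])
    note gens = end_id_Cend[of k] end_adj_Cend[of k] end_0_Cend[of k] end_pot_Cend[OF k] end_div_Cend[of k]
    have Pe: "eig i (P S T) = eig i S + eig i T" if "S \<in> Cend k 0 1 Line" "T \<in> Cend k 0 1 Line" "i \<le> k" for S T i
      unfolding P_def by (rule eig_linear(1)[OF that])
    have Qe: "eig i (Q c T) = c * eig i T" if "T \<in> Cend k 0 1 Line" "i \<le> k" for T i c
      unfolding Q_def by (rule eig_linear(2)[OF that(1) that])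
    have Pc: "cross (P S T) = cross S + cross T" if "S \<in> Cend k 0 1 Line" "T \<in> Cend k 0 1 Line" for S T
      unfolding P_def by (rule cross_linear(1)[OF that k])
    have Qc: "cross (Q c T) = c * cross T" if "T \<in> Cend k 0 1 Line" for T c
      unfolding Q_def by (rule cross_linear(2)[OF that that k])
    \<comment> \<open>The last three generators touch only c_0, c_1 and e respectively, and correct
      there what the first two contribute.\<close>
    define T where "T = P (Q al (end_id k)) (P (Q be (end_adj k)) (P (Q (M $ 1 $ 1 - al - be) (end_0 k))
        (P (Q (M $ 0 $ 0 - al + be) (end_pot k)) (Q (M $ 1 $ 0 + be) (end_div k)))))"
    have T: "T \<in> Cend k 0 1 Line" unfolding T_def by (intro P Q gens)
    have eT: "eig i T = al * 1 + (be * (-1) ^ i + ((M $ 1 $ 1 - al - be) * (if i = 0 then 1 else 0)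
        + ((M $ 0 $ 0 - al + be) * (if i = 1 then 1 else 0) + (M $ 1 $ 0 + be) * 0)))" if i: "i \<le> k" for i
      unfolding T_def
      by (simp only: Pe Qe P Q gens i eig_generators[OF k i])
    have cT: "cross T = al * 0 + (be * (-1) + ((M $ 1 $ 1 - al - be) * 0
        + ((M $ 0 $ 0 - al + be) * 0 + (M $ 1 $ 0 + be) * 1)))"
      unfolding T_def by (simp only: Pc Qc P Q gens cross_generators[OF k])
    have "(\<chi> i j. if i = 0 then (if j = 0 then eig 1 T else 0) else (if j = 0 then cross T else eig 0 T)) = M"
      using eT[OF k] eT[OF k0] cT M01 by (simp add: vec_eq_iff forall_2')
    moreover have "(if i < n then eig (i + 2) T else 0) = v i" for i
    proof (cases "i < n")
      case True
      have "i = 0 \<or> i = 1" using True n by auto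
      then show ?thesis using True eT[OF nk[OF True]] by (auto simp: al_def be_def field_simps)
    qed (use v0 in simp)
    ultimately have "invariants n T = (M, v)" by (simp add: invariants_def)
    then show ?thesis using T by blast
  qed
  have "bij_betw (invariants n) (Cend k 0 1 Line) (acar (t2_plus_Rn n))"
    unfolding bij_betw_def
  proof (intro conjI inj set_eqI iffI)
    fix x assume "x \<in> acar (t2_plus_Rn n)"
    then show "x \<in> invariants n ` Cend k 0 1 Line" using surj[of "fst x" "snd x"] by auto
  qed (use car in auto)
  moreover have "invariants n (restrict (\<lambda>A. cadd (S A) (T A)) (op_coeffs k Line)) = aadd (t2_plus_Rn n) (invariants n S) (invariants n T)
      \<and> invariants n (compose (op_coeffs k Line) S T) = amul (t2_plus_Rn n) (invariants n S) (invariants n T)"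
    if S: "S \<in> Cend k 0 1 Line" and T: "T \<in> Cend k 0 1 Line" for S T
    using eig_linear(1,3)[OF S T k] eig_linear(1,3)[OF S T k0] cross_linear(1,3)[OF S T k]
      eig_linear(1,3)[OF S T nk]
    by (simp add: invariants_def t2_plus_Rn_def vec_eq_iff forall_2' matrix_matrix_mult_def sum_2' fun_eq_iff)
  moreover have "invariants n (restrict (\<lambda>A. csmul c (T A)) (op_coeffs k Line)) = asmul (t2_plus_Rn n) c (invariants n T)"
    if T: "T \<in> Cend k 0 1 Line" for T c
    using eig_linear(2)[OF T T k] eig_linear(2)[OF T T k0] cross_linear(2)[OF T T k] eig_linear(2)[OF T T nk]
    by (simp add: invariants_def t2_plus_Rn_def vec_eq_iff forall_2' fun_eq_iff)
  ultimately show ?thesis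
    unfolding alg_isomorphic_def acar aadd amul asmul by (intro exI[of _ "invariants n"]) simp
qed

theorem theorem3p6:
  fixes k :: nat and lam mu :: complex
  assumes "k \<ge> 1"
  shows "((lam, mu) \<noteq> (0, 1) \<longrightarrow>
            alg_isomorphic (Ialg k lam mu Line) (Ialg k lam mu Circle))
       \<and> (k \<ge> 3 \<longrightarrow> alg_isomorphic (Ialg k (0::real) 1 Line) (t2_plus_Rn 2))
       \<and> (k = 2 \<longrightarrow> alg_isomorphic (Ialg k (0::real) 1 Line) (t2_plus_Rn 1))
       \<and> (k = 1 \<longrightarrow> alg_isomorphic (Ialg k (0::real) 1 Line) (t2_plus_Rn 0))"
proof -
  have "alg_isomorphic (Ialg k lam mu Line) (Ialg k lam mu Circle)" if "(lam, mu) \<noteq> (0, 1)"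
    by (rule alg_isomorphic_trans[OF Ialg_iso_Cend
          alg_isomorphic_trans[OF Cend_alg_Line_iso_Circle[OF that] Cend_iso_Ialg]])
  moreover have "alg_isomorphic (Ialg k (0::real) 1 Line) (t2_plus_Rn n)" if "n = min (k - 1) 2" for n
    by (rule alg_isomorphic_trans[OF Ialg_iso_Cend Cend_alg_iso_t2_plus_Rn[OF assms that]])
  ultimately show ?thesis by auto
qed

end
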